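(* Let $\alpha,\beta$ be integers with $\alpha\equiv\beta\equiv 7\pmod 9$ and $v_3(\alpha-\beta)=2$. Then $|G_3|=3^{8}$, the nilpotency class of $G_3$ is $5$, $o(a)=o(b)=27$ and $o(c)=9$.
   Context: $G(\alpha,\beta)=\langle A,B\mid A^{[A,B]}=A^{\alpha},\ B^{[B,A]}=B^{\beta}\rangle$ with $[x,y]=x^{-1}y^{-1}xy$, $y^x=x^{-1}yx$, and $C=[A,B]$. The group $G(\alpha,\beta)$ is finite and nilpotent, hence the direct product of its Sylow subgroups; $G_3$ denotes its Sylow $3$-subgroup and $a,b,c$ denote the images of $A,B,C$ under the canonical projection $G(\alpha,\beta)\to G_3$. $v_3$ is the $3$-adic valuation and $o(x)$ the order of $x$. *)

theory Defs
  imports "HOL-Algebra.Algebra" "HOL-Number_Theory.Number_Theory"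
begin

text \<open>A letter is a generator together with an inversion flag (True = inverse).
  Words are lists of letters.\<close>

type_synonym 'g word = "('g \<times> bool) list"

definition winv :: "'g word \<Rightarrow> 'g word" where
  "winv w = rev (map (\<lambda>(g, i). (g, \<not> i)) w)"

definition wpow :: "'g word \<Rightarrow> int \<Rightarrow> 'g word" where
  "wpow w n = (if 0 \<le> n then concat (replicate (nat n) w)
               else concat (replicate (nat (- n)) (winv w)))"

definition wcomm :: "'g word \<Rightarrow> 'g word \<Rightarrow> 'g word" where
  "wcomm x y = winv x @ winv y @ x @ y"

definition wconj :: "'g word \<Rightarrow> 'g word \<Rightarrow> 'g word" where
  "wconj y x = winv x @ y @ x"

inductive pres_eq :: "'g word set \<Rightarrow> 'g word \<Rightarrow> 'g word \<Rightarrow> bool" for R where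
  refl: "pres_eq R w w"
| sym: "pres_eq R u w \<Longrightarrow> pres_eq R w u"
| trans: "pres_eq R u v \<Longrightarrow> pres_eq R v w \<Longrightarrow> pres_eq R u w"
| cancel: "pres_eq R (u @ [(g, i), (g, \<not> i)] @ v) (u @ v)"
| rel: "r \<in> R \<Longrightarrow> pres_eq R (u @ r @ v) (u @ v)"

definition pres_class :: "'g word set \<Rightarrow> 'g word \<Rightarrow> 'g word set" where
  "pres_class R w = {v. pres_eq R w v}"

definition fp_group :: "'g word set \<Rightarrow> ('g word set) monoid" where
  "fp_group R = \<lparr> carrier = range (pres_class R),
                  monoid.mult = (\<lambda>U V. {w. \<exists>x\<in>U. \<exists>y\<in>V. pres_eq R (x @ y) w}),
                  monoid.one = pres_class R [] \<rparr>"

definition wA :: "bool word" where "wA = [(False, False)]"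
definition wB :: "bool word" where "wB = [(True, False)]"

definition Grels :: "int \<Rightarrow> int \<Rightarrow> bool word set" where
  "Grels \<alpha> \<beta> = { wconj wA (wcomm wA wB) @ wpow wA (- \<alpha>),
                  wconj wB (wcomm wB wA) @ wpow wB (- \<beta>) }"

definition Ggrp :: "int \<Rightarrow> int \<Rightarrow> (bool word set) monoid" where
  "Ggrp \<alpha> \<beta> = fp_group (Grels \<alpha> \<beta>)"

definition gA :: "int \<Rightarrow> int \<Rightarrow> bool word set" where
  "gA \<alpha> \<beta> = pres_class (Grels \<alpha> \<beta>) wA"
definition gB :: "int \<Rightarrow> int \<Rightarrow> bool word set" where
  "gB \<alpha> \<beta> = pres_class (Grels \<alpha> \<beta>) wB"
definition gC :: "int \<Rightarrow> int \<Rightarrow> bool word set" where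
  "gC \<alpha> \<beta> = pres_class (Grels \<alpha> \<beta>) (wcomm wA wB)"

text \<open>In a finite nilpotent group G, the Sylow p-subgroup is the set of p-elements,
  the p'-elements form its (normal) complement, and G is their internal direct
  product; the canonical projection sends g to its p-component.\<close>

definition p_elems :: "('a, 'b) monoid_scheme \<Rightarrow> nat \<Rightarrow> 'a set" where
  "p_elems G p = {g \<in> carrier G. \<exists>k. group.ord G g = p ^ k}"

definition p'_elems :: "('a, 'b) monoid_scheme \<Rightarrow> nat \<Rightarrow> 'a set" where
  "p'_elems G p = {g \<in> carrier G. group.ord G g \<noteq> 0 \<and> coprime (group.ord G g) p}"

definition sylow_of_nilpotent :: "('a, 'b) monoid_scheme \<Rightarrow> nat \<Rightarrow> ('a, 'b) monoid_scheme" where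
  "sylow_of_nilpotent G p = G\<lparr>carrier := p_elems G p\<rparr>"

definition sylow_proj :: "('a, 'b) monoid_scheme \<Rightarrow> nat \<Rightarrow> 'a \<Rightarrow> 'a" where
  "sylow_proj G p g = (THE h. h \<in> p_elems G p \<and> (\<exists>q\<in>p'_elems G p. g = h \<otimes>\<^bsub>G\<^esub> q))"

definition gcomm :: "('a, 'b) monoid_scheme \<Rightarrow> 'a \<Rightarrow> 'a \<Rightarrow> 'a" where
  "gcomm H x y = inv\<^bsub>H\<^esub> x \<otimes>\<^bsub>H\<^esub> inv\<^bsub>H\<^esub> y \<otimes>\<^bsub>H\<^esub> x \<otimes>\<^bsub>H\<^esub> y"

text \<open>lcs H 0 = gamma_1(H) = H, lcs H (n+1) = [lcs H n, H].\<close>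

fun lcs :: "('a, 'b) monoid_scheme \<Rightarrow> nat \<Rightarrow> 'a set" where
  "lcs H 0 = carrier H"
| "lcs H (Suc n) = generate H {gcomm H x y | x y. x \<in> lcs H n \<and> y \<in> carrier H}"

definition nilpotency_class :: "('a, 'b) monoid_scheme \<Rightarrow> nat" where
  "nilpotency_class H = (LEAST n. lcs H n = {\<one>\<^bsub>H\<^esub>})"

end

theory Submission
  imports Defs
begin

text \<open>
  The commutator \<open>C\<close> normalises the cyclic groups generated by \<open>A\<close> and by \<open>B\<close>. Conjugating \<open>A\<close> by
  \<open>B ^ (\<beta> ^ j)\<close>, which is \<open>B\<close> conjugated by a power of \<open>C\<close>, in two ways yields for every \<open>j\<close> a
  relation between powers of \<open>A\<close>, \<open>B\<close> and \<open>C\<close>; commuting it with \<open>C\<close> produces a central power of \<open>A\<close>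
  and so an explicit multiple of the order of \<open>A\<close>. Comparing these multiples over all \<open>j\<close>, every
  prime divisor of the order of \<open>A\<close> divides \<open>\<alpha> - 1\<close>, and likewise for \<open>B\<close>. This forces parts of
  \<open>A\<close> and \<open>B\<close> of coprime orders to commute, so the group is the direct product of the subgroup
  \<open>P\<close> generated by the 3-parts \<open>a\<close>, \<open>b\<close> and a subgroup \<open>Q\<close> of order prime to 3.

  In \<open>P\<close> the relation for \<open>j = 2\<close> expresses \<open>c ^ (9 * w)\<close>, with \<open>w\<close> prime to 3, through \<open>a ^ 27\<close> and
  \<open>b ^ 27\<close>, and a few further commutators give \<open>a ^ 27 = b ^ 27 = c ^ 9 = 1\<close>. Every element of \<open>P\<close> has
  the form \<open>b ^ j * c ^ k * a ^ i\<close>, so \<open>P\<close> has at most \<open>3 ^ 8\<close> elements. Equality holds because the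
  group acts on \<open>27 * 9\<close> points in two ways, one being the mirror image of the other under
  \<open>A \<leftrightarrow> B\<close>. The lower central series can then be read off from the commutators of
  powers of \<open>a\<close>, \<open>b\<close> and \<open>c\<close>.
\<close>

section \<open>Geometric sums\<close>

text \<open>Neither finiteness nor nilpotency of the presented group is given, and the Sylow
  subgroup is defined as the set of elements of 3-power order; so almost nothing can be said about
  it before the whole group has been split into two commuting factors. The relation for
  \<open>j = 2\<close> is convenient because \<open>\<alpha> ^ 2\<close> and
  \<open>\<beta> ^ 2\<close> are natural numbers whatever the signs. The powers of \<open>C\<close>
  in it differ by \<open>\<beta> ^ 2 - \<alpha> ^ 2 = (\<beta> - \<alpha>) * (\<beta> +
  \<alpha>)\<close>, of 3-adic valuation exactly 2, which is where \<open>c ^ (9 * w)\<close> comes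
  from. The lower bound needs two actions because each one is on the cosets of a cyclic subgroup:
  every power of \<open>b\<close> fixes its own coset, so evaluation at that coset recovers the
  exponents of \<open>c\<close> and \<open>a\<close> in a normal form, but not that of
  \<open>b\<close>.\<close>

definition gsum :: "int \<Rightarrow> nat \<Rightarrow> int" where
  "gsum x n = (\<Sum>i<n. x ^ i)"

lemma gsum_0 [simp]: "gsum x 0 = 0"
  by (simp add: gsum_def)

lemma gsum_Suc: "gsum x (Suc n) = 1 + x * gsum x n"
  by (simp add: gsum_def sum.lessThan_Suc_shift sum_distrib_left del: sum.lessThan_Suc)

lemma gsum_eq: "(x - 1) * gsum x n = x ^ n - 1"
  by (induction n) (simp_all add: gsum_Suc algebra_simps)

lemma gsum_add: "gsum x (m + n) = gsum x m + x ^ m * gsum x n"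
  by (induction m) (simp_all add: gsum_Suc algebra_simps)

lemma gsum_mult: "gsum x (m * n) = gsum x m * gsum (x ^ m) n"
  by (induction n) (simp_all add: gsum_Suc gsum_add algebra_simps)

lemma gsum_cong: "[x = y] (mod m) \<Longrightarrow> [gsum x n = gsum y n] (mod m)"
  unfolding gsum_def by (intro cong_sum cong_pow)

lemma gsum_one [simp]: "gsum 1 n = int n"
  by (simp add: gsum_def)

text \<open>One prime is split off at a time: \<open>gsum x (n * p)\<close> is
  \<open>gsum x n\<close> times \<open>gsum (x ^ n) p\<close>, and the latter has \<open>p\<close>
  terms, each congruent to 1 modulo \<open>p\<close>.\<close>

lemma dvd_gsum:
  assumes "n > 0" and "\<And>p. Factorial_Ring.prime p \<Longrightarrow> p dvd n \<Longrightarrow> [x = 1] (mod int p)"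
  shows "int n dvd gsum x n"
  using assms
proof (induction n rule: prime_divisors_induct)
  case (factor p n)
  have "[x ^ n = 1 ^ n] (mod int p)"
    using factor by (intro cong_pow) auto
  hence "[gsum (x ^ n) p = gsum 1 p] (mod int p)"
    by (intro gsum_cong) simp
  hence "int p dvd gsum (x ^ n) p"
    by (simp add: cong_dvd_iff)
  moreover have "int n dvd gsum x n"
    using factor by auto
  ultimately show ?case
    by (simp add: gsum_mult[of x n p] mult.commute[of p n] mult_dvd_mono)
qed (auto simp: gsum_Suc)

lemma dvd_gsum_mult:
  assumes "n > 0" and "\<And>p. Factorial_Ring.prime p \<Longrightarrow> p dvd n \<Longrightarrow> [x = 1] (mod int p)" and "n dvd k"
  shows "int n dvd gsum x k"
proof -
  obtain l where "k = n * l" using assms(3) by blast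
  thus ?thesis using dvd_gsum[OF assms(1,2)] by (simp add: gsum_mult)
qed

text \<open>If \<open>x\<close> were not \<open>1\<close> modulo \<open>p\<close>, of order \<open>e > 1\<close> say, the hypothesis would make \<open>x ^ j\<close> modulo \<open>e\<close>
  determine \<open>j\<close> modulo \<open>e\<close>. Then \<open>j \<mapsto> x ^ j mod e\<close> permutes the residues modulo \<open>e\<close>, so some power of
  \<open>x\<close> vanishes modulo \<open>e\<close>, and so does the next one.\<close>

lemma prime_dvd_of_iterated_powers:
  fixes p x :: nat
  assumes p: "Factorial_Ring.prime p" and px: "\<not> p dvd x"
    and eq: "\<And>j. [int x ^ (x ^ j) * (int x + int (x ^ j) - int (x ^ j) * int x) = int x] (mod int p)"
  shows "[int x = 1] (mod int p)"
proof (rule ccontr)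
  assume not1: "\<not> [int x = 1] (mod int p)"
  have cop: "coprime p x"
    using p px by (simp add: prime_imp_coprime)
  define e where "e = ord p x"
  have epos: "e > 0" using cop by (simp add: e_def)
  have pow_eq: "[x ^ i = x ^ j] (mod p) \<longleftrightarrow> [i = j] (mod e)" for i j
    using cop by (simp add: e_def order_divides_expdiff coprime_commute)
  \<comment> \<open>Exponents congruent modulo \<open>e\<close> give \<open>x ^ m = x ^ n\<close>
    modulo \<open>p\<close>, and this factor cancels from the hypothesis. What is left is affine in
    \<open>m\<close> with slope \<open>1 - x\<close>, a unit modulo \<open>p\<close>, so
    \<open>m = n\<close> modulo \<open>p\<close>, that is, \<open>x ^ i = x ^ j\<close> modulo
    \<open>p\<close>.\<close>
  have key: "[i = j] (mod e)" if "[x ^ i = x ^ j] (mod e)" for i j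
  proof -
    define m n where "m = x ^ i" and "n = x ^ j"
    have "[x ^ m = x ^ n] (mod p)" using that pow_eq by (simp add: m_def n_def)
    hence "[int x ^ m = int x ^ n] (mod int p)"
      by (metis cong_int_iff of_nat_power)
    hence "[int x ^ m * (int x + int m - int m * int x) = int x ^ m * (int x + int n - int n * int x)] (mod int p)"
      using eq[of i] eq[of j]
      by (smt (verit, best) cong_scalar_right cong_sym cong_trans m_def n_def)
    moreover have "coprime (int x ^ m) (int p)"
      using cop by (simp add: coprime_commute)
    ultimately have "[int x + int m - int m * int x = int x + int n - int n * int x] (mod int p)"
      using cong_mult_lcancel by blast
    hence "int p dvd (int m - int n) * (1 - int x)"
      by (simp add: cong_iff_dvd_diff algebra_simps)
    moreover have "\<not> int p dvd 1 - int x"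
      using not1 by (metis cong_iff_dvd_diff cong_sym)
    ultimately have "int p dvd int m - int n"
      using p prime_dvd_multD[of "int p"] by auto
    hence "[m = n] (mod p)"
      by (simp add: cong_iff_dvd_diff flip: cong_int_iff)
    thus ?thesis using pow_eq by (simp add: m_def n_def)
  qed
  have inj: "inj_on (\<lambda>j. x ^ j mod e) {..<e}"
  proof (rule inj_onI)
    fix i j assume "i \<in> {..<e}" "j \<in> {..<e}" "x ^ i mod e = x ^ j mod e"
    thus "i = j" using key[of i j] by (simp add: cong_def)
  qed
  moreover have "(\<lambda>j. x ^ j mod e) ` {..<e} \<subseteq> {..<e}"
    using epos by auto
  ultimately have "(\<lambda>j. x ^ j mod e) ` {..<e} = {..<e}"
    by (simp add: endo_inj_surj)
  then obtain j where "x ^ j mod e = 0"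
    using epos by (metis (no_types, lifting) imageE lessThan_iff)
  hence "[x ^ Suc j = x ^ j] (mod e)"
    by (simp add: cong_def mod_mult_right_eq[symmetric, of x])
  hence "[1 + j = 0 + j] (mod e)" using key[of "Suc j" j] by simp
  hence "e = 1" by (simp only: cong_add_rcancel_nat cong_0_iff) simp
  hence "[x = 1] (mod p)" using ord_works[of x p] by (simp add: e_def)
  thus False using not1 by (metis cong_int_iff of_nat_1)
qed

section \<open>Relations in the Macdonald group\<close>

lemma (in group) inv_cancel_left [simp]:
  assumes "x \<in> carrier G" "y \<in> carrier G"
  shows "x \<otimes> (inv x \<otimes> y) = y" "inv x \<otimes> (x \<otimes> y) = y"
  using assms by (simp_all flip: m_assoc)

lemma (in group) intertwine_inv:
  assumes "c \<in> carrier G" "x \<in> carrier G" "y \<in> carrier G"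
  shows "c \<otimes> x = y \<otimes> c \<longleftrightarrow> x \<otimes> inv c = inv c \<otimes> y"
proof
  assume "c \<otimes> x = y \<otimes> c"
  hence "inv c \<otimes> (c \<otimes> x) \<otimes> inv c = inv c \<otimes> (y \<otimes> c) \<otimes> inv c" by simp
  thus "x \<otimes> inv c = inv c \<otimes> y" using assms by (simp add: m_assoc)
next
  assume "x \<otimes> inv c = inv c \<otimes> y"
  hence "c \<otimes> (x \<otimes> inv c) \<otimes> c = c \<otimes> (inv c \<otimes> y) \<otimes> c" by simp
  thus "c \<otimes> x = y \<otimes> c" using assms by (simp add: m_assoc)
qed

lemma (in group) int_pow_intertwine:
  assumes "x \<in> carrier G" "y \<in> carrier G" "z \<in> carrier G" and eq: "x \<otimes> y = y \<otimes> z"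
  shows "x [^] (i::int) \<otimes> y = y \<otimes> z [^] i"
proof -
  have nat_case: "x [^] n \<otimes> y = y \<otimes> z [^] n" for n :: nat
  proof (induction n)
    case 0
    show ?case using assms(2) by simp
  next
    case (Suc n)
    have "x [^] Suc n \<otimes> y = x [^] n \<otimes> (x \<otimes> y)"
      using assms(1,2) by (simp add: m_assoc)
    also have "\<dots> = (x [^] n \<otimes> y) \<otimes> z"
      unfolding eq using assms(1-3) by (simp add: m_assoc)
    also have "\<dots> = y \<otimes> z [^] Suc n"
      unfolding Suc.IH using assms(1-3) by (simp add: m_assoc)
    finally show ?case .
  qed
  show ?thesis
  proof (cases i rule: int_cases2)
    case (nonneg n)
    show ?thesis unfolding nonneg int_pow_int by (rule nat_case)
  next
    case (nonpos n)
    have "inv (x [^] n) \<otimes> (x [^] n \<otimes> y) \<otimes> inv (z [^] n) = inv (x [^] n) \<otimes> (y \<otimes> z [^] n) \<otimes> inv (z [^] n)"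
      unfolding nat_case ..
    hence "inv (x [^] n) \<otimes> y = y \<otimes> inv (z [^] n)"
      using assms(1-3) by (simp add: m_assoc)
    thus ?thesis using assms(1,3) by (simp add: nonpos int_pow_neg int_pow_int)
  qed
qed

lemma (in group) int_pow_mult_assoc:
  assumes "x \<in> carrier G" "y \<in> carrier G"
  shows "x [^] (i::int) \<otimes> (x [^] (j::int) \<otimes> y) = x [^] (i + j) \<otimes> y"
  using assms by (simp add: int_pow_mult m_assoc)

lemma (in group) int_pow_cong:
  assumes "x \<in> carrier G" "x [^] (n::int) = \<one>" "[i = j] (mod n)"
  shows "x [^] i = x [^] j"
proof -
  obtain k where "i = j + n * k"
    using cong_sym[OF assms(3)] unfolding cong_iff_lin by blast
  hence "x [^] i = x [^] j \<otimes> (x [^] n) [^] k"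
    using assms(1) by (simp add: int_pow_mult int_pow_pow)
  thus ?thesis using assms by simp
qed

text \<open>Both relations are written without inverses, ready for moving powers past each other. In
  the second one \<open>[B, A]\<close> is the inverse of \<open>C\<close>, so \<open>C\<close> acts
  on \<open>A\<close> and on \<open>B\<close> from opposite sides. \<open>A\<close> and
  \<open>B\<close> need not generate \<open>G\<close>, so that their 3-parts can be a further
  instance in the same group.\<close>

locale macdonald = group G for G (structure) +
  fixes A B :: 'a and \<alpha> \<beta> :: int
  assumes A_closed [simp]: "A \<in> carrier G"
    and B_closed [simp]: "B \<in> carrier G"
    and A_gcomm: "A \<otimes> gcomm G A B = gcomm G A B \<otimes> A [^] \<alpha>"
    and gcomm_B: "gcomm G A B \<otimes> B = B [^] \<beta> \<otimes> gcomm G A B"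
begin

abbreviation C where "C \<equiv> gcomm G A B"

lemma C_closed [simp]: "C \<in> carrier G"
  by (simp add: gcomm_def)

lemma A_B: "A \<otimes> B = B \<otimes> (A \<otimes> C)"
  by (simp add: gcomm_def m_assoc)

lemma gcomm_swap: "gcomm G B A = inv C"
  by (simp add: gcomm_def m_assoc inv_mult_group)

text \<open>The symmetry of the presentation: exchanging the generators inverts \<open>C\<close>.
  Every fact about \<open>A\<close> below yields one about \<open>B\<close> in this way.\<close>

lemma macdonald_swap: "macdonald G B A \<beta> \<alpha>"
proof unfold_locales
  show "B \<otimes> gcomm G B A = gcomm G B A \<otimes> B [^] \<beta>"
    using gcomm_B unfolding gcomm_swap by (simp add: intertwine_inv)
  show "gcomm G B A \<otimes> A = A [^] \<alpha> \<otimes> gcomm G B A"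
    using A_gcomm intertwine_inv[of C "A [^] \<alpha>" A] unfolding gcomm_swap by simp
qed auto

text \<open>Only nonnegative powers of \<open>C\<close> are moved, as the other direction would need
  an inverse of \<open>\<alpha>\<close> modulo the order of \<open>A\<close>. This is why natural
  representatives of exponents are chosen so often later.\<close>

lemma A_pow_C_pow: "A [^] (i::int) \<otimes> C [^] int n = C [^] int n \<otimes> A [^] (i * \<alpha> ^ n)"
proof (induction n arbitrary: i)
  case (Suc n)
  have "A [^] i \<otimes> C = C \<otimes> (A [^] \<alpha>) [^] i"
    by (rule int_pow_intertwine) (use A_gcomm in auto)
  hence 1: "A [^] i \<otimes> C = C \<otimes> A [^] (i * \<alpha>)"
    by (simp add: int_pow_pow mult.commute)
  have S: "C [^] int (Suc n) = C \<otimes> C [^] int n"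
    using int_pow_mult[of C 1 "int n"] by simp
  have "A [^] i \<otimes> C [^] int (Suc n) = (A [^] i \<otimes> C) \<otimes> C [^] int n"
    unfolding S by (simp add: m_assoc)
  also have "\<dots> = C \<otimes> (A [^] (i * \<alpha>) \<otimes> C [^] int n)"
    unfolding 1 by (simp add: m_assoc)
  also have "\<dots> = C [^] int (Suc n) \<otimes> A [^] (i * \<alpha> ^ Suc n)"
    unfolding S Suc.IH by (simp add: m_assoc mult_ac)
  finally show ?case .
qed simp

lemma C_pow_B_pow: "C [^] int n \<otimes> B [^] (i::int) = B [^] (i * \<beta> ^ n) \<otimes> C [^] int n"
proof -
  interpret swap: macdonald G B A \<beta> \<alpha> by (rule macdonald_swap)
  have "B [^] i \<otimes> inv (C [^] int n) = inv (C [^] int n) \<otimes> B [^] (i * \<beta> ^ n)"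
    using swap.A_pow_C_pow[of i n] unfolding gcomm_swap by (simp add: int_pow_inv)
  thus ?thesis
    by (simp add: intertwine_inv)
qed

lemma A_C_pow: "(A \<otimes> C) [^] int n = C [^] int n \<otimes> A [^] (\<alpha> * gsum \<alpha> n)"
proof (induction n)
  case (Suc n)
  have "(A \<otimes> C) [^] int (Suc n) = (A \<otimes> C) [^] int n \<otimes> (A \<otimes> C)"
    using int_pow_mult[of "A \<otimes> C" "int n" 1] by (simp add: add.commute)
  also have "\<dots> = C [^] int n \<otimes> (A [^] (\<alpha> * gsum \<alpha> n + 1) \<otimes> C [^] int 1)"
    unfolding Suc.IH by (simp add: m_assoc int_pow_mult)
  also have "\<dots> = C [^] int n \<otimes> (C [^] int 1 \<otimes> A [^] (\<alpha> * gsum \<alpha> (Suc n)))"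
    unfolding A_pow_C_pow by (simp add: gsum_Suc algebra_simps)
  also have "\<dots> = C [^] int (Suc n) \<otimes> A [^] (\<alpha> * gsum \<alpha> (Suc n))"
    by (subst int_pow_mult_assoc) (simp_all add: add.commute)
  finally show ?case .
qed simp

text \<open>The conjugate of \<open>A\<close> by \<open>B\<close> is \<open>A \<otimes> C\<close>,
  whose powers have just been computed.\<close>

lemma A_pow_B: "A [^] int n \<otimes> B = B \<otimes> (C [^] int n \<otimes> A [^] (\<alpha> * gsum \<alpha> n))"
  using int_pow_intertwine[of A B "A \<otimes> C" "int n"] by (simp add: A_B A_C_pow)

lemma B_pow_A: "B [^] int n \<otimes> A = A \<otimes> (C [^] (- int n) \<otimes> B [^] (\<beta> * gsum \<beta> n))"
proof -
  interpret swap: macdonald G B A \<beta> \<alpha> by (rule macdonald_swap)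
  show ?thesis
    using swap.A_pow_B[of n] unfolding gcomm_swap by (simp add: int_pow_inv int_pow_neg)
qed

text \<open>The exponent of \<open>B\<close> that remains when \<open>A\<close> is conjugated by
  \<open>B [^] n\<close>: moving \<open>B [^] n\<close> past \<open>A\<close> leaves
  \<open>- \<beta> * gsum \<beta> n\<close>, and moving it past \<open>C [^] n\<close> adds
  \<open>n * \<beta> ^ n\<close>.\<close>

definition conj_exp :: "nat \<Rightarrow> int" where
  "conj_exp n = int n * \<beta> ^ n - \<beta> * gsum \<beta> n"

lemma A_B_pow: "A \<otimes> B [^] int n = B [^] int n \<otimes> (A \<otimes> (B [^] conj_exp n \<otimes> C [^] int n))"
proof -
  have "B [^] int n \<otimes> (A \<otimes> (B [^] conj_exp n \<otimes> C [^] int n))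
     = (B [^] int n \<otimes> A) \<otimes> (B [^] (- (\<beta> * gsum \<beta> n)) \<otimes> (B [^] (int n * \<beta> ^ n) \<otimes> C [^] int n))"
    by (simp add: int_pow_mult_assoc m_assoc conj_exp_def)
  also have "\<dots> = A \<otimes> (C [^] (- int n) \<otimes> (B [^] (\<beta> * gsum \<beta> n) \<otimes> (B [^] (- (\<beta> * gsum \<beta> n)) \<otimes> (C [^] int n \<otimes> B [^] int n))))"
    unfolding B_pow_A C_pow_B_pow by (simp add: m_assoc)
  also have "\<dots> = A \<otimes> B [^] int n"
    by (simp add: int_pow_mult_assoc)
  finally show ?thesis by simp
qed

text \<open>Both sides come from \<open>A\<close> conjugated by \<open>B [^] m = C [^] j \<otimes> B \<otimes> C [^] (- j)\<close>.\<close>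

lemma power_relation:
  assumes n: "\<alpha> ^ j = int n" and m: "\<beta> ^ j = int m"
  shows "B [^] conj_exp m \<otimes> C [^] int (m + j) = C [^] int (n + j) \<otimes> A [^] (\<alpha> * gsum \<alpha> n - \<alpha> ^ (n + j))"
proof -
  let ?S = "\<alpha> * gsum \<alpha> n"
  have "B [^] int m \<otimes> (A \<otimes> (B [^] conj_exp m \<otimes> C [^] int (m + j))) = (A \<otimes> B [^] int m) \<otimes> C [^] int j"
    unfolding A_B_pow by (simp add: m_assoc int_pow_mult)
  also have "\<dots> = A [^] (1::int) \<otimes> C [^] int j \<otimes> B"
    using C_pow_B_pow[of j 1] by (simp add: m m_assoc)
  also have "\<dots> = C [^] int j \<otimes> (A [^] int n \<otimes> B)"
    unfolding A_pow_C_pow by (simp add: n m_assoc)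
  also have "\<dots> = (C [^] int j \<otimes> B [^] (1::int)) \<otimes> (C [^] int n \<otimes> A [^] ?S)"
    unfolding A_pow_B by (simp add: m_assoc)
  also have "\<dots> = B [^] int m \<otimes> (C [^] int (n + j) \<otimes> A [^] ?S)"
    unfolding C_pow_B_pow by (simp add: m m_assoc int_pow_mult_assoc add.commute)
  finally have "A \<otimes> (B [^] conj_exp m \<otimes> C [^] int (m + j)) = C [^] int (n + j) \<otimes> A [^] ?S"
    by simp
  \<comment> \<open>The power \<open>\<alpha> ^ (n + j)\<close> of \<open>A\<close> is split off
    because it turns into a single \<open>A\<close> on the left of \<open>C [^] int (n + j)\<close>,
    where it cancels.\<close>
  also have "\<dots> = (C [^] int (n + j) \<otimes> A [^] (1 * \<alpha> ^ (n + j))) \<otimes> A [^] (?S - \<alpha> ^ (n + j))"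
    by (simp add: m_assoc flip: int_pow_mult)
  also have "\<dots> = A \<otimes> (C [^] int (n + j) \<otimes> A [^] (?S - \<alpha> ^ (n + j)))"
    unfolding A_pow_C_pow[symmetric] by (simp add: m_assoc)
  finally show ?thesis by simp
qed

end

section \<open>Torsion: finiteness of the orders of \<open>A\<close> and \<open>B\<close>, and their
  prime divisors\<close>

context macdonald
begin

text \<open>Commuting the relation above with \<open>C\<close> identifies a power of \<open>A\<close> with a conjugate of a power of
  \<open>B\<close>; that power \<open>Z\<close> of \<open>A\<close> is then central, and \<open>Z \<otimes> C = C \<otimes> Z [^] \<alpha>\<close>.\<close>

lemma A_pow_torsion:
  assumes n: "\<alpha> ^ j = int n" and m: "\<beta> ^ j = int m"
  shows "A [^] ((\<alpha> - 1) * (\<alpha> ^ n * (\<alpha> + int n - int n * \<alpha>) - \<alpha>)) = \<one>"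
proof -
  define E where "E = \<alpha> * gsum \<alpha> n - \<alpha> ^ (n + j)"
  define k p y where "k = n + j" and "p = m + j" and "y = conj_exp m"
  have rel: "B [^] y \<otimes> C [^] int p = C [^] int k \<otimes> A [^] E"
    using power_relation[OF assms] by (simp add: E_def k_def p_def y_def)
  have C1: "C [^] int (Suc i) = C [^] int i \<otimes> C [^] int 1" "C [^] int (Suc i) = C [^] int 1 \<otimes> C [^] int i" for i
    using int_pow_mult[of C "int i" 1] int_pow_mult[of C 1 "int i"] by (simp_all add: add.commute)
  \<comment> \<open>The relation times \<open>C\<close> on the right (1) and on the left (2). The
    first changes only the power of \<open>A\<close>, the second only that of \<open>B\<close>;
    comparing the two isolates \<open>Z\<close>.\<close>
  have 1: "B [^] y \<otimes> C [^] int (Suc p) = C [^] int (Suc k) \<otimes> A [^] (E * \<alpha>)"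
  proof -
    have "B [^] y \<otimes> C [^] int (Suc p) = C [^] int k \<otimes> (A [^] E \<otimes> C [^] int 1)"
      unfolding C1(1)[of p] by (metis A_closed B_closed C_closed int_pow_closed m_assoc rel)
    thus ?thesis
      unfolding A_pow_C_pow C1(1)[of k] by (simp add: m_assoc)
  qed
  have 2: "B [^] (\<beta> * y) \<otimes> C [^] int (Suc p) = C [^] int (Suc k) \<otimes> A [^] E"
  proof -
    have "C [^] int (Suc k) \<otimes> A [^] E = (C [^] int 1 \<otimes> B [^] y) \<otimes> C [^] int p"
      unfolding C1(2)[of k] by (simp add: m_assoc rel)
    thus ?thesis
      unfolding C_pow_B_pow C1(2)[of p] by (simp add: m_assoc mult.commute)
  qed
  define q Z where "q = int (Suc k)" and "Z = A [^] (E * (1 - \<alpha>))"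
  have Zc [simp]: "Z \<in> carrier G" by (simp add: Z_def)
  have "B [^] ((\<beta> - 1) * y) \<otimes> C [^] q \<otimes> A [^] (E * \<alpha>) = B [^] ((\<beta> - 1) * y) \<otimes> (B [^] y \<otimes> C [^] int (Suc p))"
    unfolding 1 q_def by (simp add: m_assoc)
  also have "\<dots> = B [^] (\<beta> * y) \<otimes> C [^] int (Suc p)"
    by (simp add: int_pow_mult_assoc algebra_simps)
  also have "\<dots> = C [^] q \<otimes> Z \<otimes> A [^] (E * \<alpha>)"
    unfolding 2 q_def Z_def by (simp add: m_assoc algebra_simps flip: int_pow_mult)
  finally have 3: "C [^] q \<otimes> Z = B [^] ((\<beta> - 1) * y) \<otimes> C [^] q"
    by simp
  have CB: "C [^] q \<otimes> B = B [^] (\<beta> ^ Suc k) \<otimes> C [^] q"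
    using C_pow_B_pow[of "Suc k" 1] by (simp add: q_def)
  have "C [^] q \<otimes> (Z \<otimes> B) = B [^] ((\<beta> - 1) * y) \<otimes> (C [^] q \<otimes> B)"
    by (metis "3" B_closed C_closed Zc int_pow_closed m_assoc)
  also have "\<dots> = B [^] (\<beta> ^ Suc k) \<otimes> (C [^] q \<otimes> Z)"
    unfolding CB 3 by (simp add: int_pow_mult_assoc add.commute)
  also have "\<dots> = C [^] q \<otimes> (B \<otimes> Z)"
    by (metis CB B_closed C_closed Zc int_pow_closed m_assoc)
  finally have ZB: "Z \<otimes> B = B \<otimes> Z" by simp
  have ZA: "Z \<otimes> A = A \<otimes> Z"
    using int_pow_mult[of A "E * (1 - \<alpha>)" 1] int_pow_mult[of A 1 "E * (1 - \<alpha>)"] by (simp add: Z_def add.commute)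
  have "Z \<otimes> (A \<otimes> B) = (B \<otimes> A) \<otimes> (Z \<otimes> C)"
    unfolding A_B by (metis A_closed B_closed C_closed ZA ZB Zc m_assoc m_closed)
  moreover have "Z \<otimes> (A \<otimes> B) = (B \<otimes> A) \<otimes> (C \<otimes> Z)"
    by (metis A_B A_closed B_closed C_closed ZA ZB Zc m_assoc m_closed)
  ultimately have "Z \<otimes> C = C \<otimes> Z" by simp
  moreover have "Z \<otimes> C = C \<otimes> A [^] (E * (1 - \<alpha>) * \<alpha>)"
    using A_pow_C_pow[of "E * (1 - \<alpha>)" 1] by (simp add: Z_def)
  ultimately have "A [^] (E * (1 - \<alpha>) * \<alpha>) = A [^] (E * (1 - \<alpha>))"
    by (simp add: Z_def)
  hence "A [^] (E * (1 - \<alpha>) * \<alpha> - E * (1 - \<alpha>)) = \<one>"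
    by (simp add: int_pow_diff)
  moreover have "E * (1 - \<alpha>) * \<alpha> - E * (1 - \<alpha>) = - ((\<alpha> - 1) * ((\<alpha> - 1) * E))"
    by (simp add: algebra_simps)
  \<comment> \<open>The factor \<open>\<alpha> - 1\<close> makes the geometric sum telescope, so the
    torsion exponent becomes a closed expression in \<open>n\<close>.\<close>
  moreover have "(\<alpha> - 1) * E = \<alpha> ^ n * (\<alpha> + int n - int n * \<alpha>) - \<alpha>"
  proof -
    have "(\<alpha> - 1) * E = \<alpha> * ((\<alpha> - 1) * gsum \<alpha> n) - (\<alpha> - 1) * \<alpha> ^ n * int n"
      by (simp add: E_def power_add n algebra_simps)
    thus ?thesis
      unfolding gsum_eq by (simp add: algebra_simps)
  qed
  ultimately show ?thesis
    by (simp add: int_pow_neg)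
qed


text \<open>The torsion exponent for \<open>j = 2\<close> is not 0: otherwise, after division by
  \<open>\<alpha> - 1\<close> and \<open>\<alpha>\<close>, a positive power of
  \<open>\<alpha>\<close> would divide 1.\<close>

lemma ord_A_pos:
  assumes "\<bar>\<alpha>\<bar> \<ge> 2"
  shows "ord A > 0"
proof (rule ccontr)
  assume "\<not> ord A > 0"
  define n where "n = nat (\<alpha> ^ 2)"
  have n: "\<alpha> ^ 2 = int n" by (simp add: n_def)
  have "\<alpha> ^ 2 \<ge> 2 ^ 2"
    using power_mono[OF assms, of 2] by simp
  hence "n > 0" using n by simp
  have "A [^] ((\<alpha> - 1) * (\<alpha> ^ n * (\<alpha> + int n - int n * \<alpha>) - \<alpha>)) = \<one>"
    by (rule A_pow_torsion[OF n, of "nat (\<beta> ^ 2)"]) simp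
  hence D0: "(\<alpha> - 1) * (\<alpha> ^ n * (\<alpha> + int n - int n * \<alpha>) - \<alpha>) = 0"
    using \<open>\<not> ord A > 0\<close> by (simp add: int_pow_eq_id)
  obtain k where k0: "n = Suc k" using \<open>n > 0\<close> by (cases n) auto
  have "\<alpha> * (\<alpha> ^ k * (\<alpha> + int n - int n * \<alpha>) - 1) = 0"
  proof -
    have "\<alpha> ^ n * (\<alpha> + int n - int n * \<alpha>) - \<alpha> = 0"
      using D0 assms by auto
    thus ?thesis using k0 by (simp add: algebra_simps)
  qed
  hence k: "\<alpha> ^ k * (\<alpha> + int n - int n * \<alpha>) = 1"
    using assms by auto
  have "k \<noteq> 0" using \<open>\<alpha> ^ 2 \<ge> 2 ^ 2\<close> n k0 by auto
  hence "\<alpha> dvd 1"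
    unfolding k[symmetric] by (simp add: dvd_mult2 dvd_power)
  thus False using assms by (simp add: zdvd1_eq)
qed

text \<open>Replacing \<open>\<alpha>\<close> and \<open>\<beta>\<close> by natural representatives
  modulo the orders makes \<open>A_pow_torsion\<close> available for every \<open>j\<close>. If
  \<open>p\<close> did not divide \<open>x - 1\<close>, this factor could be cancelled modulo
  \<open>p\<close>, and the congruences that remain are those of
  \<open>prime_dvd_of_iterated_powers\<close>.\<close>

lemma prime_dvd_ord_A:
  assumes A: "ord A > 0" and B: "ord B > 0" and p: "Factorial_Ring.prime p" "p dvd ord A"
  shows "[\<alpha> = 1] (mod int p)"
proof -
  define x y where "x = nat (\<alpha> mod int (ord A))" and "y = nat (\<beta> mod int (ord B))"
  have x: "[int x = \<alpha>] (mod int (ord A))" and y: "[int y = \<beta>] (mod int (ord B))"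
    using A B by (simp_all add: x_def y_def)
  have Ax: "A [^] int x = A [^] \<alpha>" and By: "B [^] int y = B [^] \<beta>"
    by (rule int_pow_cong[OF _ _ x] int_pow_cong[OF _ _ y]; simp add: int_pow_eq_id)+
  interpret pos: macdonald G A B "int x" "int y"
    by unfold_locales (simp_all add: Ax By A_gcomm gcomm_B)
  \<comment> \<open>Otherwise conjugation by \<open>C\<close> would send \<open>A [^] int q\<close>,
    an element of order \<open>p\<close>, to the identity.\<close>
  have "\<not> p dvd x"
  proof
    assume "p dvd x"
    then obtain l where l: "x = p * l" by blast
    obtain q where q: "ord A = p * q" using p(2) by blast
    have "A [^] int q \<otimes> C [^] int 1 = C [^] int 1 \<otimes> A [^] (int q * int x)"
      using pos.A_pow_C_pow[of "int q" 1] by simp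
    also have "A [^] (int q * int x) = \<one>"
      by (simp add: int_pow_eq_id l q)
    finally have "A [^] int q = \<one>"
      by simp
    hence "p * q dvd q" by (simp add: int_pow_eq_id q)
    moreover have "q > 0" using A q by (cases q) auto
    ultimately show False using p(1) by (auto dest: dvd_imp_le simp: prime_nat_iff)
  qed
  have "[int x = 1] (mod int p)"
  proof (rule ccontr)
    assume not1: "\<not> [int x = 1] (mod int p)"
    have "[int x ^ (x ^ j) * (int x + int (x ^ j) - int (x ^ j) * int x) = int x] (mod int p)" for j
    proof -
      have "int (ord A) dvd (int x - 1) * (int x ^ (x ^ j) * (int x + int (x ^ j) - int (x ^ j) * int x) - int x)"
        using pos.A_pow_torsion[of j "x ^ j" "y ^ j"] by (simp add: int_pow_eq_id)
      moreover have "int p dvd int (ord A)" using p(2) by simp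
      ultimately have "int p dvd (int x - 1) * (int x ^ (x ^ j) * (int x + int (x ^ j) - int (x ^ j) * int x) - int x)"
        by (rule dvd_trans[rotated])
      moreover have "\<not> int p dvd int x - 1" using not1 by (simp add: cong_iff_dvd_diff)
      ultimately show ?thesis
        unfolding cong_iff_dvd_diff using p(1) prime_dvd_multD[of "int p"] by auto
    qed
    thus False using prime_dvd_of_iterated_powers[OF p(1) \<open>\<not> p dvd x\<close>] not1 by blast
  qed
  moreover have "[int x = \<alpha>] (mod int p)"
    by (rule cong_dvd_modulus[OF x]) (use p(2) in simp)
  ultimately show ?thesis by (metis cong_sym cong_trans)
qed

text \<open>Conjugating \<open>A [^] int n = \<one>\<close> by \<open>B\<close> gives
  \<open>C [^] int n\<close> times a power of \<open>A\<close> whose exponent is a multiple of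
  \<open>n\<close>.\<close>

lemma C_pow_eq_one:
  assumes "A [^] int n = \<one>" "int n dvd gsum \<alpha> n"
  shows "C [^] int n = \<one>"
proof -
  have "A [^] (\<alpha> * gsum \<alpha> n) = \<one>"
    using assms by (auto simp: int_pow_eq_id intro: dvd_mult dvd_trans)
  hence "B = B \<otimes> C [^] int n"
    using A_pow_B[of n] assms(1) by simp
  thus ?thesis by simp
qed

end

section \<open>Parts of coprime order commute\<close>

text \<open>\<open>N\<close> divides the product of \<open>gcd N u\<close> and
  \<open>gcd N v\<close>. With \<open>N\<close> the order of an element, an exponent is shown to
  vanish by treating its \<open>u\<close>-part and its \<open>v\<close>-part separately.\<close>

lemma dvd_mult_split:
  fixes N u v x y :: int
  assumes "N dvd u * v" "gcd N v dvd x" "gcd N u dvd y"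
  shows "N dvd x * y"
proof -
  have step: "N dvd z * gcd N w" if "N dvd z * w" for z w :: int
  proof -
    have "N dvd gcd (z * N) (z * w)" using that by simp
    hence "N dvd \<bar>z\<bar> * gcd N w" by (simp only: gcd_mult_distrib_int)
    thus ?thesis by (simp add: abs_if split: if_splits)
  qed
  have "N dvd gcd N u * gcd N v"
    using step[of "gcd N u" v] step[of v u] assms(1) by (simp add: mult.commute)
  also have "gcd N u * gcd N v dvd x * y"
    using assms(2,3) by (metis mult.commute mult_dvd_mono)
  finally show ?thesis .
qed

context group
begin

lemma commute_mult:
  assumes "x \<in> carrier G" "y \<in> carrier G" "z \<in> carrier G" "x \<otimes> y = y \<otimes> x" "x \<otimes> z = z \<otimes> x"
  shows "x \<otimes> (y \<otimes> z) = (y \<otimes> z) \<otimes> x"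
  using assms by (metis m_assoc)

lemma commute_pow:
  assumes "x \<in> carrier G" "y \<in> carrier G" "x \<otimes> y = y \<otimes> x"
  shows "x \<otimes> y [^] (i::int) = y [^] i \<otimes> x"
  using int_pow_intertwine[of y x y i] assms by simp

lemma commute_inv:
  assumes "x \<in> carrier G" "y \<in> carrier G" "x \<otimes> y = y \<otimes> x"
  shows "x \<otimes> inv y = inv y \<otimes> x"
  using commute_pow[OF assms, of "-1"] assms by (simp add: int_pow_neg)

lemma commute_gcomm:
  assumes "x \<in> carrier G" "y \<in> carrier G" "z \<in> carrier G" "x \<otimes> y = y \<otimes> x" "x \<otimes> z = z \<otimes> x"
  shows "x \<otimes> gcomm G y z = gcomm G y z \<otimes> x"
  unfolding gcomm_def using assms by (intro commute_mult commute_inv) auto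

text \<open>The hypotheses make the commutator \<open>w\<close> commute with \<open>x\<close> and
  with \<open>y\<close>. Then \<open>w [^] int u\<close> is the commutator of
  \<open>x [^] int u\<close> and \<open>y\<close>, hence trivial, and \<open>w [^] int v\<close> is
  trivial for the mirrored reason.\<close>

lemma commute_of_coprime_pow:
  fixes u v :: nat
  assumes x: "x \<in> carrier G" and y: "y \<in> carrier G"
    and xy: "x \<otimes> (inv y \<otimes> x \<otimes> y) = (inv y \<otimes> x \<otimes> y) \<otimes> x"
    and yx: "y \<otimes> (inv x \<otimes> y \<otimes> x) = (inv x \<otimes> y \<otimes> x) \<otimes> y"
    and u: "x [^] int u = \<one>" and v: "y [^] int v = \<one>" and uv: "coprime u v"
  shows "x \<otimes> y = y \<otimes> x"
proof -
  define w where "w = gcomm G x y"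
  have w [simp]: "w \<in> carrier G" using x y by (simp add: w_def gcomm_def)
  have w1: "w = inv x \<otimes> (inv y \<otimes> x \<otimes> y)" and w2: "w = inv (inv x \<otimes> y \<otimes> x) \<otimes> y"
    using x y by (simp_all add: w_def gcomm_def m_assoc inv_mult_group)
  have xw: "x \<otimes> w = w \<otimes> x"
    unfolding w1 by (rule commute_mult) (use x y xy in simp_all)
  have yw: "y \<otimes> w = w \<otimes> y"
    unfolding w2 by (rule commute_mult[OF y _ y commute_inv[OF y _ yx]]) (use x y in simp_all)
  have "x \<otimes> y = y \<otimes> (x \<otimes> w)"
    using x y by (simp add: w_def gcomm_def m_assoc)
  hence "x [^] int u \<otimes> y = y \<otimes> (x \<otimes> w) [^] int u"
    using x y by (intro int_pow_intertwine) auto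
  hence "w [^] int u = \<one>"
    using x y u xw by (simp add: int_pow_mult_distrib)
  moreover have "y \<otimes> x = x \<otimes> (y \<otimes> inv w)"
    using x y by (simp add: w_def gcomm_def m_assoc inv_mult_group)
  hence "y [^] int v \<otimes> x = x \<otimes> (y \<otimes> inv w) [^] int v"
    using x y by (intro int_pow_intertwine) auto
  hence "w [^] int v = \<one>"
    using x y v commute_inv[OF y w yw] by (simp add: int_pow_mult_distrib int_pow_inv)
  ultimately have "int (ord w) dvd int u" "int (ord w) dvd int v"
    by (simp_all add: int_pow_eq_id)
  hence "ord w = 1"
    using uv by (metis coprime_common_divisor_nat int_dvd_int_iff of_nat_dvd_iff nat_dvd_1_iff_1)
  hence "w = \<one>" by (simp only: ord_eq_1[OF w])
  thus ?thesis using \<open>x \<otimes> y = y \<otimes> (x \<otimes> w)\<close> x by simp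
qed

end

context macdonald
begin

text \<open>Write \<open>a = A [^] r\<close>, \<open>b = B [^] t\<close>. As \<open>C [^] t\<close> commutes with \<open>a\<close> and with its conjugate by \<open>B\<close>, while
  it raises \<open>B\<close> to a power, \<open>a\<close> commutes with \<open>B [^] (\<beta> ^ t - 1)\<close>, and hence with every factor of
  \<open>A \<otimes> (B [^] conj_exp t \<otimes> C [^] t)\<close>, which is \<open>A\<close> conjugated by \<open>b\<close>.\<close>

lemma part_commutes_conjugate:
  fixes u v r t :: nat
  assumes ord: "ord A > 0" "ord B > 0" and A: "ord A dvd u * v" and B: "ord B dvd u * v"
    and "v dvd r" and "u dvd t" and t1: "[t = 1] (mod v)"
  defines "a \<equiv> A [^] int r" and "b \<equiv> B [^] int t"
  shows "a \<otimes> (inv b \<otimes> a \<otimes> b) = (inv b \<otimes> a \<otimes> b) \<otimes> a"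
proof -
  interpret swap: macdonald G B A \<beta> \<alpha> by (rule macdonald_swap)
  have a [simp]: "a \<in> carrier G" and b [simp]: "b \<in> carrier G" by (simp_all add: a_def b_def)
  let ?N = "int (ord A)" and ?M = "int (ord B)"
  have N: "?N dvd int u * int v" and M: "?M dvd int u * int v"
    using A B by (metis int_dvd_int_iff of_nat_mult)+
  have gN: "gcd ?N (int n) dvd gsum \<alpha> k" if "n dvd k" for n k
  proof -
    have "int (gcd (ord A) n) dvd gsum \<alpha> k"
      by (rule dvd_gsum_mult) (use ord that in \<open>auto intro: prime_dvd_ord_A dvd_trans\<close>)
    thus ?thesis by simp
  qed
  have gM: "gcd ?M (int n) dvd gsum \<beta> k" if "n dvd k" for n k
  proof -
    have "int (gcd (ord B) n) dvd gsum \<beta> k"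
      by (rule dvd_gsum_mult) (use ord that in \<open>auto intro: swap.prime_dvd_ord_A dvd_trans\<close>)
    thus ?thesis by simp
  qed
  \<comment> \<open>Here \<open>\<alpha> ^ t - 1 = (\<alpha> - 1) * gsum \<alpha> t\<close> vanishes
    on the \<open>u\<close>-part of the order of \<open>A\<close>, and \<open>k\<close> vanishes on
    its \<open>v\<close>-part.\<close>
  have commC: "A [^] k \<otimes> C [^] int t = C [^] int t \<otimes> A [^] k" if "gcd ?N (int v) dvd k" for k
  proof -
    have "gcd ?N (int u) dvd \<alpha> ^ t - 1"
      using gN[OF \<open>u dvd t\<close>] by (simp flip: gsum_eq)
    hence "?N dvd k * (\<alpha> ^ t - 1)"
      by (rule dvd_mult_split[OF N that])
    hence "A [^] (k * \<alpha> ^ t) = A [^] k"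
      by (intro int_pow_cong[of A ?N]) (simp_all add: int_pow_eq_id cong_iff_dvd_diff algebra_simps)
    thus ?thesis using A_pow_C_pow[of k t] by simp
  qed
  \<comment> \<open>\<open>h\<close> is \<open>a\<close> conjugated by \<open>B\<close>.\<close>
  define q h where "q = \<beta> ^ t" and "h = C [^] int r \<otimes> A [^] (\<alpha> * gsum \<alpha> r)"
  have h [simp]: "h \<in> carrier G" by (simp add: h_def)
  have aC: "a \<otimes> C [^] int t = C [^] int t \<otimes> a"
    unfolding a_def using \<open>v dvd r\<close> by (intro commC) (metis dvd_trans gcd_dvd2 int_dvd_int_iff)
  have hC: "C [^] int t \<otimes> h = h \<otimes> C [^] int t"
    unfolding h_def
  proof (rule commute_mult)
    show "C [^] int t \<otimes> C [^] int r = C [^] int r \<otimes> C [^] int t"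
      by (simp add: add.commute flip: int_pow_mult)
    show "C [^] int t \<otimes> A [^] (\<alpha> * gsum \<alpha> r) = A [^] (\<alpha> * gsum \<alpha> r) \<otimes> C [^] int t"
      by (rule commC[symmetric]) (use gN[OF \<open>v dvd r\<close>] in simp)
  qed auto
  have aB: "a \<otimes> B = B \<otimes> h"
    unfolding a_def h_def by (rule A_pow_B)
  have CB: "C [^] int t \<otimes> B = B [^] q \<otimes> C [^] int t"
    using C_pow_B_pow[of t 1] by (simp add: q_def)
  have "a \<otimes> B [^] q \<otimes> C [^] int t = a \<otimes> C [^] int t \<otimes> B"
    using CB by (simp add: m_assoc)
  also have "\<dots> = C [^] int t \<otimes> B \<otimes> h"
    unfolding aC using aB by (simp add: m_assoc)
  also have "\<dots> = B [^] q \<otimes> h \<otimes> C [^] int t"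
    unfolding CB using hC by (simp add: m_assoc)
  finally have aBq: "a \<otimes> B [^] q = B [^] q \<otimes> h" by simp
  \<comment> \<open>\<open>B\<close> and \<open>B [^] q\<close> conjugate \<open>a\<close> to the
    same element \<open>h\<close>.\<close>
  have "a \<otimes> B [^] (q - 1) = B [^] (q - 1) \<otimes> a"
  proof -
    have Bq: "B [^] q = B [^] (q - 1) \<otimes> B"
      using int_pow_mult[of B "q - 1" 1] by simp
    have "(a \<otimes> B [^] (q - 1)) \<otimes> B = (B [^] (q - 1) \<otimes> a) \<otimes> B"
      using aBq unfolding Bq by (simp add: m_assoc aB)
    thus ?thesis by simp
  qed
  hence comm1: "a \<otimes> B [^] ((q - 1) * k) = B [^] ((q - 1) * k) \<otimes> a" for k
    using commute_pow[of a "B [^] (q - 1)" k] by (simp add: int_pow_pow)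
  \<comment> \<open>Since \<open>q - 1 = (\<beta> - 1) * gsum \<beta> t\<close>, the sum has to be
    inverted. On the \<open>v\<close>-part of the order of \<open>B\<close> it is a unit, being
    congruent to \<open>t\<close>, hence to 1, modulo every prime there; on the
    \<open>u\<close>-part the factor \<open>t\<close> vanishes.\<close>
  have comm2: "a \<otimes> B [^] (int t * (\<beta> - 1) * k) = B [^] (int t * (\<beta> - 1) * k) \<otimes> a" for k
  proof -
    have "coprime (gsum \<beta> t) (int (gcd (ord B) v))"
    proof (rule ccontr)
      assume "\<not> coprime (gsum \<beta> t) (int (gcd (ord B) v))"
      hence "gcd (gsum \<beta> t) (int (gcd (ord B) v)) \<noteq> 1"
        unfolding coprime_iff_gcd_eq_1 .
      hence "nat (gcd (gsum \<beta> t) (int (gcd (ord B) v))) \<noteq> 1"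
        by linarith
      then obtain p where p: "Factorial_Ring.prime p" "p dvd nat (gcd (gsum \<beta> t) (int (gcd (ord B) v)))"
        using prime_factor_nat by blast
      hence "int p dvd gcd (gsum \<beta> t) (int (gcd (ord B) v))"
        by (metis gcd_ge_0_int int_dvd_int_iff int_nat_eq)
      hence pS: "int p dvd gsum \<beta> t" and pB: "p dvd ord B" and pv: "p dvd v"
        by auto
      have "[gsum \<beta> t = gsum 1 t] (mod int p)"
        by (rule gsum_cong[OF swap.prime_dvd_ord_A[OF ord(2,1) p(1) pB]])
      hence "p dvd t" using pS by (simp add: cong_dvd_iff)
      moreover have "[t = 1] (mod p)" using t1 pv by (rule cong_dvd_modulus_nat)
      ultimately have "p dvd 1" by (simp add: cong_dvd_iff)
      thus False using p(1) by simp
    qed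
    then obtain w where "[gsum \<beta> t * w = 1] (mod int (gcd (ord B) v))"
      using cong_solve_coprime_int by blast
    hence "gcd ?M (int v) dvd gsum \<beta> t * w - 1"
      by (simp add: cong_iff_dvd_diff)
    moreover have "gcd ?M (int u) dvd int t"
      using \<open>u dvd t\<close> by (metis dvd_trans gcd_dvd2 int_dvd_int_iff)
    ultimately have "?M dvd (gsum \<beta> t * w - 1) * int t"
      by (rule dvd_mult_split[OF M])
    hence "?M dvd (gsum \<beta> t * w - 1) * int t * ((\<beta> - 1) * k)"
      by (rule dvd_mult2)
    moreover have "(gsum \<beta> t * w - 1) * int t * ((\<beta> - 1) * k) = (q - 1) * (w * int t * k) - int t * (\<beta> - 1) * k"
      unfolding q_def gsum_eq[symmetric] by (simp add: algebra_simps)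
    ultimately have "B [^] ((q - 1) * (w * int t * k)) = B [^] (int t * (\<beta> - 1) * k)"
      by (intro int_pow_cong[of B ?M]) (simp_all add: int_pow_eq_id cong_iff_dvd_diff)
    thus ?thesis using comm1[of "w * int t * k"] by simp
  qed
  have "[conj_exp t = int t * 1 ^ t - 1 * gsum 1 t] (mod (\<beta> - 1))"
    unfolding conj_exp_def by (intro cong_diff cong_mult cong_pow gsum_cong) (simp_all add: cong_iff_dvd_diff)
  hence "\<beta> - 1 dvd conj_exp t" by (simp add: cong_0_iff)
  then obtain k where k: "conj_exp t = (\<beta> - 1) * k" by blast
  \<comment> \<open>Multiplying \<open>conj_exp t\<close> by \<open>t\<close> changes nothing modulo
    the order of \<open>B\<close>: it vanishes on the \<open>u\<close>-part, and \<open>t\<close> is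
    1 on the \<open>v\<close>-part.\<close>
  have "gcd ?M (int u) dvd conj_exp t"
    unfolding conj_exp_def using gM[OF \<open>u dvd t\<close>] \<open>u dvd t\<close>
    by (intro dvd_diff dvd_mult dvd_mult2) (auto intro: dvd_trans[OF gcd_dvd2])
  moreover have "gcd ?M (int v) dvd int t - 1"
    using t1 by (metis cong_iff_dvd_diff cong_int_iff dvd_trans gcd_dvd2 of_nat_1)
  ultimately have "?M dvd (int t - 1) * conj_exp t"
    by (intro dvd_mult_split[OF M])
  hence "B [^] (int t * (\<beta> - 1) * k) = B [^] conj_exp t"
    by (intro int_pow_cong[of B ?M]) (simp_all add: int_pow_eq_id cong_iff_dvd_diff k algebra_simps)
  hence aBs: "a \<otimes> B [^] conj_exp t = B [^] conj_exp t \<otimes> a"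
    using comm2[of k] by simp
  \<comment> \<open>\<open>g\<close> is \<open>A\<close> conjugated by \<open>b\<close>, so
    \<open>g [^] int r\<close> is \<open>a\<close> conjugated by \<open>b\<close>.\<close>
  define g where "g = A \<otimes> (B [^] conj_exp t \<otimes> C [^] int t)"
  have g [simp]: "g \<in> carrier G" by (simp add: g_def)
  have "a \<otimes> g = g \<otimes> a"
    unfolding g_def
  proof (intro commute_mult)
    show "a \<otimes> A = A \<otimes> a"
      unfolding a_def using int_pow_mult[of A 1 "int r"] int_pow_mult[of A "int r" 1] by (simp add: add.commute)
  qed (use aBs aC in auto)
  hence "a \<otimes> g [^] int r = g [^] int r \<otimes> a" by (intro commute_pow) auto
  moreover have "a \<otimes> b = b \<otimes> g [^] int r"
    unfolding a_def b_def using A_B_pow[of t] by (intro int_pow_intertwine) (auto simp: g_def)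
  hence "inv b \<otimes> a \<otimes> b = g [^] int r" by (simp add: m_assoc)
  ultimately show ?thesis by simp
qed

lemma coprime_parts_commute:
  fixes u v r t :: nat
  assumes ord: "ord A > 0" "ord B > 0" and A: "ord A dvd u * v" and B: "ord B dvd u * v"
    and uv: "coprime u v"
    and r: "v dvd r" "[r = 1] (mod u)" and t: "u dvd t" "[t = 1] (mod v)"
  shows "A [^] int r \<otimes> B [^] int t = B [^] int t \<otimes> A [^] int r"
proof (rule commute_of_coprime_pow[OF _ _ _ _ _ _ uv])
  interpret swap: macdonald G B A \<beta> \<alpha> by (rule macdonald_swap)
  show "A [^] int r \<otimes> (inv (B [^] int t) \<otimes> A [^] int r \<otimes> B [^] int t)
      = inv (B [^] int t) \<otimes> A [^] int r \<otimes> B [^] int t \<otimes> A [^] int r"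
    using part_commutes_conjugate[OF ord A B r(1) t] .
  show "B [^] int t \<otimes> (inv (A [^] int r) \<otimes> B [^] int t \<otimes> A [^] int r)
      = inv (A [^] int r) \<otimes> B [^] int t \<otimes> A [^] int r \<otimes> B [^] int t"
    by (rule swap.part_commutes_conjugate[of v u]) (use assms in \<open>simp_all add: mult.commute\<close>)
  have "ord A dvd r * u" "ord B dvd t * v"
    using A B r(1) t(1) by (metis dvd_trans mult.commute mult_dvd_mono dvd_refl)+
  thus "(A [^] int r) [^] int u = \<one>" "(B [^] int t) [^] int v = \<one>"
    by (simp_all add: int_pow_pow int_pow_eq_id flip: of_nat_mult)
qed auto

text \<open>Since the primed and unprimed parts commute, the commutator of the products is the
  product of the commutators. As a power of \<open>A\<close>, \<open>a\<close> obeys the relation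
  with \<open>C\<close>, and the factor \<open>gcomm G a' b'\<close> of \<open>C\<close>, which
  commutes with \<open>a\<close> and \<open>b\<close>, cancels from it.\<close>

lemma macdonald_part:
  assumes [simp]: "a \<in> carrier G" "b \<in> carrier G" "a' \<in> carrier G" "b' \<in> carrier G"
    and AB: "A = a \<otimes> a'" "B = b \<otimes> b'"
    and pow: "a = A [^] (r::int)" "b = B [^] r"
    and comm: "a \<otimes> a' = a' \<otimes> a" "a \<otimes> b' = b' \<otimes> a" "b \<otimes> a' = a' \<otimes> b" "b \<otimes> b' = b' \<otimes> b"
  shows "C = gcomm G a b \<otimes> gcomm G a' b'" and "macdonald G a b \<alpha> \<beta>"
proof -
  let ?c = "gcomm G a b" and ?c' = "gcomm G a' b'"
  have cl [simp]: "?c \<in> carrier G" "?c' \<in> carrier G" by (simp_all add: gcomm_def)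
  have ac': "a \<otimes> ?c' = ?c' \<otimes> a" and bc': "b \<otimes> ?c' = ?c' \<otimes> b"
    using comm by (auto intro!: commute_gcomm)
  have "(b \<otimes> b') \<otimes> ((a \<otimes> a') \<otimes> (?c \<otimes> ?c')) = (a \<otimes> a') \<otimes> (b \<otimes> b')"
  proof -
    have "a' \<otimes> ?c = ?c \<otimes> a'" "b' \<otimes> ?c = ?c \<otimes> b'"
      using comm by (auto intro!: commute_gcomm)
    have ab: "a \<otimes> (b \<otimes> z) = b \<otimes> (a \<otimes> (?c \<otimes> z))"
      if "z \<in> carrier G" for z
      using that by (simp add: gcomm_def m_assoc)
    have ab': "a' \<otimes> b' = b' \<otimes> (a' \<otimes> ?c')"
      by (simp add: gcomm_def m_assoc)
    have left: "y \<otimes> (x \<otimes> z) = x \<otimes> (y \<otimes> z)"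
      if "x \<otimes> y = y \<otimes> x" "x \<in> carrier G" "y \<in> carrier G" "z \<in> carrier G" for x y z
      using that by (simp flip: m_assoc)
    have "(a \<otimes> a') \<otimes> (b \<otimes> b') = a \<otimes> (b \<otimes> (a' \<otimes> b'))"
      using left[OF comm(3)] by (simp add: m_assoc)
    also have "\<dots> = b \<otimes> (a \<otimes> (b' \<otimes> (?c \<otimes> (a' \<otimes> ?c'))))"
      using left[of b' ?c] \<open>b' \<otimes> ?c = ?c \<otimes> b'\<close> by (simp add: ab ab')
    also have "\<dots> = b \<otimes> (b' \<otimes> (a \<otimes> (a' \<otimes> (?c \<otimes> ?c'))))"
      using left[OF comm(2)[symmetric]] left[of a' ?c] \<open>a' \<otimes> ?c = ?c \<otimes> a'\<close> by simp
    finally show ?thesis by (simp add: m_assoc)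
  qed
  moreover have "B \<otimes> (A \<otimes> C) = A \<otimes> B" using A_B by simp
  ultimately show C: "C = ?c \<otimes> ?c'"
    unfolding AB[symmetric] by (metis A_closed B_closed C_closed cl l_cancel m_closed)
  show "macdonald G a b \<alpha> \<beta>"
  proof unfold_locales
    have "a \<otimes> C = C \<otimes> a [^] \<alpha>"
      using A_pow_C_pow[of r 1] unfolding pow(1) by (simp add: int_pow_pow)
    hence "(a \<otimes> ?c) \<otimes> ?c' = (?c \<otimes> a [^] \<alpha>) \<otimes> ?c'"
      unfolding C using int_pow_intertwine[OF _ _ _ ac', of \<alpha>] by (simp add: m_assoc)
    thus "a \<otimes> ?c = ?c \<otimes> a [^] \<alpha>" by simp
    have "C \<otimes> b = b [^] \<beta> \<otimes> C"
      using C_pow_B_pow[of 1 r] unfolding pow(2) by (simp add: int_pow_pow)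
    hence "(?c \<otimes> b) \<otimes> ?c' = (b [^] \<beta> \<otimes> ?c) \<otimes> ?c'"
      unfolding C using bc' by (simp add: m_assoc)
    thus "?c \<otimes> b = b [^] \<beta> \<otimes> ?c" by simp
  qed auto
qed

end

section \<open>The 3-part\<close>

lemma coprime_3_power:
  assumes "\<not> 3 dvd (z::int)"
  shows "coprime z (3 ^ k)"
proof -
  have "coprime 3 z" by (rule prime_imp_coprime) (use assms in simp_all)
  thus ?thesis by (simp only: coprime_commute[of 3 z] coprime_power_right_iff simp_thms)
qed

text \<open>Turns the congruences below into checks of nine cases. The modulus is 81, and not 27,
  because \<open>x - 1\<close> has 3-adic valuation 1 and is later divided out.\<close>

lemma residue_7_mod_81:
  assumes "[x = 7] (mod 9)"
  shows "x mod 81 \<in> {7, 16, 25, 34, 43, 52, 61, 70, 79 :: int}"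
proof -
  define q where "q = x mod 81 div 9"
  have "x mod 81 mod 9 = 7"
    using assms by (simp add: cong_def mod_mod_cancel)
  hence x: "x mod 81 = 9 * q + 7"
    using mult_div_mod_eq[of 9 "x mod 81"] by (simp add: q_def)
  have "0 \<le> x mod 81" "x mod 81 < 81" by simp_all
  hence "0 \<le> q" "q < 9" unfolding x by linarith+
  hence "q \<in> {0, 1, 2, 3, 4, 5, 6, 7, 8}" by simp presburger
  thus ?thesis unfolding x by auto
qed

lemma pow_mod_81:
  assumes "[x = 7] (mod 9)"
  shows "[x ^ 9 = 55] (mod 81)" and "[x ^ 27 = 1] (mod 81)" and "[gsum x 27 = 27] (mod 81)"
proof -
  define a where "a = x mod 81"
  have a: "a \<in> {7, 16, 25, 34, 43, 52, 61, 70, 79}"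
    using residue_7_mod_81[OF assms] by (simp add: a_def)
  have xa: "[x = a] (mod 81)" by (simp add: a_def)
  have a9: "[a ^ 9 = 55] (mod 81)"
    using a by (elim insertE; simp add: cong_def)
  \<comment> \<open>Splitting 27 terms into three sums of three, with \<open>a ^ 9\<close> already
    reduced to \<open>55\<close>, keeps the numerals small.\<close>
  have "[gsum a 3 * (gsum (a ^ 3) 3 * gsum 55 3) = 27] (mod 81)"
    using a by (elim insertE; simp add: cong_def gsum_def eval_nat_numeral)
  moreover have "gsum a 27 = gsum a 3 * (gsum (a ^ 3) 3 * gsum (a ^ 9) 3)"
    using gsum_mult[of a 3 9] gsum_mult[of "a ^ 3" 3 3] by simp
  moreover have "[gsum a 3 * (gsum (a ^ 3) 3 * gsum (a ^ 9) 3) = gsum a 3 * (gsum (a ^ 3) 3 * gsum 55 3)] (mod 81)"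
    by (intro cong_mult cong_refl gsum_cong a9)
  ultimately have "[gsum a 27 = 27] (mod 81)"
    using cong_trans by auto
  thus "[gsum x 27 = 27] (mod 81)"
    by (rule cong_trans[OF gsum_cong[OF xa]])
  show x9: "[x ^ 9 = 55] (mod 81)"
    by (rule cong_trans[OF cong_pow[OF xa] a9])
  have "[(x ^ 9) ^ 3 = 55 ^ 3] (mod 81)"
    by (rule cong_pow[OF x9])
  thus "[x ^ 27 = 1] (mod 81)"
    by (simp add: cong_def flip: power_mult)
qed

text \<open>By \<open>x ^ 27 = 1\<close> modulo 81 the exponent \<open>n = x ^ 2\<close> matters
  only modulo 27, so everything is determined by the residue of \<open>x\<close> modulo 81.\<close>

lemma torsion_exponent_dvd_81:
  fixes x :: int
  assumes x: "[x = 7] (mod 9)" and n: "x ^ 2 = int n"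
  shows "81 dvd x ^ n * (x + int n - int n * x) - x"
proof -
  define a where "a = x mod 81"
  have a: "a \<in> {7, 16, 25, 34, 43, 52, 61, 70, 79}"
    using residue_7_mod_81[OF x] by (simp add: a_def)
  have xa: "[x = a] (mod 81)" by (simp add: a_def)
  have na: "[int n = a ^ 2] (mod 81)" using cong_pow[OF xa, of 2] n by simp
  have "int n mod 27 = a ^ 2 mod 27"
    using cong_dvd_modulus[OF na, of 27] by (simp add: cong_def)
  hence n27: "n mod 27 = nat (a ^ 2 mod 27)"
    by (metis nat_int of_nat_mod of_nat_numeral)
  have "[a ^ 27 = 1] (mod 81)"
    using cong_trans[OF cong_sym[OF cong_pow[OF xa]] pow_mod_81(2)[OF x]] .
  hence "[(a ^ 27) ^ (n div 27) * a ^ (n mod 27) = 1 ^ (n div 27) * a ^ (n mod 27)] (mod 81)"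
    by (intro cong_mult cong_pow) auto
  hence "[a ^ n = a ^ (n mod 27)] (mod 81)"
    by (simp flip: power_mult power_add)
  also have "a ^ (n mod 27) = (a ^ 9) ^ (n mod 27 div 9) * a ^ (n mod 27 mod 9)"
    by (simp only: mult_div_mod_eq flip: power_mult power_add)
  also have "[\<dots> = 55 ^ (n mod 27 div 9) * a ^ (n mod 27 mod 9)] (mod 81)"
    using cong_trans[OF cong_sym[OF cong_pow[OF xa]] pow_mod_81(1)[OF x]] by (intro cong_mult cong_pow) auto
  finally have "[x ^ n = 55 ^ (n mod 27 div 9) * a ^ (n mod 27 mod 9)] (mod 81)"
    using cong_pow[OF xa, of n] cong_trans by blast
  hence "[x ^ n * (x + int n - int n * x) - x
      = 55 ^ (n mod 27 div 9) * a ^ (n mod 27 mod 9) * (a + a ^ 2 - a ^ 2 * a) - a] (mod 81)"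
    using xa na by (intro cong_mult cong_add cong_diff) auto
  moreover have "81 dvd 55 ^ (n mod 27 div 9) * a ^ (n mod 27 mod 9) * (a + a ^ 2 - a ^ 2 * a) - a"
    unfolding n27 using a by (elim insertE; simp)
  ultimately show ?thesis using cong_dvd_iff by blast
qed

text \<open>Times \<open>x - 1\<close> this is the exponent of
  \<open>torsion_exponent_dvd_81\<close>, and \<open>x - 1\<close> is 3 times a number prime to
  3.\<close>

lemma relation_exponent_dvd_27:
  fixes x :: int
  assumes x: "[x = 7] (mod 9)" and n: "x ^ 2 = int n"
  shows "27 dvd x * gsum x n - x ^ (n + 2)"
proof -
  define E where "E = x * gsum x n - x ^ (n + 2)"
  have "(x - 1) * E = x * ((x - 1) * gsum x n) - (x - 1) * x ^ n * int n"
    by (simp only: E_def power_add n) (simp add: algebra_simps)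
  hence "(x - 1) * E = x ^ n * (x + int n - int n * x) - x"
    unfolding gsum_eq by (simp add: algebra_simps)
  hence "81 dvd (x - 1) * E"
    using torsion_exponent_dvd_81[OF assms] by simp
  moreover obtain k where k: "x - 1 = 3 * k" "\<not> 3 dvd k"
  proof -
    have "x mod 9 = 7" using x by (simp add: cong_def)
    hence "x - 1 = 3 * ((x - 1) div 3)" "\<not> 3 dvd (x - 1) div 3" by presburger+
    thus ?thesis using that by blast
  qed
  ultimately have "3 * 27 dvd 3 * (k * E)" by (simp only: k(1) mult.assoc) simp
  hence "27 dvd k * E" by (simp only: dvd_mult_cancel_left) simp
  moreover have "coprime 27 k"
    using coprime_3_power[OF k(2), of 3] by (simp only: coprime_commute) simp
  ultimately show ?thesis
    by (simp add: coprime_dvd_mult_right_iff E_def)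
qed

lemma gsum_mult_27:
  assumes "[x = 7] (mod 9)"
  shows "[gsum x (27 * k) = 27 * int k] (mod 81)"
proof -
  have "[gsum x 27 * gsum (x ^ 27) k = 27 * gsum 1 k] (mod 81)"
    using pow_mod_81[OF assms] by (intro cong_mult gsum_cong) auto
  thus ?thesis unfolding gsum_mult by simp
qed

text \<open>\<open>x ^ 9\<close> is \<open>1 + 54\<close> modulo 81, and \<open>54 ^ 2\<close> is a
  multiple of 81, so the powers grow linearly.\<close>

lemma pow_9_mod_81:
  assumes "[x = 7] (mod 9)"
  shows "[x ^ (9 * w) = 1 + 54 * int w] (mod 81)"
proof (induction w)
  case (Suc w)
  have "[x ^ (9 * Suc w) = 55 * (1 + 54 * int w)] (mod 81)"
    using cong_mult[OF pow_mod_81(1)[OF assms] Suc.IH] by (simp only: power_add mult_Suc_right)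
  also have "[55 * (1 + 54 * int w) = 1 + 54 * int (Suc w)] (mod 81)"
  proof -
    have eq: "55 * (1 + 54 * int w) = 1 + 54 * int (Suc w) + 81 * (36 * int w)" by simp
    show ?thesis unfolding eq cong_iff_dvd_diff by simp
  qed
  finally show ?case .
qed simp

section \<open>Orders of the generators of the 3-part and of their commutator\<close>

lemma (in group) pow_root:
  assumes "x \<in> carrier G" "x [^] (n::int) = \<one>" "coprime z n"
  shows "\<exists>w. \<forall>m. x [^] m = (x [^] (m * z)) [^] (w::int)"
proof -
  obtain w where "[z * w = 1] (mod n)"
    using cong_solve_coprime_int[OF assms(3)] by blast
  hence "[m * z * w = m] (mod n)" for m
    using cong_mult[of m m n "z * w" 1] by (simp add: mult.assoc)
  thus ?thesis
    using int_pow_cong[OF assms(1,2)] assms(1) by (metis int_pow_pow)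
qed

text \<open>\<open>diff_27\<close> together with the two congruences modulo 9 is the condition on
  the valuation of \<open>\<alpha> - \<beta>\<close>. \<open>K\<close> is an a priori bound of
  unknown size, to be replaced by 3 for \<open>A\<close> and \<open>B\<close> and by 2 for
  \<open>C\<close>.\<close>

locale macdonald3 = macdonald +
  fixes K :: nat
  assumes A_3: "A [^] (3 ^ K :: int) = \<one>" and B_3: "B [^] (3 ^ K :: int) = \<one>"
    and \<alpha>_7: "[\<alpha> = 7] (mod 9)" and \<beta>_7: "[\<beta> = 7] (mod 9)" and diff_27: "\<not> 27 dvd \<alpha> - \<beta>"
begin

lemma macdonald3_swap: "macdonald3 G B A \<beta> \<alpha> K"
proof -
  interpret swap: macdonald G B A \<beta> \<alpha> by (rule macdonald_swap)
  show ?thesis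
    by unfold_locales (use A_3 B_3 \<alpha>_7 \<beta>_7 diff_27 in \<open>simp_all add: dvd_diff_commute\<close>)
qed

lemma C_3: "C [^] (3 ^ K :: int) = \<one>"
proof -
  have "[\<alpha> = 1] (mod 3)"
    using cong_dvd_modulus[OF \<alpha>_7, of 3] by (simp add: cong_def)
  hence "int (3 ^ K) dvd gsum \<alpha> (3 ^ K)"
  proof (intro dvd_gsum)
    fix p :: nat assume p: "Factorial_Ring.prime p" "p dvd 3 ^ K"
    hence "p dvd 3" by (rule prime_dvd_power)
    hence "p = 3" using p(1) primes_dvd_imp_eq[of p 3] by simp
    thus "[\<alpha> = 1] (mod int p)" using \<open>[\<alpha> = 1] (mod 3)\<close> by simp
  qed simp
  thus ?thesis using C_pow_eq_one[of "3 ^ K"] A_3 by simp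
qed

text \<open>An inverse of \<open>\<alpha>\<close>, for moving \<open>C\<close> past powers of
  \<open>A\<close> in the other direction. Modulo \<open>3 ^ K\<close> would suffice for that; the
  extra factor 9 makes \<open>\<rho>\<close> equal to 4 modulo 9 even for small
  \<open>K\<close>.\<close>

definition \<rho> :: int where
  "\<rho> = (SOME r. [\<alpha> * r = 1] (mod 3 ^ (2 + K)))"

lemma alpha_rho: "[\<alpha> * \<rho> = 1] (mod 3 ^ (2 + K))"
proof -
  have "\<not> 3 dvd \<alpha>" using \<alpha>_7 unfolding cong_def by presburger
  hence "\<exists>r. [\<alpha> * r = 1] (mod 3 ^ (2 + K))"
    by (intro cong_solve_coprime_int coprime_3_power)
  thus ?thesis unfolding \<rho>_def by (rule someI_ex)
qed

lemma rho_4: "[\<rho> = 4] (mod 9)"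
proof -
  have "[\<rho> = 4 * (7 * \<rho>)] (mod 9)"
    by (simp add: cong_iff_dvd_diff)
  also have "[4 * (7 * \<rho>) = 4 * (\<alpha> * \<rho>)] (mod 9)"
    using \<alpha>_7 by (intro cong_mult) (auto intro: cong_sym)
  also have "[4 * (\<alpha> * \<rho>) = 4 * 1] (mod 9)"
    using cong_dvd_modulus[OF alpha_rho, of 9] by (intro cong_mult) (auto simp: power_add)
  finally show ?thesis by simp
qed

lemma C_pow_A_pow: "C [^] int n \<otimes> A [^] i = A [^] (i * \<rho> ^ n) \<otimes> C [^] int n"
proof -
  have "[\<alpha> * \<rho> = 1] (mod 3 ^ K)"
    by (rule cong_dvd_modulus[OF alpha_rho]) (simp add: power_add)
  hence "[(\<alpha> * \<rho>) ^ n * i = 1 ^ n * i] (mod 3 ^ K)"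
    by (intro cong_mult cong_pow) auto
  hence "A [^] (i * \<rho> ^ n * \<alpha> ^ n) = A [^] i"
    by (intro int_pow_cong[OF _ A_3]) (simp_all add: power_mult_distrib mult_ac)
  thus ?thesis using A_pow_C_pow[of "i * \<rho> ^ n" n] by simp
qed

text \<open>In the relation for \<open>j = 2\<close> the powers of \<open>A\<close> and
  \<open>B\<close> have exponents divisible by 27, and the powers of \<open>C\<close> combine to
  exponent \<open>(\<beta> - \<alpha>) * (\<beta> + \<alpha>)\<close>. This is 9 times a number
  prime to 3; here the valuation of \<open>\<alpha> - \<beta>\<close> enters.\<close>

lemma C_pow_9: obtains w y :: nat and x :: int
  where "\<not> 3 dvd w" "C [^] int (9 * w) = B [^] int (27 * y) \<otimes> A [^] (27 * x)"
proof -
  define n m where "n = nat (\<alpha> ^ 2)" and "m = nat (\<beta> ^ 2)"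
  have n: "\<alpha> ^ 2 = int n" and m: "\<beta> ^ 2 = int m" by (simp_all add: n_def m_def)
  obtain x1 where x1: "\<alpha> * gsum \<alpha> n - \<alpha> ^ (n + 2) = 27 * x1"
    using relation_exponent_dvd_27[OF \<alpha>_7 n] by blast
  obtain y1 where "\<beta> * gsum \<beta> m - \<beta> ^ (m + 2) = 27 * y1"
    using relation_exponent_dvd_27[OF \<beta>_7 m] by blast
  moreover have "conj_exp m = - (\<beta> * gsum \<beta> m - \<beta> ^ (m + 2))"
    by (simp only: conj_exp_def power_add m) (simp add: algebra_simps)
  ultimately have y1: "conj_exp m = - (27 * y1)" by (simp only:)
  define x where "x = x1 * \<rho> ^ (n + 2)"
  have "B [^] (- (27 * y1)) \<otimes> C [^] int (m + 2) = A [^] (27 * x) \<otimes> C [^] int (n + 2)"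
    using power_relation[OF n m] C_pow_A_pow[of "n + 2" "27 * x1"] by (simp only: x1 y1 x_def) (simp add: mult.assoc)
  hence "B [^] (27 * y1) \<otimes> (B [^] (- (27 * y1)) \<otimes> C [^] int (m + 2)) \<otimes> C [^] (- int (n + 2))
     = B [^] (27 * y1) \<otimes> (A [^] (27 * x) \<otimes> C [^] int (n + 2)) \<otimes> C [^] (- int (n + 2))" by (simp only:)
  hence rel: "C [^] (int m - int n) = B [^] (27 * y1) \<otimes> A [^] (27 * x)"
    by (simp add: int_pow_mult_assoc m_assoc flip: int_pow_mult)
  have "int m - int n = (\<beta> - \<alpha>) * (\<beta> + \<alpha>)"
    by (simp flip: n m add: power2_eq_square algebra_simps)
  moreover have "[\<beta> = \<alpha>] (mod 9)" by (rule cong_trans[OF \<beta>_7 cong_sym[OF \<alpha>_7]])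
  then obtain d where d: "\<beta> - \<alpha> = 9 * d" unfolding cong_iff_dvd_diff by blast
  ultimately have u: "int m - int n = 9 * (d * (\<beta> + \<alpha>))" by simp
  have "\<not> 3 dvd d"
  proof
    assume "3 dvd d"
    hence "9 * 3 dvd 9 * d" by (rule mult_dvd_mono[OF dvd_refl])
    hence "27 dvd \<alpha> - \<beta>" unfolding d[symmetric] dvd_diff_commute[of _ \<alpha> \<beta>] by simp
    thus False using diff_27 by contradiction
  qed
  moreover have "\<not> 3 dvd \<beta> + \<alpha>"
  proof -
    have "[\<beta> + \<alpha> = 7 + 7] (mod 3)"
      by (rule cong_dvd_modulus[OF cong_add[OF \<beta>_7 \<alpha>_7]]) simp
    thus ?thesis by (simp add: cong_dvd_iff)
  qed
  ultimately have u3: "\<not> 3 dvd d * (\<beta> + \<alpha>)"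
    using prime_dvd_multD[of "3::int"] by auto
  define u where "u = d * (\<beta> + \<alpha>)"
  \<comment> \<open>Natural representatives, for the rules that need natural exponents.
    \<open>Suc K\<close> instead of \<open>K\<close> keeps \<open>w\<close> prime to 3 even if
    \<open>K = 0\<close>.\<close>
  define w y where "w = nat (u mod 3 ^ Suc K)" and "y = nat (y1 mod 3 ^ Suc K)"
  have w0: "[int w = u] (mod 3 ^ Suc K)" and y0: "[int y = y1] (mod 3 ^ Suc K)"
    by (simp_all add: w_def y_def del: power_Suc)
  have w: "[int w = u] (mod 3 ^ K)" "[int w = u] (mod 3)" and y: "[int y = y1] (mod 3 ^ K)"
    by (rule cong_dvd_modulus[OF w0] cong_dvd_modulus[OF y0], simp)+
  have "C [^] int (9 * w) = C [^] (int m - int n)"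
    unfolding u using cong_scalar_left[OF w(1), of 9] by (intro int_pow_cong[OF _ C_3]) (simp_all add: u_def)
  moreover have "B [^] int (27 * y) = B [^] (27 * y1)"
    using cong_scalar_left[OF y, of 27] by (intro int_pow_cong[OF _ B_3]) simp_all
  moreover have "\<not> 3 dvd w"
  proof
    assume "3 dvd w"
    hence "3 dvd int w" by presburger
    thus False using w(2) u3 by (simp add: cong_dvd_iff u_def)
  qed
  ultimately show ?thesis using that[of w y x] by (simp only: rel simp_thms)
qed

text \<open>\<open>A\<close> is conjugated by \<open>C [^] int (9 * w)\<close> in two ways:
  directly, which raises it to the power \<open>q = \<alpha> ^ (9 * w)\<close>, and through the
  expression in \<open>B\<close> and \<open>A\<close> from \<open>C_pow_9\<close>. Modulo 81,
  \<open>q - 1\<close> is \<open>54 * w\<close>.\<close>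

lemma A_pow_27: obtains z t y :: int
  where "\<not> 3 dvd z" "A [^] (27 * z) = B [^] (81 * t) \<otimes> C [^] (27 * y)"
proof -
  obtain w y :: nat and x :: int
    where w: "\<not> 3 dvd w" and C9: "C [^] int (9 * w) = B [^] int (27 * y) \<otimes> A [^] (27 * x)"
    by (rule C_pow_9)
  define n q where "n = 27 * y" and "q = \<alpha> ^ (9 * w)"
  have "A \<otimes> C [^] int (9 * w) = C [^] int (9 * w) \<otimes> A [^] q"
    using A_pow_C_pow[of 1 "9 * w"] by (simp add: q_def)
  hence "A \<otimes> B [^] int n \<otimes> A [^] (27 * x) = B [^] int n \<otimes> A [^] q \<otimes> A [^] (27 * x)"
    unfolding C9 n_def by (simp add: m_assoc add.commute flip: int_pow_mult)
  hence "A \<otimes> B [^] int n = B [^] int n \<otimes> A [^] q" by simp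
  hence "A \<otimes> (B [^] conj_exp n \<otimes> C [^] int n) = A \<otimes> A [^] (q - 1)"
    unfolding A_B_pow using int_pow_mult[of A 1 "q - 1"] by simp
  hence "A [^] (q - 1) = B [^] conj_exp n \<otimes> C [^] int n" by simp
  \<comment> \<open>Modulo 81, \<open>gsum \<beta> n\<close> is \<open>n\<close>, so
    \<open>conj_exp n\<close> is \<open>n * (\<beta> ^ n - \<beta>)\<close> with 27 dividing
    \<open>n\<close> and 3 dividing the other factor.\<close>
  moreover have "81 dvd conj_exp n"
  proof -
    have "[conj_exp n = int n * \<beta> ^ n - \<beta> * (27 * int y)] (mod 81)"
      unfolding conj_exp_def n_def by (intro cong_diff cong_mult gsum_mult_27 \<beta>_7) auto
    moreover have "81 dvd int n * \<beta> ^ n - \<beta> * (27 * int y)"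
    proof -
      have "int n * \<beta> ^ n - \<beta> * (27 * int y) = 27 * int y * ((\<beta> ^ n - 1) - (\<beta> - 1))"
        by (simp add: n_def algebra_simps)
      moreover have "3 dvd \<beta> - 1" using \<beta>_7 unfolding cong_def by presburger
      hence "3 dvd (\<beta> ^ n - 1) - (\<beta> - 1)" by (simp flip: gsum_eq)
      hence "27 * 3 dvd 27 * ((\<beta> ^ n - 1) - (\<beta> - 1))" by (rule mult_dvd_mono[OF dvd_refl])
      ultimately show ?thesis by (simp add: dvd_mult2 mult_ac)
    qed
    ultimately show ?thesis using cong_dvd_iff by blast
  qed
  then obtain t where "conj_exp n = 81 * t" by blast
  moreover obtain z where "q - 1 = 27 * z" "\<not> 3 dvd z"
  proof -
    obtain k where "q - 1 = 54 * int w + 81 * k"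
      using pow_9_mod_81[OF \<alpha>_7, of w] unfolding q_def cong_iff_dvd_diff
      by (metis add_diff_cancel_left' diff_diff_eq dvdE diff_add_cancel add.commute)
    hence "q - 1 = 27 * (2 * int w + 3 * k)" by simp
    moreover have "\<not> 3 dvd 2 * int w + 3 * k" using w by presburger
    ultimately show ?thesis using that by blast
  qed
  ultimately show ?thesis using that[of z t "int y"] by (simp add: n_def)
qed

text \<open>Conjugating the relation of \<open>A_pow_27\<close> by \<open>C\<close> and dividing by
  the original removes the power of \<open>C\<close>. The power of \<open>A\<close> gains the factor
  \<open>\<rho> - 1\<close>, of valuation exactly 1, and the power of \<open>B\<close> gains
  \<open>\<beta> - 1\<close>, of valuation at least 1.\<close>

lemma A_pow_81: obtains k where "A [^] (81::int) = B [^] (243 * k :: int)"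
proof -
  obtain z t y :: int where z: "\<not> 3 dvd z" and A27: "A [^] (27 * z) = B [^] (81 * t) \<otimes> C [^] (27 * y)"
    by (rule A_pow_27)
  have CA: "C \<otimes> A [^] i = A [^] (i * \<rho>) \<otimes> C" for i
    using C_pow_A_pow[of 1 i] by simp
  have "C \<otimes> A [^] (27 * z) = B [^] (81 * t * \<beta>) \<otimes> C \<otimes> C [^] (27 * y)"
    unfolding A27 using C_pow_B_pow[of 1 "81 * t"] by (simp flip: m_assoc)
  also have "C \<otimes> C [^] (27 * y) = C [^] (27 * y) \<otimes> C"
    using int_pow_mult[of C 1 "27 * y"] int_pow_mult[of C "27 * y" 1] by (simp add: add.commute)
  hence "B [^] (81 * t * \<beta>) \<otimes> C \<otimes> C [^] (27 * y) = B [^] (81 * t * \<beta>) \<otimes> C [^] (27 * y) \<otimes> C"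
    by (simp add: m_assoc)
  finally have "A [^] (27 * z * \<rho>) = B [^] (81 * t * \<beta>) \<otimes> C [^] (27 * y)"
    unfolding CA by simp
  also have "\<dots> = B [^] (81 * t * (\<beta> - 1)) \<otimes> A [^] (27 * z)"
    unfolding A27 by (simp add: int_pow_mult_assoc algebra_simps)
  finally have "A [^] (27 * z * \<rho> - 27 * z) = B [^] (81 * t * (\<beta> - 1))"
    by (simp add: int_pow_diff m_assoc)
  moreover obtain z' where "27 * z * \<rho> - 27 * z = 81 * z'" and z': "\<not> 3 dvd z'"
  proof -
    obtain d where d: "\<rho> = 4 + 9 * d"
      using cong_sym[OF rho_4] unfolding cong_iff_lin by blast
    have "27 * z * \<rho> - 27 * z = 81 * (z + 3 * (z * d))" by (simp add: d algebra_simps)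
    moreover have "\<not> 3 dvd z + 3 * (z * d)" using z by presburger
    ultimately show ?thesis using that by blast
  qed
  moreover obtain b where "\<beta> - 1 = 3 * b"
  proof -
    have "3 dvd \<beta> - 1" using \<beta>_7 unfolding cong_def by presburger
    thus ?thesis using that by blast
  qed
  ultimately have A81: "A [^] (81 * z') = B [^] (243 * (t * b))"
    by (simp add: mult_ac)
  obtain w where "A [^] (81::int) = (A [^] (81 * z')) [^] (w::int)"
    using pow_root[OF A_closed A_3 coprime_3_power[OF z']] by blast
  hence "A [^] (81::int) = B [^] (243 * (t * b * w))"
    unfolding A81 by (simp add: int_pow_pow mult.assoc)
  thus ?thesis by (rule that)
qed

text \<open>Using \<open>A_pow_81\<close> and its mirror image alternately writes
  \<open>A [^] 81\<close> as its own power with exponent \<open>9 * (l * k)\<close>, and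
  \<open>1 - 9 * (l * k)\<close> is prime to 3.\<close>

lemma A_81: "A [^] (81::int) = \<one>"
proof -
  interpret swap: macdonald3 G B A \<beta> \<alpha> K by (rule macdonald3_swap)
  obtain k where k: "A [^] (81::int) = B [^] (243 * k :: int)" by (rule A_pow_81)
  obtain l where l: "B [^] (81::int) = A [^] (243 * l :: int)" by (rule swap.A_pow_81)
  have "A [^] (81::int) = (B [^] (81::int)) [^] (3 * k)"
    using k by (simp add: int_pow_pow)
  also have "\<dots> = A [^] (729 * (l * k))"
    unfolding l by (simp add: int_pow_pow mult_ac)
  finally have "A [^] (81 * (1 - 9 * (l * k))) = \<one>"
    by (simp add: int_pow_diff algebra_simps)
  moreover have "\<not> 3 dvd 1 - 9 * (l * k)" by presburger
  then obtain w where "A [^] (81::int) = (A [^] (81 * (1 - 9 * (l * k)))) [^] (w::int)"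
    using pow_root[OF A_closed A_3 coprime_3_power] by blast
  ultimately show ?thesis by simp
qed

lemma A_pow_27_C: obtains k where "A [^] (27::int) = C [^] (27 * k :: int)"
proof -
  interpret swap: macdonald3 G B A \<beta> \<alpha> K by (rule macdonald3_swap)
  obtain z t y :: int where z: "\<not> 3 dvd z" and A27: "A [^] (27 * z) = B [^] (81 * t) \<otimes> C [^] (27 * y)"
    by (rule A_pow_27)
  have "B [^] (81 * t) = \<one>" using swap.A_81 by (simp flip: int_pow_pow)
  hence A27: "A [^] (27 * z) = C [^] (27 * y)" using A27 by simp
  obtain w where "A [^] (27::int) = (A [^] (27 * z)) [^] (w::int)"
    using pow_root[OF A_closed A_3 coprime_3_power[OF z]] by blast
  hence "A [^] (27::int) = C [^] (27 * (y * w))"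
    unfolding A27 by (simp add: int_pow_pow mult.assoc)
  thus ?thesis by (rule that)
qed

text \<open>\<open>A [^] 27\<close> and \<open>B [^] 27\<close> are powers of \<open>C\<close>, so
  they commute and the identity of \<open>C_pow_9\<close> may be cubed. Its right-hand side then
  vanishes by \<open>A_81\<close>, which leaves \<open>C [^] 27 = \<one>\<close>; this kills
  \<open>A [^] 27\<close> and \<open>B [^] 27\<close>, and a second look at \<open>C_pow_9\<close>
  gives the bound for \<open>C\<close>.\<close>

lemma A_27: "A [^] (27::int) = \<one>" and C_9: "C [^] (9::int) = \<one>"
proof -
  interpret swap: macdonald3 G B A \<beta> \<alpha> K by (rule macdonald3_swap)
  obtain w y :: nat and x :: int
    where w: "\<not> 3 dvd w" and C9: "C [^] int (9 * w) = B [^] int (27 * y) \<otimes> A [^] (27 * x)"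
    by (rule C_pow_9)
  obtain k where k: "A [^] (27::int) = C [^] (27 * k :: int)" by (rule A_pow_27_C)
  obtain l where "B [^] (27::int) = (inv C) [^] (27 * l :: int)"
    by (rule swap.A_pow_27_C[unfolded gcomm_swap])
  hence l: "B [^] (27::int) = C [^] (27 * - l)" by (simp add: int_pow_inv int_pow_neg)
  have "B [^] int (27 * y) \<otimes> A [^] (27 * x) = A [^] (27 * x) \<otimes> B [^] int (27 * y)"
  proof -
    have "B [^] int (27 * y) = C [^] (27 * - l * int y)" "A [^] (27 * x) = C [^] (27 * k * x)"
      using k l int_pow_pow[of A 27 x] int_pow_pow[of B 27 "int y"] by (simp_all add: int_pow_pow)
    thus ?thesis by (simp add: add.commute flip: int_pow_mult)
  qed
  hence "(B [^] int (27 * y) \<otimes> A [^] (27 * x)) [^] (3::int) = (B [^] int (27 * y)) [^] (3::int) \<otimes> (A [^] (27 * x)) [^] (3::int)"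
    by (intro int_pow_mult_distrib) auto
  also have "(B [^] int (27 * y)) [^] (3::int) = (B [^] (81::int)) [^] int y"
    by (simp add: int_pow_pow mult.commute)
  also have "(A [^] (27 * x)) [^] (3::int) = (A [^] (81::int)) [^] x"
    by (simp add: int_pow_pow mult.commute)
  finally have "(C [^] int (9 * w)) [^] (3::int) = \<one>"
    using A_81 swap.A_81 C9 by simp
  hence "C [^] (27 * int w) = \<one>" by (simp add: int_pow_pow mult.commute)
  moreover have w': "\<not> 3 dvd int w" using w by presburger
  then obtain v where v: "\<And>m. C [^] m = (C [^] (m * int w)) [^] (v::int)"
    using pow_root[OF C_closed C_3 coprime_3_power] by blast
  ultimately have "C [^] (27::int) = \<one>" by (metis int_pow_one)
  hence C27: "C [^] (27 * i) = \<one>" for i :: int by (simp flip: int_pow_pow)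
  show "A [^] (27::int) = \<one>" using k C27 by simp
  moreover have "B [^] (27::int) = \<one>" unfolding l by (rule C27)
  ultimately have "C [^] int (9 * w) = \<one>"
    using C9 by (simp flip: int_pow_pow)
  thus "C [^] (9::int) = \<one>" using v[of 9] by simp
qed

end

section \<open>Normal form\<close>

text \<open>The formula \<open>|HK| |H \<inter> K| = |H| |K|\<close>, valid although
  \<open>HK\<close> need not be a subgroup: \<open>F\<close> moves one chosen factorisation of
  \<open>g\<close> by an element of the intersection, and this reaches all factorisations.\<close>

lemma (in group) card_set_mult:
  assumes H: "subgroup H G" and K: "subgroup K G" and fin: "finite H" "finite K"
  shows "card (H <#> K) dvd card H * card K"
proof -
  define f where "f = (\<lambda>g. SOME p. p \<in> H \<times> K \<and> fst p \<otimes> snd p = g)"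
  have f: "f g \<in> H \<times> K \<and> fst (f g) \<otimes> snd (f g) = g" if g: "g \<in> H <#> K" for g
  proof -
    obtain h k where "h \<in> H" "k \<in> K" "g = h \<otimes> k"
      using g unfolding set_mult_def by blast
    thus ?thesis unfolding f_def
      by (intro someI[where P = "\<lambda>p. p \<in> H \<times> K \<and> fst p \<otimes> snd p = g" and x = "(h, k)"]) simp
  qed
  have Hc: "x \<in> carrier G" if "x \<in> H" for x using H that by (rule subgroup.mem_carrier)
  have Kc: "x \<in> carrier G" if "x \<in> K" for x using K that by (rule subgroup.mem_carrier)
  note closed = subgroup.m_closed[OF H] subgroup.m_closed[OF K] subgroup.m_inv_closed[OF H] subgroup.m_inv_closed[OF K]
  define F where "F = (\<lambda>(g, x). (fst (f g) \<otimes> x, inv x \<otimes> snd (f g)))"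
  have "bij_betw F ((H <#> K) \<times> (H \<inter> K)) (H \<times> K)"
    unfolding bij_betw_def
  proof
    show "inj_on F ((H <#> K) \<times> (H \<inter> K))"
    proof (rule inj_onI, clarify)
      fix g x g' x'
      assume g: "g \<in> H <#> K" "g' \<in> H <#> K" and x: "x \<in> H" "x \<in> K" "x' \<in> H" "x' \<in> K"
        and eq: "F (g, x) = F (g', x')"
      have prod: "fst (F (h, y)) \<otimes> snd (F (h, y)) = h" if "h \<in> H <#> K" "y \<in> H" for h y
        using f[OF that(1)] that(2) Hc Kc by (auto simp: F_def m_assoc)
      have "g = g'" using prod[OF g(1) x(1)] prod[OF g(2) x(3)] eq by simp
      moreover have "fst (f g) \<otimes> x = fst (f g') \<otimes> x'" using eq by (simp add: F_def)
      ultimately show "g = g' \<and> x = x'"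
        using f[OF g(1)] x Hc by auto
    qed
    show "F ` ((H <#> K) \<times> (H \<inter> K)) = H \<times> K"
    proof
      show "F ` ((H <#> K) \<times> (H \<inter> K)) \<subseteq> H \<times> K"
        using f closed by (fastforce simp: F_def)
      show "H \<times> K \<subseteq> F ` ((H <#> K) \<times> (H \<inter> K))"
      proof clarify
        fix h k assume hk: "h \<in> H" "k \<in> K"
        define g where "g = h \<otimes> k"
        have g: "g \<in> H <#> K" using hk by (auto simp: g_def set_mult_def)
        obtain h' k' where fg: "f g = (h', k')" by (cases "f g")
        have h'k': "h' \<in> H" "k' \<in> K" "h' \<otimes> k' = h \<otimes> k" using f[OF g] unfolding fg by (auto simp: g_def)
        have c: "h \<in> carrier G" "k \<in> carrier G" "h' \<in> carrier G" "k' \<in> carrier G"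
          using hk h'k' Hc Kc by auto
        define x where "x = inv h' \<otimes> h"
        have "inv h' \<otimes> (h' \<otimes> k') \<otimes> inv k = inv h' \<otimes> (h \<otimes> k) \<otimes> inv k"
          using h'k'(3) by simp
        hence x': "x = k' \<otimes> inv k" using c by (simp add: x_def m_assoc)
        have "x \<in> H \<inter> K"
          using hk h'k' closed by (auto simp: x_def) (auto simp: x' simp flip: x_def)
        moreover have "F (g, x) = (h, k)"
        proof -
          have "h' \<otimes> x = h" using c by (simp add: x_def)
          moreover have "inv x \<otimes> k' = k" using c by (simp add: x' inv_mult_group m_assoc)
          ultimately show ?thesis by (simp add: F_def fg)
        qed
        ultimately show "(h, k) \<in> F ` ((H <#> K) \<times> (H \<inter> K))"
          using g by (metis SigmaI imageI)
      qed
    qed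
  qed
  hence "card ((H <#> K) \<times> (H \<inter> K)) = card (H \<times> K)" by (rule bij_betw_same_card)
  thus ?thesis by (simp add: card_cartesian_product flip: dvd_def) (metis dvd_triv_left)
qed

context macdonald
begin

text \<open>The products of this shape are closed under right multiplication by \<open>A\<close> and
  by \<open>B\<close>: a power of \<open>A\<close> passing \<open>B\<close> leaves only powers of
  \<open>C\<close> and \<open>A\<close>, and a power of \<open>C\<close> passing \<open>B\<close>
  leaves a power of \<open>B\<close>. The exponents are first reduced to natural numbers, as these
  rules require.\<close>

lemma normal_form:
  assumes n: "n > 0" "A [^] int n = \<one>" "B [^] int n = \<one>" "C [^] int n = \<one>"
    and g: "g \<in> generate G {A, B}"
  shows "\<exists>j k i. j < n \<and> k < n \<and> i < n \<and> g = B [^] int j \<otimes> (C [^] int k \<otimes> A [^] int i)"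
proof -
  define S where "S = {B [^] j \<otimes> (C [^] k \<otimes> A [^] i) | (j::int) (k::int) (i::int). True}"
  have red: "x [^] i = x [^] int (nat (i mod int n))" if "x \<in> carrier G" "x [^] int n = \<one>" for x i
    by (rule int_pow_cong[OF that]) (use n(1) in \<open>simp add: cong_def\<close>)
  have SI: "B [^] j \<otimes> (C [^] k \<otimes> A [^] i) \<in> S" for j k i :: int
    unfolding S_def by blast
  have Sc: "x \<in> carrier G" if "x \<in> S" for x
    using that unfolding S_def by auto
  have SA: "x \<otimes> A [^] i \<in> S" if "x \<in> S" for x and i :: int
    using that SI by (auto simp: S_def m_assoc simp flip: int_pow_mult)
  have SB1: "x \<otimes> B \<in> S" if "x \<in> S" for x
  proof -
    from that obtain j k i :: int where x: "x = B [^] j \<otimes> (C [^] k \<otimes> A [^] i)" unfolding S_def by blast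
    define k' i' where "k' = nat (k mod int n)" and "i' = nat (i mod int n)"
    have "x = B [^] j \<otimes> (C [^] int k' \<otimes> A [^] int i')"
      unfolding x k'_def i'_def using red[of C k] red[of A i] n by simp
    hence "x \<otimes> B = B [^] j \<otimes> ((C [^] int k' \<otimes> B [^] (1::int)) \<otimes> (C [^] int i' \<otimes> A [^] (\<alpha> * gsum \<alpha> i')))"
      using A_pow_B[of i'] by (simp add: m_assoc)
    also have "\<dots> = B [^] (j + \<beta> ^ k') \<otimes> (C [^] (int k' + int i') \<otimes> A [^] (\<alpha> * gsum \<alpha> i'))"
      unfolding C_pow_B_pow by (simp add: int_pow_mult_assoc m_assoc)
    finally show ?thesis using SI by simp
  qed
  have SB: "x \<otimes> B [^] i \<in> S" if "x \<in> S" for x and i :: int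
  proof -
    have "x \<in> carrier G" using that by (auto simp: S_def)
    have "x \<otimes> B [^] l \<in> S" for l :: nat
    proof (induction l)
      case (Suc l)
      thus ?case using SB1[of "x \<otimes> B [^] l"] \<open>x \<in> carrier G\<close> by (simp add: m_assoc)
    qed (use that \<open>x \<in> carrier G\<close> in simp)
    hence "x \<otimes> B [^] int (nat (i mod int n)) \<in> S" by (simp only: int_pow_int)
    thus ?thesis by (simp only: red[OF B_closed n(3), symmetric])
  qed
  \<comment> \<open>The second conjunct is needed because \<open>generate\<close> multiplies two
    generated elements, not an element and a generator.\<close>
  have "g \<in> S \<and> (\<forall>x\<in>S. x \<otimes> g \<in> S)"
    using g
  proof (induction rule: generate.induct)
    case one
    show ?case using SI[of 0 0 0] Sc by auto
  next
    case (incl h)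
    then show ?case
      using SI[of 0 0 1] SI[of 1 0 0] SA[of _ 1] SB[of _ 1] by auto
  next
    case (inv h)
    then show ?case
      using SI[of 0 0 "-1"] SI[of "-1" 0 0] SA[of _ "-1"] SB[of _ "-1"] by (auto simp: int_pow_neg)
  next
    case (eng h1 h2)
    have "h1 \<in> carrier G" "h2 \<in> carrier G" "\<And>x. x \<in> S \<Longrightarrow> x \<in> carrier G"
      using eng by (auto simp: S_def)
    thus ?case using eng by (auto simp flip: m_assoc)
  qed
  then obtain j k i :: int where "g = B [^] j \<otimes> (C [^] k \<otimes> A [^] i)" unfolding S_def by blast
  hence "g = B [^] int (nat (j mod int n)) \<otimes> (C [^] int (nat (k mod int n)) \<otimes> A [^] int (nat (i mod int n)))"
    using red[of B j] red[of C k] red[of A i] n by simp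
  moreover have "nat (l mod int n) < n" for l using n by (simp add: nat_less_iff)
  ultimately show ?thesis by blast
qed

text \<open>A mere bound on the size would not do: with \<open>n\<close> prime to 3, divisibility
  shows that the complement has order prime to 3. The subgroup is the product of the one generated
  by \<open>B\<close> with \<open>L\<close>, and \<open>L\<close> is a subgroup because
  \<open>C\<close> normalises the powers of \<open>A\<close>.\<close>

lemma card_generate_dvd:
  assumes n: "n > 0" "A [^] int n = \<one>" "B [^] int n = \<one>" "C [^] int n = \<one>"
  shows "finite (generate G {A, B})" and "card (generate G {A, B}) dvd n ^ 3"
proof -
  let ?f = "\<lambda>(j, k, i). B [^] int j \<otimes> (C [^] int k \<otimes> A [^] int i)"
  have "generate G {A, B} \<subseteq> ?f ` ({..<n} \<times> {..<n} \<times> {..<n})"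
  proof
    fix g assume "g \<in> generate G {A, B}"
    then obtain j k i where "j < n" "k < n" "i < n" "g = ?f (j, k, i)"
      using normal_form[OF n, of g] by (auto simp only: prod.case)
    thus "g \<in> ?f ` ({..<n} \<times> {..<n} \<times> {..<n})" by (intro image_eqI[of _ _ "(j, k, i)"]) auto
  qed
  thus "finite (generate G {A, B})" by (rule finite_subset) auto
  have cyc: "subgroup (generate G {x}) G" "finite (generate G {x})" "card (generate G {x}) dvd n"
    "generate G {x} = {x [^] (i::int) | i. True}"
    if "x \<in> carrier G" "x [^] int n = \<one>" for x
  proof -
    show "subgroup (generate G {x}) G" using that(1) by (simp add: generate_is_subgroup)
    have ord: "ord x dvd n" using that by (simp add: int_pow_eq_id)
    hence "ord x > 0" using n(1) by (auto intro: Nat.gr0I)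
    moreover have card: "card (generate G {x}) = ord x" using that(1) by (simp add: generate_pow_card)
    ultimately show "finite (generate G {x})" by (metis card.infinite less_irrefl)
    show "card (generate G {x}) dvd n" using card ord by simp
    show "generate G {x} = {x [^] (i::int) | i. True}"
      using generate_pow[OF that(1)] by auto
  qed
  define L where "L = generate G {C} <#> generate G {A}"
  have L: "L = {C [^] k \<otimes> A [^] i | (k::int) (i::int). True}"
    unfolding L_def cyc(4)[OF C_closed n(4)] cyc(4)[OF A_closed n(2)] set_mult_def by blast
  have red: "C [^] k = C [^] int (nat (k mod int n))" for k
    by (rule int_pow_cong[OF C_closed n(4)]) (use n(1) in \<open>simp add: cong_def\<close>)
  have AC: "A [^] i \<otimes> C [^] k \<in> L" for i k :: int
    unfolding red[of k] A_pow_C_pow L by blast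
  have LA: "x \<otimes> A [^] i \<in> L" if "x \<in> L" for x and i :: int
  proof -
    from that obtain k m where "x = C [^] (k::int) \<otimes> A [^] (m::int)" unfolding L by blast
    hence "x \<otimes> A [^] i = C [^] k \<otimes> A [^] (m + i)" by (simp add: m_assoc int_pow_mult)
    thus ?thesis using L by auto
  qed
  have CL: "C [^] i \<otimes> x \<in> L" if "x \<in> L" for x and i :: int
  proof -
    from that obtain k m where "x = C [^] (k::int) \<otimes> A [^] (m::int)" unfolding L by blast
    hence "C [^] i \<otimes> x = C [^] (i + k) \<otimes> A [^] m" by (simp add: int_pow_mult_assoc)
    thus ?thesis using L by auto
  qed
  have subL: "subgroup L G"
  proof (rule subgroupI)
    show "L \<subseteq> carrier G" unfolding L by auto
    show "L \<noteq> {}" using AC by auto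
    fix x assume "x \<in> L"
    then obtain k i where x: "x = C [^] (k::int) \<otimes> A [^] (i::int)" unfolding L by blast
    have "inv x = A [^] (- i) \<otimes> C [^] (- k)" by (simp add: x inv_mult_group int_pow_neg)
    thus "inv x \<in> L" using AC by simp
    fix y assume "y \<in> L"
    then obtain l m where y: "y = C [^] (l::int) \<otimes> A [^] (m::int)" unfolding L by blast
    have "x \<otimes> y = C [^] k \<otimes> ((A [^] i \<otimes> C [^] l) \<otimes> A [^] m)" by (simp add: x y m_assoc)
    thus "x \<otimes> y \<in> L" using CL[OF LA[OF AC]] by simp
  qed
  have finL: "finite L" unfolding L_def
    using cyc(2)[OF C_closed n(4)] cyc(2)[OF A_closed n(2)] by (simp add: set_mult_def)
  have sg: "subgroup (generate G {A, B}) G" by (simp add: generate_is_subgroup)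
  have "A \<in> generate G {A, B}" "B \<in> generate G {A, B}" by (auto intro: generate.incl)
  hence "C \<in> generate G {A, B}"
    unfolding gcomm_def using subgroup.m_closed[OF sg] subgroup.m_inv_closed[OF sg] by simp
  have "generate G {A, B} = generate G {B} <#> L"
  proof
    show "generate G {A, B} \<subseteq> generate G {B} <#> L"
    proof
      fix g assume "g \<in> generate G {A, B}"
      then obtain j k i where "g = B [^] int j \<otimes> (C [^] int k \<otimes> A [^] int i)"
        using normal_form[OF n] by blast
      thus "g \<in> generate G {B} <#> L"
        unfolding cyc(4)[OF B_closed n(3)] L set_mult_def by blast
    qed
    show "generate G {B} <#> L \<subseteq> generate G {A, B}"
      unfolding cyc(4)[OF B_closed n(3)] L set_mult_def
      using \<open>A \<in> _\<close> \<open>B \<in> _\<close> \<open>C \<in> _\<close> subgroup.m_closed[OF sg] subgroup_int_pow_closed[OF sg] by auto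
  qed
  hence "card (generate G {A, B}) dvd card (generate G {B}) * card L"
    using card_set_mult[OF cyc(1)[OF B_closed n(3)] subL cyc(2)[OF B_closed n(3)] finL] by simp
  also have "card (generate G {B}) * card L dvd n * (n * n)"
    unfolding L_def using cyc[OF A_closed n(2)] cyc[OF B_closed n(3)] cyc[OF C_closed n(4)]
    by (intro mult_dvd_mono dvd_trans[OF card_set_mult])
  finally show "card (generate G {A, B}) dvd n ^ 3" by (simp add: power3_eq_cube mult.assoc)
qed

end

section \<open>Finitely presented groups\<close>

lemma pres_eq_append:
  assumes "pres_eq R u v"
  shows "pres_eq R (x @ u @ y) (x @ v @ y)"
  using assms
proof induction
  case (cancel u g i v)
  show ?case using pres_eq.cancel[of R "x @ u" g i "v @ y"] by simp
next
  case (rel r u v)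
  show ?case using pres_eq.rel[OF rel, of "x @ u" "v @ y"] by simp
qed (auto intro: pres_eq.intros)

lemma pres_eq_append2:
  assumes "pres_eq R u u'" "pres_eq R v v'"
  shows "pres_eq R (u @ v) (u' @ v')"
proof (rule pres_eq.trans)
  show "pres_eq R (u @ v) (u' @ v)" using pres_eq_append[OF assms(1), of "[]" v] by simp
  show "pres_eq R (u' @ v) (u' @ v')" using pres_eq_append[OF assms(2), of u' "[]"] by simp
qed

lemma pres_class_eq_iff: "pres_class R u = pres_class R v \<longleftrightarrow> pres_eq R u v"
  unfolding pres_class_def by (auto intro: pres_eq.intros)

lemma winv_append: "winv (u @ v) = winv v @ winv u"
  by (simp add: winv_def)

lemma winv_winv [simp]: "winv (winv w) = w"
  by (induction w) (auto simp: winv_def)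

lemma pres_eq_winv: "pres_eq R (w @ winv w) []"
proof (induction w)
  case (Cons l w)
  obtain g i where l: "l = (g, i)" by (cases l)
  have "pres_eq R ([l] @ (w @ winv w) @ [(g, \<not> i)]) ([l] @ [] @ [(g, \<not> i)])"
    by (rule pres_eq_append[OF Cons.IH])
  moreover have "pres_eq R ([] @ [(g, i), (g, \<not> i)] @ []) ([] @ [])"
    by (rule pres_eq.cancel)
  ultimately show ?case
    by (auto simp: l winv_def intro: pres_eq.trans)
qed (simp add: winv_def pres_eq.refl)

lemma fp_group_mult:
  "pres_class R u \<otimes>\<^bsub>fp_group R\<^esub> pres_class R v = pres_class R (u @ v)"
  unfolding fp_group_def pres_class_def
  by (auto intro: pres_eq.refl pres_eq.trans pres_eq_append2)

lemma fp_group_one: "\<one>\<^bsub>fp_group R\<^esub> = pres_class R []"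
  by (simp add: fp_group_def)

lemma fp_group_carrier: "carrier (fp_group R) = range (pres_class R)"
  by (simp add: fp_group_def)

lemma group_fp_group: "group (fp_group R)"
proof (rule groupI)
  fix x assume "x \<in> carrier (fp_group R)"
  then obtain w where x: "x = pres_class R w" by (auto simp: fp_group_carrier)
  have "pres_eq R (winv w @ w) []" using pres_eq_winv[of R "winv w"] by simp
  hence "pres_class R (winv w) \<otimes>\<^bsub>fp_group R\<^esub> x = \<one>\<^bsub>fp_group R\<^esub>"
    by (simp add: x fp_group_mult fp_group_one pres_class_eq_iff)
  thus "\<exists>y\<in>carrier (fp_group R). y \<otimes>\<^bsub>fp_group R\<^esub> x = \<one>\<^bsub>fp_group R\<^esub>"
    by (auto simp: fp_group_carrier)
qed (auto simp: fp_group_carrier fp_group_mult fp_group_one)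

lemma fp_group_inv: "inv\<^bsub>fp_group R\<^esub> pres_class R w = pres_class R (winv w)"
proof -
  interpret group "fp_group R" by (rule group_fp_group)
  show ?thesis
    by (rule inv_equality)
      (auto simp: fp_group_carrier fp_group_mult fp_group_one pres_class_eq_iff
        intro: pres_eq_winv[of R "winv w", simplified])
qed

lemma fp_group_int_pow: "pres_class R w [^]\<^bsub>fp_group R\<^esub> (n::int) = pres_class R (wpow w n)"
proof -
  interpret group "fp_group R" by (rule group_fp_group)
  have nat_pow: "pres_class R w [^]\<^bsub>fp_group R\<^esub> k = pres_class R (concat (replicate k w))" for k :: nat and w
  proof (induction k)
    case (Suc k)
    have "concat (replicate k w) @ w = w @ concat (replicate k w)"
      by (induction k) simp_all
    thus ?case using Suc by (simp add: fp_group_mult)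
  qed (simp add: fp_group_one)
  show ?thesis
  proof (cases n rule: int_cases2)
    case (nonneg k)
    show ?thesis by (simp only: nonneg int_pow_int nat_pow) (simp add: wpow_def)
  next
    case (nonpos k)
    have "pres_class R w [^]\<^bsub>fp_group R\<^esub> n = inv\<^bsub>fp_group R\<^esub> pres_class R w [^]\<^bsub>fp_group R\<^esub> k"
      by (simp add: nonpos int_pow_neg int_pow_int nat_pow_inv fp_group_carrier)
    thus ?thesis by (simp only: fp_group_inv nat_pow) (simp add: nonpos wpow_def)
  qed
qed

section \<open>Evaluation of words and the universal property\<close>

definition word_eval :: "('h, 'm) monoid_scheme \<Rightarrow> ('g \<Rightarrow> 'h) \<Rightarrow> 'g word \<Rightarrow> 'h" where
  "word_eval H f w = foldr (\<lambda>(g, i) h. (if i then inv\<^bsub>H\<^esub> f g else f g) \<otimes>\<^bsub>H\<^esub> h) w \<one>\<^bsub>H\<^esub>"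

context group
begin

lemma word_eval_closed:
  assumes "range f \<subseteq> carrier G"
  shows "word_eval G f w \<in> carrier G"
proof (induction w)
  case (Cons l w)
  have "f g \<in> carrier G" for g using assms by auto
  thus ?case using Cons by (cases l) (auto simp: word_eval_def)
qed (simp add: word_eval_def)

lemma word_eval_append:
  assumes "range f \<subseteq> carrier G"
  shows "word_eval G f (u @ v) = word_eval G f u \<otimes> word_eval G f v"
proof (induction u)
  case Nil
  show ?case using word_eval_closed[OF assms, of v] by (simp add: word_eval_def)
next
  case (Cons l u)
  have c: "f g \<in> carrier G" for g using assms by auto
  show ?case
    using Cons word_eval_closed[OF assms, of u] word_eval_closed[OF assms, of v] c
    by (cases l) (auto simp: word_eval_def m_assoc)
qed

lemma word_eval_winv:
  assumes "range f \<subseteq> carrier G"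
  shows "word_eval G f (winv w) = inv (word_eval G f w)"
proof (induction w)
  case (Cons l w)
  have c: "f g \<in> carrier G" for g using assms by auto
  have "winv (l # w) = winv w @ winv [l]" using winv_append[of "[l]" w] by simp
  hence "word_eval G f (winv (l # w)) = inv (word_eval G f w) \<otimes> word_eval G f (winv [l])"
    by (simp only: word_eval_append[OF assms] Cons.IH)
  moreover have "word_eval G f (winv [l]) = inv (word_eval G f [l])"
    using c by (cases l) (simp add: word_eval_def winv_def)
  moreover have "word_eval G f (l # w) = word_eval G f [l] \<otimes> word_eval G f w"
    using word_eval_append[OF assms, of "[l]" w] by simp
  ultimately show ?case
    using word_eval_closed[OF assms] by (simp add: inv_mult_group)
qed (simp add: word_eval_def winv_def)

lemma word_eval_wpow:
  assumes "range f \<subseteq> carrier G"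
  shows "word_eval G f (wpow w n) = word_eval G f w [^] n"
proof -
  have nat_pow: "word_eval G f (concat (replicate k u)) = word_eval G f u [^] k" for k u
  proof (induction k)
    case (Suc k)
    thus ?case
      using word_eval_closed[OF assms, of u] nat_pow_Suc2[of "word_eval G f u" k]
      by (simp add: word_eval_append[OF assms])
  qed (simp add: word_eval_def)
  show ?thesis
  proof (cases n rule: int_cases2)
    case (nonneg k)
    show ?thesis unfolding nonneg int_pow_int nat_pow[symmetric] by (simp add: wpow_def)
  next
    case (nonpos k)
    have "word_eval G f w [^] n = inv (word_eval G f w) [^] k"
      using word_eval_closed[OF assms, of w] by (simp add: nonpos int_pow_neg int_pow_int nat_pow_inv)
    also have "\<dots> = word_eval G f (concat (replicate k (winv w)))"
      by (simp only: nat_pow word_eval_winv[OF assms])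
    finally show ?thesis by (simp add: nonpos wpow_def)
  qed
qed

lemma word_eval_cong:
  assumes f: "range f \<subseteq> carrier G" and R: "\<And>r. r \<in> R \<Longrightarrow> word_eval G f r = \<one>"
    and "pres_eq R u v"
  shows "word_eval G f u = word_eval G f v"
  using assms(3)
proof induction
  case (cancel u g i v)
  have "f g \<in> carrier G" using f by auto
  hence "word_eval G f [(g, i), (g, \<not> i)] = \<one>" by (simp add: word_eval_def)
  thus ?case using word_eval_closed[OF f] by (simp only: word_eval_append[OF f] l_one)
next
  case (rel r u v)
  thus ?case using word_eval_closed[OF f] by (simp add: word_eval_append[OF f] R)
qed auto

text \<open>Von Dyck's theorem. The homomorphism evaluates an arbitrary representative of a class,
  and \<open>word_eval_cong\<close> makes the choice immaterial.\<close>

lemma fp_group_hom: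
  assumes f: "range f \<subseteq> carrier G" and R: "\<And>r. r \<in> R \<Longrightarrow> word_eval G f r = \<one>"
  obtains h where "group_hom (fp_group R) G h" "\<And>w. h (pres_class R w) = word_eval G f w"
proof -
  define h where "h = (\<lambda>U. word_eval G f (SOME w. w \<in> U))"
  have h: "h (pres_class R w) = word_eval G f w" for w
  proof -
    have "(SOME v. v \<in> pres_class R w) \<in> pres_class R w"
      by (rule someI[of _ w]) (simp add: pres_class_def pres_eq.refl)
    hence "pres_eq R w (SOME v. v \<in> pres_class R w)"
      by (simp only: pres_class_def mem_Collect_eq)
    from word_eval_cong[OF f R this] show ?thesis unfolding h_def by simp
  qed
  have "h \<in> hom (fp_group R) G"
    by (rule homI) (auto simp: fp_group_carrier fp_group_mult h word_eval_closed[OF f] word_eval_append[OF f])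
  hence "group_hom (fp_group R) G h"
    by (simp add: group_hom_def group_hom_axioms_def group_fp_group group_axioms)
  thus ?thesis using h by (rule that)
qed

end

section \<open>A permutation model\<close>

text \<open>The model is the action of the group on the cosets \<open>a [^] i \<otimes> c [^] k \<otimes> \<langle>b\<rangle>\<close>, written as pairs
  \<open>(i, k)\<close> modulo \<open>(27, 9)\<close>: \<open>a\<close> sends \<open>(i, k)\<close> to \<open>(i + 1, k)\<close>, \<open>c\<close> to \<open>(\<rho> * i, k + 1)\<close> and the inverse
  of \<open>b\<close> to \<open>(1 + \<rho> + \<dots> + \<rho> ^ (i - 1), k + i)\<close>, where \<open>\<rho> = 1 + 3 * d\<close> is the inverse of \<open>\<alpha>\<close>. The
  polynomial \<open>\<sigma> d i\<close> is that geometric sum modulo \<open>27\<close>.\<close>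

definition \<sigma> :: "int \<Rightarrow> int \<Rightarrow> int" where
  "\<sigma> d i = i * (1 + 15 * d * (i - 1) * (1 + d * (i - 2))) mod 27"

definition Yf :: "int \<Rightarrow> int \<times> int \<Rightarrow> int \<times> int" where
  "Yf d p = (\<sigma> d (fst p), (snd p + fst p) mod 9)"

lemma Yf_pair: "Yf d (i, k) = (\<sigma> d i, (k + i) mod 9)"
  by (simp add: Yf_def)

lemma range27: "{0..<27::int} = {0, 1, 2, 3, 4, 5, 6, 7, 8, 9, 10, 11, 12, 13, 14, 15, 16, 17, 18, 19, 20, 21, 22, 23, 24, 25, 26}"
proof -
  have "{0..<27::int} = set [0..26]" by auto
  also have "[0..26::int] = [0, 1, 2, 3, 4, 5, 6, 7, 8, 9, 10, 11, 12, 13, 14, 15, 16, 17, 18, 19, 20, 21, 22, 23, 24, 25, 26]"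
    by (simp add: upto.simps)
  finally show ?thesis by simp
qed

text \<open>The relation for \<open>b\<close> on the points \<open>(i, 0)\<close>: since the ninth
  power of \<open>Yf d\<close> is trivial, \<open>\<beta>\<close> may be replaced by 7. The values
  of \<open>d\<close> are those for which \<open>1 + 3 * d\<close> is 4, the inverse of 7, modulo
  9.\<close>

lemma Yf_pow_7:
  assumes "d \<in> {1, 4, 7}"
  shows "\<forall>i\<in>{0..<27}. Yf d (Yf d (Yf d (Yf d (Yf d (Yf d (Yf d ((1 + 3 * d) * i mod 27, 0))))))) = ((1 + 3 * d) * \<sigma> d i mod 27, i mod 9)"
  using assms unfolding range27 ball_simps by (elim insertE; simp add: Yf_pair \<sigma>_def)

lemma Yf_pow_9:
  assumes "d \<in> {1, 4, 7}"
  shows "\<forall>i\<in>{0..<27}. Yf d (Yf d (Yf d (Yf d (Yf d (Yf d (Yf d (Yf d (Yf d (i, 0))))))))) = (i, 0)"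
  using assms unfolding range27 ball_simps by (elim insertE; simp add: Yf_pair \<sigma>_def)

text \<open>The recursion of the geometric sum, including the wraparound at \<open>i = 26\<close>.
  The coefficient 15 is \<open>3 / 2\<close> modulo 27: expanding
  \<open>((1 + 3 * d) ^ i - 1) / (3 * d)\<close> by the binomial theorem gives \<open>i\<close>,
  then \<open>3 * d\<close> times \<open>i\<close> over 2, then \<open>9 * d ^ 2\<close> times
  \<open>i\<close> over 3, and all later terms are divisible by 27.\<close>

lemma \<sigma>_Suc:
  assumes "d \<in> {1, 4, 7}"
  shows "\<forall>i\<in>{0..<27}. \<sigma> d ((i + 1) mod 27) = (1 + (1 + 3 * d) * \<sigma> d i) mod 27"
  using assms unfolding range27 ball_simps by (elim insertE; simp add: \<sigma>_def)

definition pts :: "(int \<times> int) set" where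
  "pts = {0..<27} \<times> {0..<9}"

text \<open>The elements of \<open>BijGroup\<close> are functions that are undefined outside the
  set, hence the restriction.\<close>

definition on_pts :: "(int \<times> int \<Rightarrow> int \<times> int) \<Rightarrow> int \<times> int \<Rightarrow> int \<times> int" where
  "on_pts f = restrict f pts"

lemma on_pts_carrier:
  assumes "bij_betw f pts pts"
  shows "on_pts f \<in> carrier (BijGroup pts)"
  using assms by (simp add: BijGroup_def Bij_def on_pts_def cong: bij_betw_cong)

lemma on_pts_mult:
  assumes "bij_betw f pts pts" "bij_betw g pts pts"
  shows "on_pts f \<otimes>\<^bsub>BijGroup pts\<^esub> on_pts g = on_pts (f \<circ> g)"
proof -
  have "on_pts f \<in> Bij pts" "on_pts g \<in> Bij pts"
    using on_pts_carrier assms by (simp_all add: BijGroup_def)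
  moreover have "g x \<in> pts" if "x \<in> pts" for x
    using assms(2) that bij_betwE by blast
  ultimately show ?thesis
    by (auto simp: BijGroup_def on_pts_def compose_def fun_eq_iff)
qed

lemma on_pts_eqI: "(\<And>i k. 0 \<le> i \<Longrightarrow> i < 27 \<Longrightarrow> 0 \<le> k \<Longrightarrow> k < 9 \<Longrightarrow> f (i, k) = g (i, k)) \<Longrightarrow> on_pts f = on_pts g"
  by (auto simp: on_pts_def pts_def fun_eq_iff restrict_def)

lemma on_pts_one: "\<one>\<^bsub>BijGroup pts\<^esub> = on_pts id"
  by (simp add: BijGroup_def on_pts_def id_def)

lemma on_pts_pow:
  assumes "bij_betw f pts pts"
  shows "on_pts f [^]\<^bsub>BijGroup pts\<^esub> (n::nat) = on_pts (f ^^ n)"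
proof (induction n)
  case (Suc n)
  have "bij_betw (f ^^ n) pts pts" using assms by (rule bij_betw_funpow)
  thus ?case using Suc assms on_pts_mult[of "f ^^ n" f] by (simp add: funpow_Suc_right comp_def del: funpow.simps)
qed (simp add: on_pts_one id_def)

definition Af :: "int \<times> int \<Rightarrow> int \<times> int" where
  "Af p = ((fst p + 1) mod 27, snd p)"

definition Cf :: "int \<Rightarrow> int \<times> int \<Rightarrow> int \<times> int" where
  "Cf d p = ((1 + 3 * d) * fst p mod 27, (snd p + 1) mod 9)"

lemma Af_funpow: "i \<in> {0..<27} \<Longrightarrow> (Af ^^ n) (i, k) = ((i + int n) mod 27, k)"
  by (induction n) (auto simp: Af_def mod_simps algebra_simps)

lemma Cf_funpow: "(Cf d ^^ n) (i mod 27, k mod 9) = ((1 + 3 * d) ^ n * i mod 27, (k + int n) mod 9)"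
proof (induction n)
  case (Suc n)
  have "Cf d ((1 + 3 * d) ^ n * i mod 27, (k + int n) mod 9)
      = ((1 + 3 * d) * ((1 + 3 * d) ^ n * i) mod 27, (k + int n + 1) mod 9)"
    by (simp only: Cf_def fst_conv snd_conv mod_mult_right_eq mod_add_left_eq)
  thus ?case using Suc by (simp add: mult.assoc add_ac)
qed simp

lemma Af_bij: "bij_betw Af pts pts"
  by (rule bij_betw_byWitness[where f' = "\<lambda>p. ((fst p - 1) mod 27, snd p)"])
    (auto simp: Af_def pts_def mod_simps)

lemma Cf_bij:
  assumes "[\<alpha> * (1 + 3 * d) = 1] (mod 27)"
  shows "bij_betw (Cf d) pts pts"
proof (rule bij_betw_byWitness[where f' = "\<lambda>p. (\<alpha> * fst p mod 27, (snd p - 1) mod 9)"])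
  have 1: "\<alpha> * ((1 + 3 * d) * i mod 27) mod 27 = i" "(1 + 3 * d) * (\<alpha> * i mod 27) mod 27 = i"
    if "0 \<le> i" "i < 27" for i
  proof -
    have "[\<alpha> * (1 + 3 * d) * i = 1 * i] (mod 27)" using assms by (rule cong_scalar_right)
    hence "(\<alpha> * (1 + 3 * d) * i) mod 27 = i" using that by (simp add: cong_def)
    thus "\<alpha> * ((1 + 3 * d) * i mod 27) mod 27 = i" "(1 + 3 * d) * (\<alpha> * i mod 27) mod 27 = i"
      by (simp_all add: mod_mult_right_eq mult_ac)
  qed
  show "\<forall>p\<in>pts. (\<alpha> * fst (Cf d p) mod 27, (snd (Cf d p) - 1) mod 9) = p"
    using 1 by (auto simp: Cf_def pts_def mod_simps)
  show "\<forall>p\<in>pts. Cf d (\<alpha> * fst p mod 27, (snd p - 1) mod 9) = p"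
    using 1 by (auto simp: Cf_def pts_def mod_simps)
qed (auto simp: Cf_def pts_def)

text \<open>\<open>Yf d\<close> commutes with translations of the second coordinate, which is why
  checks at second coordinate 0 suffice.\<close>

lemma Yf_shift: "Yf d (i, (k + l) mod 9) = (fst (Yf d (i, k)), (snd (Yf d (i, k)) + l) mod 9)"
  by (simp add: Yf_def mod_simps algebra_simps)

lemma Yf_funpow_shift: "(Yf d ^^ n) (i, (k + l) mod 9) = (fst ((Yf d ^^ n) (i, k)), (snd ((Yf d ^^ n) (i, k)) + l) mod 9)"
proof (induction n)
  case (Suc n)
  show ?case using Yf_shift[of d "fst ((Yf d ^^ n) (i, k))" "snd ((Yf d ^^ n) (i, k))" l] Suc by simp
qed simp

lemma Yf_funpow_9:
  assumes "d \<in> {1, 4, 7}" "p \<in> pts"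
  shows "(Yf d ^^ 9) p = p"
proof -
  obtain i k where p: "p = (i, k)" "i \<in> {0..<27}" "k \<in> {0..<9}" using assms(2) by (auto simp: pts_def)
  have "(Yf d ^^ 9) (i, 0) = (i, 0)"
    using Yf_pow_9[OF assms(1)] p(2) by (simp add: eval_nat_numeral)
  thus ?thesis using Yf_funpow_shift[of 9 d i 0 k] p by simp
qed

lemma Yf_bij:
  assumes "d \<in> {1, 4, 7}"
  \<comment> \<open>The inverse is the eighth iterate.\<close>
  shows "bij_betw (Yf d) pts pts"
proof (rule bij_betw_byWitness[where f' = "Yf d ^^ 8"])
  have Y: "Yf d p \<in> pts" for p by (auto simp: Yf_def pts_def \<sigma>_def)
  thus "Yf d ` pts \<subseteq> pts" by auto
  have "(Yf d ^^ n) p \<in> pts" if "p \<in> pts" for n p using that Y by (cases n) auto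
  thus "(Yf d ^^ 8) ` pts \<subseteq> pts" by auto
  have "(Yf d ^^ 8) (Yf d p) = (Yf d ^^ 9) p" "Yf d ((Yf d ^^ 8) p) = (Yf d ^^ 9) p" for p
    using funpow_swap1[of "Yf d" 8 p] by (simp_all add: eval_nat_numeral)
  thus "\<forall>p\<in>pts. (Yf d ^^ 8) (Yf d p) = p" "\<forall>p\<in>pts. Yf d ((Yf d ^^ 8) p) = p"
    using Yf_funpow_9[OF assms] by simp_all
qed

lemma inverse_mod_27:
  assumes "[x = 7] (mod 9)"
  obtains d :: int where "d \<in> {1, 4, 7}" "[x * (1 + 3 * d) = 1] (mod 27)"
proof -
  obtain q where x: "x = 7 + 9 * q" using cong_sym[OF assms] unfolding cong_iff_lin by blast
  have "q mod 3 = 0 \<or> q mod 3 = 1 \<or> q mod 3 = 2" by presburger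
  then obtain l where "q = 3 * l \<or> q = 3 * l + 1 \<or> q = 3 * l + 2"
    by (metis mult_div_mod_eq add.right_neutral)
  thus ?thesis
    using that[of 1] that[of 4] that[of 7] unfolding x cong_iff_dvd_diff
    by (elim disjE) (auto simp: algebra_simps)
qed

text \<open>The separation property comes from applying both sides to \<open>(0, 0)\<close>. The
  powers of \<open>y\<close> fix every \<open>(0, q)\<close>, so the right side gives
  \<open>(0, l)\<close>, while the left gives a unit times \<open>i\<close> in the first coordinate
  and \<open>k\<close> in the second.\<close>

lemma macdonald_model:
  fixes \<alpha> \<beta> :: int
  assumes \<alpha>: "[\<alpha> = 7] (mod 9)" and \<beta>: "[\<beta> = 7] (mod 9)"
  obtains H :: "(int \<times> int \<Rightarrow> int \<times> int) monoid" and x y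
  where "macdonald H x y \<alpha> \<beta>" "x [^]\<^bsub>H\<^esub> (27::int) = \<one>\<^bsub>H\<^esub>" "y [^]\<^bsub>H\<^esub> (27::int) = \<one>\<^bsub>H\<^esub>"
    "\<And>i k l (j::int). gcomm H x y [^]\<^bsub>H\<^esub> int k \<otimes>\<^bsub>H\<^esub> x [^]\<^bsub>H\<^esub> int i = y [^]\<^bsub>H\<^esub> j \<otimes>\<^bsub>H\<^esub> gcomm H x y [^]\<^bsub>H\<^esub> int l
      \<Longrightarrow> [k = l] (mod 9) \<and> 27 dvd i"
proof -
  obtain d where d: "d \<in> {1, 4, 7}" and \<rho>: "[\<alpha> * (1 + 3 * d) = 1] (mod 27)"
    using inverse_mod_27[OF \<alpha>] by blast
  define H where "H = BijGroup pts"
  interpret H: group H unfolding H_def by (rule group_BijGroup)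
  note bijA = Af_bij and bijC = Cf_bij[OF \<rho>] and bijY = Yf_bij[OF d]
  note bij_comp = bij_betw_trans[of _ pts pts _ pts]
  define x Y z y where "x = on_pts Af" and "Y = on_pts (Yf d)" and "z = on_pts (Cf d)" and "y = inv\<^bsub>H\<^esub> Y"
  have [simp]: "x \<in> carrier H" "Y \<in> carrier H" "z \<in> carrier H" "y \<in> carrier H"
    unfolding y_def using on_pts_carrier[OF bijA] on_pts_carrier[OF bijC] on_pts_carrier[OF bijY]
    by (simp_all add: x_def Y_def z_def flip: H_def)
  have pow: "on_pts f [^]\<^bsub>H\<^esub> int n = on_pts (f ^^ n)" if "bij_betw f pts pts" for f n
    using on_pts_pow[OF that] by (simp add: H_def int_pow_int)
  have one: "\<one>\<^bsub>H\<^esub> = on_pts id" by (simp add: H_def on_pts_one)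
  have mult: "on_pts f \<otimes>\<^bsub>H\<^esub> on_pts g = on_pts (f \<circ> g)" if "bij_betw f pts pts" "bij_betw g pts pts" for f g
    using on_pts_mult[OF that] by (simp add: H_def)
  have "x [^]\<^bsub>H\<^esub> int 27 = \<one>\<^bsub>H\<^esub>"
    unfolding x_def pow[OF bijA] one by (rule on_pts_eqI) (simp add: Af_funpow)
  hence x27: "x [^]\<^bsub>H\<^esub> (27::int) = \<one>\<^bsub>H\<^esub>" by simp
  have "Y [^]\<^bsub>H\<^esub> int 9 = \<one>\<^bsub>H\<^esub>"
    unfolding Y_def pow[OF bijY] one by (rule on_pts_eqI) (simp add: Yf_funpow_9[OF d] pts_def)
  hence Y9: "Y [^]\<^bsub>H\<^esub> (9::int) = \<one>\<^bsub>H\<^esub>" by simp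
  have mod9: "(k + j mod 27) mod 9 = (k + j) mod 9" for k j :: int
    by (rule mod_add_cong) (simp_all add: mod_mod_cancel)
  \<comment> \<open>This is \<open>A \<otimes> B = B \<otimes> (A \<otimes> C)\<close> rewritten
    with \<open>Y\<close> as the inverse of \<open>B\<close>. On first coordinates it is the
    recursion \<open>\<sigma>_Suc\<close>.\<close>
  have "Y \<otimes>\<^bsub>H\<^esub> x = x \<otimes>\<^bsub>H\<^esub> z \<otimes>\<^bsub>H\<^esub> Y"
    unfolding x_def Y_def z_def
    by (subst mult, simp_all add: bijA bijC bijY bij_comp)+
      (rule on_pts_eqI, auto simp: Af_def Cf_def Yf_def \<sigma>_Suc[OF d, rule_format] mod9 mod_simps algebra_simps)
  hence gc: "gcomm H x y = z"
    by (simp add: gcomm_def y_def H.m_assoc)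
  have rel_x: "x \<otimes>\<^bsub>H\<^esub> z = z \<otimes>\<^bsub>H\<^esub> x [^]\<^bsub>H\<^esub> \<alpha>"
  proof -
    define n where "n = nat (\<alpha> mod 27)"
    have n: "[int n = \<alpha>] (mod 27)" by (simp add: n_def cong_def)
    have "[(1 + 3 * d) * int n = (1 + 3 * d) * \<alpha>] (mod 27)" using n by (rule cong_scalar_left)
    hence \<rho>n: "[(1 + 3 * d) * int n = 1] (mod 27)" using \<rho> by (metis cong_trans mult.commute)
    have "(1 + 3 * d) * ((i + int n) mod 27) mod 27 = ((1 + 3 * d) * i mod 27 + 1) mod 27" for i
    proof -
      have "[(1 + 3 * d) * i + (1 + 3 * d) * int n = (1 + 3 * d) * i + 1] (mod 27)"
        using \<rho>n by (intro cong_add) auto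
      thus ?thesis by (simp add: cong_def mod_simps distrib_left)
    qed
    hence "x \<otimes>\<^bsub>H\<^esub> z = z \<otimes>\<^bsub>H\<^esub> x [^]\<^bsub>H\<^esub> int n"
      unfolding x_def z_def pow[OF bijA] mult[OF bijA bijC] mult[OF bijC bij_betw_funpow[OF bijA]]
      by (intro on_pts_eqI) (simp add: Af_funpow, simp add: Af_def Cf_def)
    also have "x [^]\<^bsub>H\<^esub> int n = x [^]\<^bsub>H\<^esub> \<alpha>"
      by (rule H.int_pow_cong[OF _ x27 n]) simp
    finally show ?thesis .
  qed
  have Y7: "Y [^]\<^bsub>H\<^esub> int 7 \<otimes>\<^bsub>H\<^esub> z = z \<otimes>\<^bsub>H\<^esub> Y"
    unfolding Y_def z_def pow[OF bijY] mult[OF bij_betw_funpow[OF bijY] bijC] mult[OF bijC bijY]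
  proof (rule on_pts_eqI)
    fix i k :: int assume ik: "0 \<le> i" "i < 27" "0 \<le> k" "k < 9"
    have "(Yf d ^^ 7) ((1 + 3 * d) * i mod 27, 0) = ((1 + 3 * d) * \<sigma> d i mod 27, i mod 9)"
      using Yf_pow_7[OF d] ik by (simp add: eval_nat_numeral)
    hence "(Yf d ^^ 7) ((1 + 3 * d) * i mod 27, (k + 1) mod 9) = ((1 + 3 * d) * \<sigma> d i mod 27, (i mod 9 + (k + 1)) mod 9)"
      using Yf_funpow_shift[of 7 d "(1 + 3 * d) * i mod 27" 0 "k + 1"] by simp
    moreover have "(i mod 9 + (k + 1)) mod 9 = ((k + i) mod 9 + 1) mod 9"
      by (simp only: mod_add_left_eq) (simp add: add_ac)
    ultimately show "((Yf d ^^ 7) \<circ> Cf d) (i, k) = (Cf d \<circ> Yf d) (i, k)"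
      by (simp add: Cf_def Yf_def)
  qed
  have y9: "y [^]\<^bsub>H\<^esub> (9::int) = \<one>\<^bsub>H\<^esub>"
    unfolding y_def by (simp add: H.int_pow_inv Y9)
  have rel_y: "z \<otimes>\<^bsub>H\<^esub> y = y [^]\<^bsub>H\<^esub> \<beta> \<otimes>\<^bsub>H\<^esub> z"
  proof -
    have "y [^]\<^bsub>H\<^esub> \<beta> = y [^]\<^bsub>H\<^esub> (7::int)"
      by (rule H.int_pow_cong[OF _ y9 \<beta>]) simp
    also have "\<dots> = inv\<^bsub>H\<^esub> (Y [^]\<^bsub>H\<^esub> (7::int))"
      unfolding y_def by (simp add: H.int_pow_inv)
    finally have y\<beta>: "y [^]\<^bsub>H\<^esub> \<beta> = inv\<^bsub>H\<^esub> (Y [^]\<^bsub>H\<^esub> (7::int))" .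
    have "z \<otimes>\<^bsub>H\<^esub> y = inv\<^bsub>H\<^esub> (Y [^]\<^bsub>H\<^esub> (7::int)) \<otimes>\<^bsub>H\<^esub> (Y [^]\<^bsub>H\<^esub> int 7 \<otimes>\<^bsub>H\<^esub> z) \<otimes>\<^bsub>H\<^esub> y"
      by (simp add: H.m_assoc)
    also have "\<dots> = inv\<^bsub>H\<^esub> (Y [^]\<^bsub>H\<^esub> (7::int)) \<otimes>\<^bsub>H\<^esub> z"
      unfolding Y7 y_def by (simp add: H.m_assoc)
    finally show ?thesis unfolding y\<beta> .
  qed
  show ?thesis
  proof (rule that[of H x y])
    show "macdonald H x y \<alpha> \<beta>"
      by unfold_locales (simp_all add: gc rel_x rel_y)
    show "x [^]\<^bsub>H\<^esub> (27::int) = \<one>\<^bsub>H\<^esub>" by (rule x27)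
    show "y [^]\<^bsub>H\<^esub> (27::int) = \<one>\<^bsub>H\<^esub>"
      using H.int_pow_pow[of y 9 3] y9 by simp
    fix i k l :: nat and j :: int
    assume eq0: "gcomm H x y [^]\<^bsub>H\<^esub> int k \<otimes>\<^bsub>H\<^esub> x [^]\<^bsub>H\<^esub> int i = y [^]\<^bsub>H\<^esub> j \<otimes>\<^bsub>H\<^esub> gcomm H x y [^]\<^bsub>H\<^esub> int l"
    define m where "m = nat ((- j) mod 9)"
    have "y [^]\<^bsub>H\<^esub> j = Y [^]\<^bsub>H\<^esub> (- j)"
      unfolding y_def by (simp add: H.int_pow_inv H.int_pow_neg)
    also have "\<dots> = Y [^]\<^bsub>H\<^esub> int m"
      by (rule H.int_pow_cong[OF _ Y9]) (simp_all add: m_def cong_def)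
    finally have "y [^]\<^bsub>H\<^esub> j = Y [^]\<^bsub>H\<^esub> int m" .
    hence "z [^]\<^bsub>H\<^esub> int k \<otimes>\<^bsub>H\<^esub> x [^]\<^bsub>H\<^esub> int i = Y [^]\<^bsub>H\<^esub> int m \<otimes>\<^bsub>H\<^esub> z [^]\<^bsub>H\<^esub> int l"
      using eq0 by (simp only: gc)
    hence "on_pts ((Cf d ^^ k) \<circ> (Af ^^ i)) = on_pts ((Yf d ^^ m) \<circ> (Cf d ^^ l))"
      unfolding x_def Y_def z_def pow[OF bijA] pow[OF bijY] pow[OF bijC]
      by (simp only: mult bij_betw_funpow bijA bijY bijC)
    hence "on_pts ((Cf d ^^ k) \<circ> (Af ^^ i)) (0, 0) = on_pts ((Yf d ^^ m) \<circ> (Cf d ^^ l)) (0, 0)"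
      by (rule fun_cong)
    hence eq: "(Cf d ^^ k) ((Af ^^ i) (0, 0)) = (Yf d ^^ m) ((Cf d ^^ l) (0, 0))"
      by (simp add: on_pts_def pts_def)
    have Y0: "(Yf d ^^ m) (0, q mod 9) = (0, q mod 9)" for q
      by (induction m) (simp_all add: Yf_def \<sigma>_def)
    have "((1 + 3 * d) ^ k * int i mod 27, int k mod 9) = (0, int l mod 9)"
      using eq Cf_funpow[of k d "int i" 0] Cf_funpow[of l d 0 0] Y0[of "int l"] by (simp add: Af_funpow)
    hence "27 dvd (1 + 3 * d) ^ k * int i" and kl: "[int k = int l] (mod 9)"
      by (auto simp: cong_def)
    moreover have "coprime 27 ((1 + 3 * d) ^ k)"
    proof -
      have "coprime (3 ^ 3) (1 + 3 * d)"
      proof -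
        have "\<not> 3 dvd 1 + 3 * d" by presburger
        from coprime_3_power[OF this, of 3] show ?thesis by (simp only: coprime_commute)
      qed
      thus ?thesis by (simp only: coprime_power_right_iff) simp
    qed
    ultimately have "27 dvd int i" by (simp add: coprime_dvd_mult_right_iff)
    thus "[k = l] (mod 9) \<and> 27 dvd i"
      using kl by (metis cong_int_iff int_dvd_int_iff of_nat_numeral)
  qed
qed

section \<open>Nilpotency class\<close>

context group
begin

lemma gcomm_closed [simp]: "x \<in> carrier G \<Longrightarrow> y \<in> carrier G \<Longrightarrow> gcomm G x y \<in> carrier G"
  by (simp add: gcomm_def)

lemma gcomm_mult_left:
  assumes "s \<in> carrier G" "t \<in> carrier G" "g \<in> carrier G"
  shows "gcomm G (s \<otimes> t) g = inv t \<otimes> gcomm G s g \<otimes> t \<otimes> gcomm G t g"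
  using assms by (simp add: gcomm_def inv_mult_group m_assoc)

lemma gcomm_mult_right:
  assumes "s \<in> carrier G" "g \<in> carrier G" "h \<in> carrier G"
  shows "gcomm G s (g \<otimes> h) = gcomm G s h \<otimes> (inv h \<otimes> gcomm G s g \<otimes> h)"
  using assms by (simp add: gcomm_def inv_mult_group m_assoc)

lemma gcomm_inv_left:
  assumes "s \<in> carrier G" "g \<in> carrier G"
  shows "gcomm G (inv s) g = s \<otimes> inv (gcomm G s g) \<otimes> inv s"
  using assms by (simp add: gcomm_def inv_mult_group m_assoc)

lemma gcomm_inv_right:
  assumes "s \<in> carrier G" "g \<in> carrier G"
  shows "gcomm G s (inv g) = g \<otimes> inv (gcomm G s g) \<otimes> inv g"
  using assms by (simp add: gcomm_def inv_mult_group m_assoc)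

lemma gcomm_one [simp]: "g \<in> carrier G \<Longrightarrow> gcomm G \<one> g = \<one>" "g \<in> carrier G \<Longrightarrow> gcomm G g \<one> = \<one>"
  by (simp_all add: gcomm_def)

text \<open>Commuting modulo a normal subgroup may be tested on generators: the commutator
  identities express the new commutators by conjugates of the old ones, in one induction for each
  argument.\<close>

lemma gcomm_generate_mem:
  assumes N: "N \<lhd> G" and S: "S \<subseteq> carrier G" and U: "U \<subseteq> carrier G"
    and SU: "\<And>s x. s \<in> S \<Longrightarrow> x \<in> U \<Longrightarrow> gcomm G s x \<in> N"
    and s: "s \<in> generate G S" and x: "x \<in> generate G U"
  shows "gcomm G s x \<in> N"
proof -
  interpret N: normal N G by (rule N)
  have Uc: "g \<in> carrier G" if "g \<in> generate G U" for g using generate_in_carrier[OF U that] .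
  have Sc: "g \<in> carrier G" if "g \<in> generate G S" for g using generate_in_carrier[OF S that] .
  have 1: "gcomm G t x \<in> N" if t: "t \<in> S" for t
    using x
  proof (induction rule: generate.induct)
    case one
    show ?case using S t by auto
  next
    case (incl h)
    thus ?case using SU t by simp
  next
    case (inv h)
    hence "h \<in> carrier G" "t \<in> carrier G" using S U t by auto
    thus ?case using SU[OF t inv] by (simp add: gcomm_inv_right N.inv_op_closed2)
  next
    case (eng g h)
    hence "g \<in> carrier G" "h \<in> carrier G" "t \<in> carrier G" using S Uc t by auto
    thus ?case using eng by (simp add: gcomm_mult_right N.inv_op_closed1)
  qed
  have xc: "x \<in> carrier G" by (rule Uc[OF x])
  show ?thesis
    using s
  proof (induction rule: generate.induct)
    case one
    show ?case using xc by simp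
  next
    case (incl h)
    thus ?case using 1 by simp
  next
    case (inv h)
    hence "h \<in> carrier G" using S by auto
    thus ?case using 1[OF inv] xc by (simp add: gcomm_inv_left N.inv_op_closed2)
  next
    case (eng g h)
    hence "g \<in> carrier G" "h \<in> carrier G" using Sc by auto
    thus ?case using eng xc by (simp add: gcomm_mult_left N.inv_op_closed1)
  qed
qed

text \<open>A central series is built from the bottom up, one application per term. Normality of the
  new term comes for free: a conjugate of \<open>s\<close> differs from \<open>s\<close> by a
  commutator, which lies in \<open>N\<close> and hence in \<open>generate G S\<close>.\<close>

lemma central_series_step:
  assumes N: "N \<lhd> G" and S: "S \<subseteq> carrier G" and U: "U \<subseteq> carrier G" "carrier G = generate G U"
    and NS: "N \<subseteq> generate G S"
    and SU: "\<And>s x. s \<in> S \<Longrightarrow> x \<in> U \<Longrightarrow> gcomm G s x \<in> N"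
  shows "generate G S \<lhd> G" and "\<And>s g. s \<in> generate G S \<Longrightarrow> g \<in> carrier G \<Longrightarrow> gcomm G s g \<in> N"
proof -
  show 1: "gcomm G s g \<in> N" if "s \<in> generate G S" "g \<in> carrier G" for s g
    using gcomm_generate_mem[OF N S U(1) SU] that U(2) by simp
  have sub: "subgroup (generate G S) G" by (rule generate_is_subgroup[OF S])
  show "generate G S \<lhd> G"
  proof (rule normal_invI[OF sub])
    fix g s assume g: "g \<in> carrier G" and s: "s \<in> generate G S"
    have sc: "s \<in> carrier G" by (rule generate_in_carrier[OF S s])
    have "g \<otimes> s \<otimes> inv g = s \<otimes> gcomm G s (inv g)"
      using g sc by (simp add: gcomm_def m_assoc)
    moreover have "gcomm G s (inv g) \<in> generate G S"
      using 1[OF s, of "inv g"] g NS by auto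
    ultimately show "g \<otimes> s \<otimes> inv g \<in> generate G S"
      using subgroup.m_closed[OF sub s] by simp
  qed
qed

lemma lcs_subset:
  assumes M0: "M 0 = carrier G" and sub: "\<And>n. subgroup (M n) G"
    and comm: "\<And>n x g. x \<in> M n \<Longrightarrow> g \<in> carrier G \<Longrightarrow> gcomm G x g \<in> M (Suc n)"
  shows "lcs G n \<subseteq> M n"
proof (induction n)
  case (Suc n)
  show ?case
    unfolding lcs.simps by (rule generate_subgroup_incl[OF _ sub]) (use Suc comm in blast)
qed (simp add: M0)

lemma lcs_Suc_trivial:
  assumes "lcs G n = {\<one>}"
  shows "lcs G (Suc n) = {\<one>}"
proof -
  have "{gcomm G x y | x y. x \<in> lcs G n \<and> y \<in> carrier G} \<subseteq> {\<one>}"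
    unfolding assms by auto
  hence "lcs G (Suc n) \<subseteq> {\<one>}"
    unfolding lcs.simps by (rule generate_subgroup_incl[OF _ triv_subgroup])
  moreover have "\<one> \<in> lcs G (Suc n)"
    unfolding lcs.simps by (rule generate.one)
  ultimately show ?thesis by blast
qed

lemma lcs_mem_gcomm: "x \<in> lcs G n \<Longrightarrow> y \<in> carrier G \<Longrightarrow> gcomm G x y \<in> lcs G (Suc n)"
  unfolding lcs.simps by (rule generate.incl) blast

lemma nilpotency_class_eqI:
  assumes "lcs G (Suc n) = {\<one>}" "lcs G n \<noteq> {\<one>}"
  shows "nilpotency_class G = Suc n"
  unfolding nilpotency_class_def
proof (rule Least_equality)
  fix m assume m: "lcs G m = {\<one>}"
  show "Suc n \<le> m"
  proof (rule ccontr)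
    assume "\<not> Suc n \<le> m"
    hence "m \<le> n" by simp
    hence "lcs G n = {\<one>}" using m
      by (induction n rule: dec_induct) (simp_all only: lcs_Suc_trivial)
    thus False using assms(2) by contradiction
  qed
qed (rule assms)

end

section \<open>Congruences for the exponents in the commutators\<close>

lemma gsum_3_mod_27:
  assumes "[x = 7] (mod 9)"
  shows "[gsum x 3 = 3] (mod 27)"
proof -
  obtain q where x: "x = 7 + 9 * q" using cong_sym[OF assms] unfolding cong_iff_lin by blast
  have "gsum x 3 - 3 = 27 * (2 + 5 * q + 3 * q ^ 2)"
    by (simp add: gsum_def eval_nat_numeral x algebra_simps)
  thus ?thesis by (simp add: cong_iff_dvd_diff)
qed

lemma pow_3_mod_27:
  fixes x :: int
  assumes "[x = 7] (mod 9)"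
  shows "[x ^ 3 = 19] (mod 27)"
proof -
  obtain q where x: "x = 7 + 9 * q" using cong_sym[OF assms] unfolding cong_iff_lin by blast
  have "x ^ 3 - 19 = 27 * (12 + 49 * q + 63 * q ^ 2 + 27 * q ^ 3)"
    by (simp add: eval_nat_numeral x algebra_simps)
  thus ?thesis by (simp add: cong_iff_dvd_diff)
qed

lemma pow_9_mod_27:
  fixes x :: int
  assumes "[x = 7] (mod 9)"
  shows "[x ^ 9 = 1] (mod 27)"
  using cong_dvd_modulus[OF pow_mod_81(1)[OF assms], of 27] by (simp add: cong_def)

text \<open>This is the exponent left over in the commutator of \<open>A [^] 3\<close> with
  \<open>B\<close>, by \<open>gcomm_A_pow_B\<close>. Divisibility by 9 puts that commutator two
  steps above the bottom of the central series; the analogue for 9 makes \<open>A [^] 9\<close>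
  central.\<close>

lemma gcomm_exponent_3:
  assumes "[x = 7] (mod 9)"
  shows "9 dvd x * gsum x 3 - 3 * x ^ 3"
proof -
  have "[x * gsum x 3 - 3 * x ^ 3 = 7 * 3 - 3 * 19] (mod 9)"
    by (intro cong_diff cong_mult assms cong_refl cong_dvd_modulus[OF gsum_3_mod_27[OF assms], of 9]
        cong_dvd_modulus[OF pow_3_mod_27[OF assms], of 9]) auto
  thus ?thesis by (simp add: cong_dvd_iff)
qed

lemma gcomm_exponent_9:
  assumes "[x = 7] (mod 9)"
  shows "27 dvd x * gsum x 9 - 9 * x ^ 9"
proof -
  have x3: "[x ^ 3 = 1] (mod 9)"
    using cong_dvd_modulus[OF pow_3_mod_27[OF assms], of 9] by (simp add: cong_def)
  obtain a where a: "gsum x 3 = 3 + 27 * a"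
    using cong_sym[OF gsum_3_mod_27[OF assms]] unfolding cong_iff_lin by blast
  obtain b where "gsum (x ^ 3) 3 = gsum 1 3 + 9 * b"
    using cong_sym[OF gsum_cong[OF x3]] unfolding cong_iff_lin by blast
  hence b: "gsum (x ^ 3) 3 = 3 + 9 * b" by simp
  have "gsum x 9 = 9 + 27 * (b + 3 * a + 9 * (a * b))"
    using gsum_mult[of x 3 3] by (simp add: a b algebra_simps)
  moreover obtain c where c: "x ^ 9 = 1 + 27 * c"
    using cong_sym[OF pow_9_mod_27[OF assms]] unfolding cong_iff_lin by blast
  moreover obtain q where "x = 7 + 9 * q" using cong_sym[OF assms] unfolding cong_iff_lin by blast
  ultimately have "x * gsum x 9 - 9 * x ^ 9 = 27 * (x * (b + 3 * a + 9 * (a * b)) + 2 + 3 * q - 9 * c)"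
    by (simp add: algebra_simps)
  thus ?thesis by simp
qed

section \<open>Commutators of powers and the lower central series\<close>

context macdonald
begin

lemma gcomm_A_pow_B: "gcomm G (A [^] int n) B = C [^] int n \<otimes> A [^] (\<alpha> * gsum \<alpha> n - int n * \<alpha> ^ n)"
proof -
  have "gcomm G (A [^] int n) B = A [^] (- int n) \<otimes> (inv B \<otimes> (A [^] int n \<otimes> B))"
    by (simp add: gcomm_def m_assoc int_pow_neg)
  also have "\<dots> = (A [^] (- int n) \<otimes> C [^] int n) \<otimes> A [^] (\<alpha> * gsum \<alpha> n)"
    unfolding A_pow_B by (simp add: m_assoc)
  also have "\<dots> = C [^] int n \<otimes> A [^] (- int n * \<alpha> ^ n + \<alpha> * gsum \<alpha> n)"
    unfolding A_pow_C_pow by (simp add: m_assoc flip: int_pow_mult)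
  finally show ?thesis by (simp add: add.commute)
qed

lemma gcomm_B_pow_A: "gcomm G (B [^] int n) A = C [^] (- int n) \<otimes> B [^] (\<beta> * gsum \<beta> n - int n * \<beta> ^ n)"
proof -
  interpret swap: macdonald G B A \<beta> \<alpha> by (rule macdonald_swap)
  show ?thesis using swap.gcomm_A_pow_B[of n] unfolding gcomm_swap by (simp add: int_pow_inv int_pow_neg)
qed

lemma gcomm_C_pow_A: "gcomm G (C [^] int n) A = A [^] (1 - \<alpha> ^ n)"
proof -
  have "gcomm G (C [^] int n) A = C [^] (- int n) \<otimes> (A [^] (-1::int) \<otimes> C [^] int n) \<otimes> A"
    by (simp add: gcomm_def m_assoc int_pow_neg)
  also have "\<dots> = A [^] (- (\<alpha> ^ n)) \<otimes> A"
    unfolding A_pow_C_pow by (simp add: m_assoc int_pow_mult_assoc)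
  also have "\<dots> = A [^] (- (\<alpha> ^ n) + 1)" using int_pow_mult[of A "- (\<alpha> ^ n)" 1] by simp
  finally show ?thesis by simp
qed

lemma gcomm_C_pow_B: "gcomm G (C [^] int n) B = inv (C [^] int n) \<otimes> B [^] (\<beta> ^ n - 1) \<otimes> C [^] int n"
proof -
  have "gcomm G (C [^] int n) B = inv (C [^] int n) \<otimes> (inv B \<otimes> (C [^] int n \<otimes> B [^] (1::int)))"
    by (simp add: gcomm_def m_assoc)
  also have "\<dots> = inv (C [^] int n) \<otimes> (B [^] (-1::int) \<otimes> (B [^] (\<beta> ^ n) \<otimes> C [^] int n))"
    unfolding C_pow_B_pow by (simp add: int_pow_neg)
  finally show ?thesis by (simp add: int_pow_mult_assoc m_assoc)
qed

lemma gcomm_pow_self: "x \<in> carrier G \<Longrightarrow> gcomm G (x [^] (i::int)) x = \<one>"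
  using int_pow_intertwine[of x x x i] by (simp add: gcomm_def m_assoc)

text \<open>The sets \<open>S2\<close> to \<open>S5\<close> generate the proper terms of a
  descending central series of length 5, which bounds the class from above. For sharpness,
  \<open>C\<close> is commuted with \<open>A\<close>, then \<open>B\<close>, then \<open>A\<close>
  again; the result is \<open>A [^] 9\<close>, lying in \<open>lcs G 4\<close>.\<close>

lemma nilpotency_class_5:
  assumes gen: "carrier G = generate G {A, B}"
    and A27: "A [^] (27::int) = \<one>" and B27: "B [^] (27::int) = \<one>" and C9: "C [^] (9::int) = \<one>"
    and A9: "A [^] (9::int) \<noteq> \<one>"
    and \<alpha>: "[\<alpha> = 7] (mod 9)" and \<beta>: "[\<beta> = 7] (mod 9)"
  shows "nilpotency_class G = 5"
proof -
  define S2 S3 S4 S5 where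
    "S2 = {C, A [^] (3::int), B [^] (3::int)}" and "S3 = {A [^] (3::int), B [^] (3::int), C [^] (3::int)}" and
    "S4 = {C [^] (3::int), A [^] (9::int), B [^] (9::int)}" and "S5 = {A [^] (9::int), B [^] (9::int)}"
  note S_defs = S2_def S3_def S4_def S5_def
  have Sc: "S2 \<subseteq> carrier G" "S3 \<subseteq> carrier G" "S4 \<subseteq> carrier G" "S5 \<subseteq> carrier G"
    by (auto simp: S_defs)
  have U: "{A, B} \<subseteq> carrier G" by simp
  have sub: "subgroup (generate G S) G" if "S \<subseteq> carrier G" for S
    using that by (rule generate_is_subgroup)
  have pow_mem: "x [^] j \<in> generate G S"
    if "x [^] i \<in> S" "S \<subseteq> carrier G" "i dvd j" "x \<in> carrier G" for x S and i j :: int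
  proof -
    from that(3) obtain k where "j = i * k" by blast
    thus ?thesis
      using subgroup_int_pow_closed[OF sub[OF that(2)] generate.incl[OF that(1)], of k] that(4) by (simp add: int_pow_pow)
  qed
  note closed = subgroup.m_closed[OF sub] subgroup.one_closed[OF sub]
  have d: "3 dvd 1 - \<alpha>" "3 dvd \<beta> - 1" "9 dvd 1 - \<alpha> ^ 3" "9 dvd \<beta> ^ 3 - 1"
  proof -
    have "[\<alpha> = 7] (mod 3)" "[\<beta> = 7] (mod 3)"
      using cong_dvd_modulus[OF \<alpha>, of 3] cong_dvd_modulus[OF \<beta>, of 3] by simp_all
    thus "3 dvd 1 - \<alpha>" "3 dvd \<beta> - 1"
      by (simp_all add: mod_eq_dvd_iff[symmetric] cong_def)
    have "[\<alpha> ^ 3 = 19] (mod 9)" "[\<beta> ^ 3 = 19] (mod 9)"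
      using cong_dvd_modulus[OF pow_3_mod_27[OF \<alpha>], of 9] cong_dvd_modulus[OF pow_3_mod_27[OF \<beta>], of 9] by simp_all
    thus "9 dvd 1 - \<alpha> ^ 3" "9 dvd \<beta> ^ 3 - 1"
      by (simp_all add: mod_eq_dvd_iff[symmetric] cong_def)
  qed
  have 27: "A [^] (27 * k) = \<one>" "B [^] (27 * k) = \<one>" "C [^] (9 * k) = \<one>" for k :: int
    using A27 B27 C9 by (simp_all flip: int_pow_pow)
  have A9B: "gcomm G (A [^] (9::int)) B = \<one>"
  proof -
    obtain k where "\<alpha> * gsum \<alpha> 9 - 9 * \<alpha> ^ 9 = 27 * k" using gcomm_exponent_9[OF \<alpha>] by blast
    thus ?thesis using gcomm_A_pow_B[of 9] 27(1)[of k] C9 by simp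
  qed
  have B9A: "gcomm G (B [^] (9::int)) A = \<one>"
  proof -
    obtain k where "\<beta> * gsum \<beta> 9 - 9 * \<beta> ^ 9 = 27 * k" using gcomm_exponent_9[OF \<beta>] by blast
    thus ?thesis using gcomm_B_pow_A[of 9] 27(2)[of k] 27(3)[of "-1"] by simp
  qed
  have A3B: "gcomm G (A [^] (3::int)) B = C [^] (3::int) \<otimes> A [^] (\<alpha> * gsum \<alpha> 3 - 3 * \<alpha> ^ 3)"
    and B3A: "gcomm G (B [^] (3::int)) A = C [^] (-3::int) \<otimes> B [^] (\<beta> * gsum \<beta> 3 - 3 * \<beta> ^ 3)"
    and C3A: "gcomm G (C [^] (3::int)) A = A [^] (1 - \<alpha> ^ 3)"
    and C3B: "gcomm G (C [^] (3::int)) B = inv (C [^] (3::int)) \<otimes> B [^] (\<beta> ^ 3 - 1) \<otimes> C [^] (3::int)"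
    and C1A: "gcomm G C A = A [^] (1 - \<alpha>)"
    and C1B: "gcomm G C B = inv C \<otimes> B [^] (\<beta> - 1) \<otimes> C"
    using gcomm_A_pow_B[of 3] gcomm_B_pow_A[of 3] gcomm_C_pow_A[of 3] gcomm_C_pow_B[of 3]
      gcomm_C_pow_A[of 1] gcomm_C_pow_B[of 1] by simp_all
  note self = gcomm_pow_self[OF A_closed] gcomm_pow_self[OF B_closed]
  have S5: "gcomm G s x \<in> {\<one>}" if "s \<in> S5" "x \<in> {A, B}" for s x
    using that A9B B9A self by (auto simp: S5_def)
  have "{\<one>} \<subseteq> generate G S5" by (simp add: generate.one)
  note step5 = central_series_step[OF one_is_normal Sc(4) U gen this S5]
  have S4: "gcomm G s x \<in> generate G S5" if "s \<in> S4" "x \<in> {A, B}" for s x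
  proof -
    have "A [^] (1 - \<alpha> ^ 3) \<in> generate G S5"
      by (rule pow_mem[OF _ Sc(4) d(3)]) (auto simp: S5_def)
    moreover have "B [^] (\<beta> ^ 3 - 1) \<in> generate G S5"
      by (rule pow_mem[OF _ Sc(4) d(4)]) (auto simp: S5_def)
    hence "gcomm G (C [^] (3::int)) B \<in> generate G S5"
      unfolding C3B using normal.inv_op_closed1[OF step5(1)] by simp
    ultimately show ?thesis
      using that A9B B9A self C3A generate.one[of G S5] by (auto simp: S4_def)
  qed
  have "generate G S5 \<subseteq> generate G S4" by (rule mono_generate) (auto simp: S_defs)
  note step4 = central_series_step[OF step5(1) Sc(3) U gen this S4]
  have S3: "gcomm G s x \<in> generate G S4" if "s \<in> S3" "x \<in> {A, B}" for s x
  proof -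
    have "A [^] (\<alpha> * gsum \<alpha> 3 - 3 * \<alpha> ^ 3) \<in> generate G S4"
      by (rule pow_mem[OF _ Sc(3) gcomm_exponent_3[OF \<alpha>]]) (auto simp: S4_def)
    moreover have "C [^] (3::int) \<in> generate G S4"
      by (rule generate.incl) (simp add: S4_def)
    ultimately have 1: "gcomm G (A [^] (3::int)) B \<in> generate G S4"
      unfolding A3B by (rule closed(1)[OF Sc(3), rotated])
    have "B [^] (\<beta> * gsum \<beta> 3 - 3 * \<beta> ^ 3) \<in> generate G S4"
      by (rule pow_mem[OF _ Sc(3) gcomm_exponent_3[OF \<beta>]]) (auto simp: S4_def)
    moreover have "C [^] (-3::int) \<in> generate G S4"
      by (rule pow_mem[OF _ Sc(3), of C 3]) (auto simp: S4_def)
    ultimately have 2: "gcomm G (B [^] (3::int)) A \<in> generate G S4"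
      unfolding B3A by (rule closed(1)[OF Sc(3), rotated])
    have "C [^] (3::int) \<in> S4" by (simp add: S4_def)
    hence "gcomm G (C [^] (3::int)) x \<in> generate G S4"
      using S4[of "C [^] (3::int)" x] that(2) \<open>generate G S5 \<subseteq> generate G S4\<close> by blast
    thus ?thesis
      using that 1 2 self generate.one[of G S4] by (auto simp: S3_def)
  qed
  have "generate G S4 \<subseteq> generate G S3"
  proof (rule generate_subgroup_incl[OF _ sub[OF Sc(2)]])
    have "A [^] (9::int) \<in> generate G S3" "B [^] (9::int) \<in> generate G S3" "C [^] (3::int) \<in> generate G S3"
      by (rule pow_mem[OF _ Sc(2), of _ 3], simp add: S3_def, simp, simp)+
    thus "S4 \<subseteq> generate G S3" by (simp add: S4_def)
  qed
  note step3 = central_series_step[OF step4(1) Sc(2) U gen this S3]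
  have S2: "gcomm G s x \<in> generate G S3" if "s \<in> S2" "x \<in> {A, B}" for s x
  proof -
    have "A [^] (1 - \<alpha>) \<in> generate G S3"
      by (rule pow_mem[OF _ Sc(2) d(1)]) (auto simp: S3_def)
    moreover have "B [^] (\<beta> - 1) \<in> generate G S3"
      by (rule pow_mem[OF _ Sc(2) d(2)]) (auto simp: S3_def)
    hence "gcomm G C B \<in> generate G S3"
      unfolding C1B using normal.inv_op_closed1[OF step3(1)] by simp
    moreover have "gcomm G (A [^] (3::int)) x \<in> generate G S3" "gcomm G (B [^] (3::int)) x \<in> generate G S3"
      using S3[of "A [^] (3::int)" x] S3[of "B [^] (3::int)" x] that(2)
        \<open>generate G S4 \<subseteq> generate G S3\<close> by (auto simp: S3_def)
    ultimately show ?thesis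
      using that C1A by (auto simp: S2_def)
  qed
  have "generate G S3 \<subseteq> generate G S2"
  proof (rule generate_subgroup_incl[OF _ sub[OF Sc(1)]])
    have "A [^] (3::int) \<in> generate G S2" "B [^] (3::int) \<in> generate G S2"
      by (rule generate.incl, simp add: S2_def)+
    moreover have "C [^] (3::int) \<in> generate G S2"
      by (rule pow_mem[OF _ Sc(1), of _ 1]) (simp_all add: S2_def)
    ultimately show "S3 \<subseteq> generate G S2" by (simp add: S3_def)
  qed
  note step2 = central_series_step[OF step3(1) Sc(1) U gen this S2]
  have S1: "gcomm G s x \<in> generate G S2" if "s \<in> {A, B}" "x \<in> {A, B}" for s x
  proof -
    have "C \<in> generate G S2" by (rule generate.incl) (simp add: S2_def)
    moreover have "gcomm G B A \<in> generate G S2"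
      unfolding gcomm_swap using generate_m_inv_closed[OF Sc(1) \<open>C \<in> _\<close>] .
    ultimately show ?thesis
      using that self[of 1] generate.one[of G S2] by auto
  qed
  have "generate G S2 \<subseteq> generate G {A, B}"
    using generate_in_carrier[OF Sc(1)] gen by blast
  note step1 = central_series_step[OF step2(1) U U gen this S1]
  define M where "M = (\<lambda>n::nat. if n = 0 then carrier G else if n = 1 then generate G S2 else
     if n = 2 then generate G S3 else if n = 3 then generate G S4 else if n = 4 then generate G S5 else {\<one>})"
  have "lcs G 5 \<subseteq> M 5"
  proof (rule lcs_subset)
    show "subgroup (M n) G" for n
      using sub[OF Sc(1)] sub[OF Sc(2)] sub[OF Sc(3)] sub[OF Sc(4)] subgroup_self triv_subgroup by (simp add: M_def)
    fix n x g assume "x \<in> M n" "g \<in> carrier G"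
    thus "gcomm G x g \<in> M (Suc n)"
      using step1(2)[of x g] step2(2)[of x g] step3(2)[of x g] step4(2)[of x g] step5(2)[of x g] gen
      by (auto simp: M_def split: if_splits)
  qed (simp add: M_def)
  moreover have "\<one> \<in> lcs G 5"
    unfolding eval_nat_numeral lcs.simps by (rule generate.one)
  ultimately have L5: "lcs G 5 = {\<one>}" by (auto simp: M_def)
  \<comment> \<open>The commutator of \<open>C\<close> with \<open>A\<close> is
    \<open>A [^] (1 - \<alpha>)\<close>; the next formula needs a natural exponent.\<close>
  define l where "l = nat ((1 - \<alpha>) mod 27)"
  have l: "[int l = 1 - \<alpha>] (mod 27)" by (simp add: l_def cong_def)
  have "C \<in> lcs G 1"
    using lcs_mem_gcomm[of A 0 B] by simp
  hence "gcomm G C A \<in> lcs G 2"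
    using lcs_mem_gcomm[of C 1 A] by (simp add: eval_nat_numeral)
  moreover have "A [^] (1 - \<alpha>) = A [^] int l"
    by (rule int_pow_cong[OF A_closed A27 cong_sym[OF l]])
  ultimately have "A [^] int l \<in> lcs G 2" using C1A by simp
  hence "gcomm G (A [^] int l) B \<in> lcs G 3"
    using lcs_mem_gcomm[of "A [^] int l" 2 B] by (simp add: eval_nat_numeral)
  hence "gcomm G (C [^] int l \<otimes> A [^] (\<alpha> * gsum \<alpha> l - int l * \<alpha> ^ l)) A \<in> lcs G 4"
    unfolding gcomm_A_pow_B using lcs_mem_gcomm[of _ 3 A] by (simp add: eval_nat_numeral)
  \<comment> \<open>The power of \<open>A\<close> commutes with \<open>A\<close>, so only the power
    of \<open>C\<close> matters.\<close>
  moreover have "gcomm G (C [^] int l \<otimes> A [^] e) A = A [^] (1 - \<alpha> ^ l)" for e :: int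
    by (simp add: gcomm_mult_left gcomm_C_pow_A self int_pow_mult_assoc m_assoc flip: int_pow_neg int_pow_mult)
  ultimately have "A [^] (1 - \<alpha> ^ l) \<in> lcs G 4" by simp
  moreover have "A [^] (1 - \<alpha> ^ l) = A [^] (9::int)"
  proof (rule int_pow_cong[OF A_closed A27])
    obtain q where q: "1 - \<alpha> = 3 + 9 * q"
    proof -
      obtain q where "\<alpha> = 7 + 9 * q" using cong_sym[OF \<alpha>] unfolding cong_iff_lin by blast
      thus ?thesis using that[of "- q - 1"] by simp
    qed
    \<comment> \<open>\<open>1 - 7\<close> is 3 modulo 9. As \<open>\<alpha> ^ 9\<close> is 1 modulo
      27, \<open>\<alpha> ^ l\<close> equals \<open>\<alpha> ^ 3\<close>, that is 19, and
      \<open>1 - 19\<close> is 9 modulo 27.\<close>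
    have "[int l = 3] (mod 9)"
      using cong_dvd_modulus[OF l, of 9] unfolding q by (simp add: cong_def)
    hence "[l = 3] (mod 9)" by (metis cong_int_iff of_nat_numeral)
    hence "l mod 9 = 3" by (simp add: cong_def)
    hence l9: "l = 9 * (l div 9) + 3" using mult_div_mod_eq[of 9 l] by simp
    have "[(\<alpha> ^ 9) ^ (l div 9) * \<alpha> ^ 3 = 1 ^ (l div 9) * 19] (mod 27)"
      by (intro cong_mult cong_pow pow_9_mod_27 pow_3_mod_27 \<alpha>)
    hence "[\<alpha> ^ l = 19] (mod 27)"
      by (subst l9) (simp add: power_add power_mult)
    hence "[1 - \<alpha> ^ l = 1 - 19] (mod 27)" by (intro cong_diff) auto
    thus "[1 - \<alpha> ^ l = 9] (mod 27)" by (simp add: cong_def)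
  qed
  ultimately have "lcs G 4 \<noteq> {\<one>}" using A9 by auto
  thus ?thesis using nilpotency_class_eqI[of 4] L5 by (simp add: eval_nat_numeral)
qed

end

section \<open>Direct product decomposition\<close>

lemma (in group) ord_dvd_card_subgroup:
  assumes H: "subgroup H G" "finite H" and x: "x \<in> H"
  shows "ord x dvd card H"
proof -
  interpret H: group "G\<lparr>carrier := H\<rparr>" by (rule subgroup.subgroup_is_group[OF H(1) group_axioms])
  have "x [^]\<^bsub>G\<lparr>carrier := H\<rparr>\<^esub> order (G\<lparr>carrier := H\<rparr>) = \<one>\<^bsub>G\<lparr>carrier := H\<rparr>\<^esub>"
    by (rule H.pow_order_eq_1) (use x in simp)
  hence "x [^] card H = \<one>"
    by (simp add: order_def flip: nat_pow_consistent)
  thus ?thesis using pow_eq_id[of x] subgroup.mem_carrier[OF H(1) x] by simp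
qed

text \<open>\<open>P\<close> and \<open>Q\<close> meet trivially, so a power of
  \<open>x \<otimes> y\<close> is trivial only if the same powers of \<open>x\<close> and
  \<open>y\<close> are. Hence the elements of \<open>p\<close>-power order are those with trivial
  \<open>Q\<close>-component, those of order prime to \<open>p\<close> have trivial
  \<open>P\<close>-component, and uniqueness of factorisation evaluates the description in
  \<open>sylow_proj\<close>.\<close>

lemma (in group) sylow_of_direct_product:
  fixes p n :: nat
  assumes p: "Factorial_Ring.prime p"
    and P: "subgroup P G" "card P = p ^ n"
    and Q: "subgroup Q G" "finite Q" "coprime (card Q) p"
    and comm: "\<And>x y. x \<in> P \<Longrightarrow> y \<in> Q \<Longrightarrow> x \<otimes> y = y \<otimes> x"
    and prod: "\<And>g. g \<in> carrier G \<Longrightarrow> \<exists>x\<in>P. \<exists>y\<in>Q. g = x \<otimes> y"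
  shows "p_elems G p = P" and "\<And>x y. x \<in> P \<Longrightarrow> y \<in> Q \<Longrightarrow> sylow_proj G p (x \<otimes> y) = x"
proof -
  have Pc: "x \<in> carrier G" if "x \<in> P" for x using subgroup.mem_carrier[OF P(1) that] .
  have Qc: "x \<in> carrier G" if "x \<in> Q" for x using subgroup.mem_carrier[OF Q(1) that] .
  have "card P > 0" using P(2) p by (simp add: prime_gt_0_nat)
  hence finP: "finite P" by (rule card_ge_0_finite)
  have ordP: "\<exists>k. ord x = p ^ k" if "x \<in> P" for x
    using ord_dvd_card_subgroup[OF P(1) finP that] divides_primepow_nat[OF p] P(2) by auto
  have ordQ: "coprime (ord y) p" "ord y \<noteq> 0" if "y \<in> Q" for y
  proof -
    have dvd: "ord y dvd card Q" by (rule ord_dvd_card_subgroup[OF Q(1,2) that])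
    thus "coprime (ord y) p" using Q(3) by (rule coprime_divisors[OF _ dvd_refl])
    have "card Q \<noteq> 0" using that Q(2) by auto
    thus "ord y \<noteq> 0" using dvd by auto
  qed
  have one: "x = \<one>" if "x \<in> carrier G" "ord x dvd a" "ord x dvd b" "coprime a b" for x a b
    using that by (metis coprime_common_divisor_nat ord_eq_1 nat_dvd_1_iff_1)
  have PQ: "x = \<one>" if x: "x \<in> P" "x \<in> Q" for x
  proof -
    obtain k where k: "ord x = p ^ k" using ordP[OF x(1)] by blast
    have "coprime (ord x) (ord x)" using ordQ(1)[OF x(2)] unfolding k by auto
    thus ?thesis using one[OF Pc[OF x(1)] dvd_refl dvd_refl] by blast
  qed
  have pow: "x [^] m = \<one> \<and> y [^] m = \<one>"
    if xy: "x \<in> P" "y \<in> Q" and eq: "(x \<otimes> y) [^] m = \<one>" for x y and m :: nat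
  proof -
    have c: "x \<in> carrier G" "y \<in> carrier G" using xy Pc Qc by auto
    have "x [^] m \<otimes> y [^] m = \<one>"
      using eq pow_mult_distrib[OF comm[OF xy] c] by simp
    hence "x [^] m = inv (y [^] m)" using c inv_equality[of "x [^] m" "y [^] m"] by simp
    moreover have "x [^] m \<in> P" "inv (y [^] m) \<in> Q"
      using subgroup_int_pow_closed[OF P(1) xy(1), of "int m"] subgroup_int_pow_closed[OF Q(1) xy(2), of "- int m"] c
      by (simp_all add: int_pow_int int_pow_neg)
    ultimately show ?thesis using PQ[of "x [^] m"] c by (simp add: inv_eq_1_iff)
  qed
  show pel: "p_elems G p = P"
  proof
    show "P \<subseteq> p_elems G p" using ordP Pc by (auto simp: p_elems_def)
    show "p_elems G p \<subseteq> P"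
    proof
      fix g assume "g \<in> p_elems G p"
      then obtain k where g: "g \<in> carrier G" "ord g = p ^ k" by (auto simp: p_elems_def)
      obtain x y where xy: "x \<in> P" "y \<in> Q" "g = x \<otimes> y" using prod[OF g(1)] by blast
      have "y [^] (p ^ k) = \<one>"
        using pow[OF xy(1,2), of "p ^ k"] pow_ord_eq_1[OF g(1)] g(2) xy(3) by simp
      hence "ord y dvd p ^ k" using pow_eq_id Qc[OF xy(2)] by simp
      moreover have "coprime (p ^ k) (ord y)" using ordQ(1)[OF xy(2)] by (simp add: coprime_commute)
      ultimately have "y = \<one>" using one[OF Qc[OF xy(2)], of "p ^ k" "ord y"] by simp
      thus "g \<in> P" using xy Pc by simp
    qed
  qed
  have p'el: "p'_elems G p = Q"
  proof
    show "Q \<subseteq> p'_elems G p" using ordQ Qc by (auto simp: p'_elems_def)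
    show "p'_elems G p \<subseteq> Q"
    proof
      fix g assume "g \<in> p'_elems G p"
      hence g: "g \<in> carrier G" "coprime (ord g) p" by (auto simp: p'_elems_def)
      obtain x y where xy: "x \<in> P" "y \<in> Q" "g = x \<otimes> y" using prod[OF g(1)] by blast
      have "x [^] ord g = \<one>"
        using pow[OF xy(1,2), of "ord g"] pow_ord_eq_1[OF g(1)] xy(3) by simp
      hence "ord x dvd ord g" using pow_eq_id Pc[OF xy(1)] by simp
      moreover obtain k where "ord x = p ^ k" using ordP[OF xy(1)] by blast
      hence "coprime (ord g) (ord x)" using g(2) by simp
      ultimately have "x = \<one>" using one[OF Pc[OF xy(1)], of "ord g" "ord x"] by simp
      thus "g \<in> Q" using xy Qc by simp
    qed
  qed
  fix x y assume xy: "x \<in> P" "y \<in> Q"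
  show "sylow_proj G p (x \<otimes> y) = x"
    unfolding sylow_proj_def pel p'el
  proof (rule the_equality)
    fix h assume "h \<in> P \<and> (\<exists>q\<in>Q. x \<otimes> y = h \<otimes> q)"
    then obtain q where hq: "h \<in> P" "q \<in> Q" "x \<otimes> y = h \<otimes> q" by blast
    have c: "x \<in> carrier G" "y \<in> carrier G" "h \<in> carrier G" "q \<in> carrier G"
      using xy hq Pc Qc by auto
    have "inv h \<otimes> (x \<otimes> y) \<otimes> inv y = inv h \<otimes> (h \<otimes> q) \<otimes> inv y" using hq(3) by simp
    hence eq: "inv h \<otimes> x = q \<otimes> inv y" using c by (simp add: m_assoc)
    have "inv h \<otimes> x \<in> P" using hq(1) xy(1) subgroup.m_closed[OF P(1)] subgroup.m_inv_closed[OF P(1)] by simp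
    moreover have "inv h \<otimes> x \<in> Q"
      unfolding eq using hq(2) xy(2) subgroup.m_closed[OF Q(1)] subgroup.m_inv_closed[OF Q(1)] by simp
    ultimately have "inv h \<otimes> x = \<one>" by (rule PQ)
    hence "h \<otimes> (inv h \<otimes> x) = h \<otimes> \<one>" by simp
    thus "h = x" using c by simp
  qed (use xy in blast)
qed

lemma (in group) generate_commute:
  assumes S: "S \<subseteq> carrier G" and T: "T \<subseteq> carrier G"
    and ST: "\<And>s t. s \<in> S \<Longrightarrow> t \<in> T \<Longrightarrow> s \<otimes> t = t \<otimes> s"
    and x: "x \<in> generate G S" and y: "y \<in> generate G T"
  shows "x \<otimes> y = y \<otimes> x"
proof -
  have c: "x \<in> carrier G" "y \<in> carrier G" using generate_in_carrier S T x y by auto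
  have "gcomm G x y \<in> {\<one>}"
  proof (rule gcomm_generate_mem[OF one_is_normal S T _ x y])
    fix s t assume st: "s \<in> S" "t \<in> T"
    hence "s \<in> carrier G" "t \<in> carrier G" using S T by auto
    thus "gcomm G s t \<in> {\<one>}" using ST[OF st] by (simp add: gcomm_def m_assoc)
  qed
  hence "y \<otimes> (x \<otimes> gcomm G x y) = y \<otimes> x" using c by simp
  thus ?thesis using c by (simp add: gcomm_def m_assoc)
qed

context macdonald
begin

text \<open>\<open>r\<close> and \<open>t\<close> are the idempotents of the Chinese remainder
  theorem for the 3-part \<open>u\<close> and the complementary part \<open>v\<close> of a common
  multiple of the two orders.\<close>

lemma three_part_split:
  assumes "\<bar>\<alpha>\<bar> \<ge> 2" "\<bar>\<beta>\<bar> \<ge> 2"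
  obtains K v r t :: nat
  where "v > 0" "coprime v 3" "[int r = 1] (mod 27)"
    and "A = A [^] int r \<otimes> A [^] int t" "B = B [^] int r \<otimes> B [^] int t"
    and "A [^] int r \<otimes> B [^] int t = B [^] int t \<otimes> A [^] int r"
    and "A [^] int t \<otimes> B [^] int r = B [^] int r \<otimes> A [^] int t"
    and "(A [^] int r) [^] (3 ^ K :: int) = \<one>" "(B [^] int r) [^] (3 ^ K :: int) = \<one>"
    and "(A [^] int t) [^] int v = \<one>" "(B [^] int t) [^] int v = \<one>"
proof -
  interpret swap: macdonald G B A \<beta> \<alpha> by (rule macdonald_swap)
  have ord: "ord A > 0" "ord B > 0" using ord_A_pos[OF assms(1)] swap.ord_A_pos[OF assms(2)] by auto
  define N where "N = ord A * ord B"
  have "N \<noteq> 0" using ord by (simp add: N_def)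
  then obtain v where v: "N = 3 ^ multiplicity 3 N * v" "\<not> 3 dvd v"
    using multiplicity_decompose'[of N 3] by auto
  \<comment> \<open>The summand 3 makes \<open>u\<close> a multiple of 27, whence
    \<open>r = 1\<close> modulo 27: taking \<open>r\<close>-th powers then does not move the
    generators of the models.\<close>
  define K u where "K = multiplicity 3 N + 3" and "u = (3::nat) ^ K"
  have v0: "v > 0" using v \<open>N \<noteq> 0\<close> by (cases v) auto
  have "coprime 3 v" by (rule prime_imp_coprime) (use v(2) in simp_all)
  hence v3: "coprime v 3" by (simp only: coprime_commute)
  have uv: "coprime u v" using \<open>coprime 3 v\<close> unfolding u_def by (simp only: coprime_power_left_iff simp_thms)
  have "N dvd u * v" by (subst v(1)) (simp add: u_def K_def power_add)
  hence A: "ord A dvd u * v" and B: "ord B dvd u * v"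
    unfolding N_def by (auto intro: dvd_mult_left dvd_mult_right)
  obtain r where r: "[r = 1] (mod u)" "[r = 0] (mod v)"
    using binary_chinese_remainder_nat[OF uv] by blast
  obtain t where t: "[t = 0] (mod u)" "[t = 1] (mod v)"
    using binary_chinese_remainder_nat[OF uv] by blast
  have vr: "v dvd r" and ut: "u dvd t" using r(2) t(1) by (simp_all add: cong_0_iff)
  have "[r + t = 1 + 0] (mod u)" "[r + t = 0 + 1] (mod v)"
    using r t by (intro cong_add; simp)+
  hence "[r + t = 1] (mod u * v)" using uv by (simp add: coprime_cong_mult_nat)
  hence rt: "[int r + int t = 1] (mod int (u * v))"
    by (metis cong_int_iff of_nat_1 of_nat_add)
  have Auv: "A [^] int (u * v) = \<one>" and Buv: "B [^] int (u * v) = \<one>"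
    using A B by (simp_all add: int_pow_eq_id del: of_nat_mult)
  have "27 dvd u" unfolding u_def K_def by (simp add: power_add)
  hence "[r = 1] (mod 27)" using r(1) by (metis cong_dvd_modulus_nat)
  hence r27: "[int r = 1] (mod 27)" by (metis cong_int_iff of_nat_1 of_nat_numeral)
  have split: "x = x [^] int r \<otimes> x [^] int t" if "x \<in> carrier G" "x [^] int (u * v) = \<one>" for x
    using int_pow_cong[OF that rt] that(1) by (simp add: int_pow_mult)
  have tor: "(x [^] int i) [^] int w = \<one>" if "x \<in> carrier G" "x [^] int (u * v) = \<one>" "u * v dvd i * w" for x i w
  proof -
    have "int (u * v) dvd int (i * w)" using that(3) by (simp only: int_dvd_int_iff)
    hence "[int i * int w = 0] (mod int (u * v))" by (simp add: cong_0_iff)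
    thus ?thesis using int_pow_cong[OF that(1,2)] that(1) by (simp add: int_pow_pow)
  qed
  have d: "u * v dvd r * u" "u * v dvd t * v" using vr ut by (simp_all add: mult.commute mult_dvd_mono)
  have u: "int u = 3 ^ K" by (simp add: u_def)
  show ?thesis
  proof (rule that[OF v0 v3 r27])
    show "A = A [^] int r \<otimes> A [^] int t" "B = B [^] int r \<otimes> B [^] int t"
      using split Auv Buv by auto
    show "A [^] int r \<otimes> B [^] int t = B [^] int t \<otimes> A [^] int r"
      by (rule coprime_parts_commute[OF ord A B uv vr r(1) ut t(2)])
    show "A [^] int t \<otimes> B [^] int r = B [^] int r \<otimes> A [^] int t"
      by (rule coprime_parts_commute[of v u]) (use ord A B uv vr r ut t in \<open>simp_all add: mult.commute coprime_commute\<close>)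
    show "(A [^] int r) [^] (3 ^ K :: int) = \<one>" "(B [^] int r) [^] (3 ^ K :: int) = \<one>"
      using tor[OF A_closed Auv d(1)] tor[OF B_closed Buv d(1)] unfolding u .
    show "(A [^] int t) [^] int v = \<one>" "(B [^] int t) [^] int v = \<one>"
      using tor[OF A_closed Auv d(2)] tor[OF B_closed Buv d(2)] .
  qed
qed

end

section \<open>The presented group and the theorem\<close>

lemma macdonald_Ggrp:
  shows "macdonald (Ggrp \<alpha> \<beta>) (gA \<alpha> \<beta>) (gB \<alpha> \<beta>) \<alpha> \<beta>"
    and "gcomm (Ggrp \<alpha> \<beta>) (gA \<alpha> \<beta>) (gB \<alpha> \<beta>) = gC \<alpha> \<beta>"
    and "carrier (Ggrp \<alpha> \<beta>) = generate (Ggrp \<alpha> \<beta>) {gA \<alpha> \<beta>, gB \<alpha> \<beta>}"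
proof -
  define R where "R = Grels \<alpha> \<beta>"
  define G where "G = fp_group R"
  define A B where "A = pres_class R wA" and "B = pres_class R wB"
  have defs: "Ggrp \<alpha> \<beta> = G" "gA \<alpha> \<beta> = A" "gB \<alpha> \<beta> = B" "gC \<alpha> \<beta> = pres_class R (wcomm wA wB)"
    by (simp_all add: Ggrp_def gA_def gB_def gC_def G_def A_def B_def R_def)
  interpret group G unfolding G_def by (rule group_fp_group)
  have carr: "pres_class R w \<in> carrier G" for w by (simp add: G_def fp_group_carrier)
  note mult = fp_group_mult[of R, folded G_def] and inv = fp_group_inv[of R, folded G_def]
    and pow = fp_group_int_pow[of R, folded G_def] and one = fp_group_one[of R, folded G_def]
  have comm: "gcomm G (pres_class R u) (pres_class R w) = pres_class R (wcomm u w)" for u w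
    by (simp add: gcomm_def wcomm_def mult inv)
  have conj: "inv\<^bsub>G\<^esub> (pres_class R w) \<otimes>\<^bsub>G\<^esub> pres_class R u \<otimes>\<^bsub>G\<^esub> pres_class R w = pres_class R (wconj u w)" for u w
    by (simp add: wconj_def mult inv)
  have rel: "x \<otimes>\<^bsub>G\<^esub> g = g \<otimes>\<^bsub>G\<^esub> x [^]\<^bsub>G\<^esub> n"
    if r: "wconj u w @ wpow u (- n) \<in> R" and xg: "x = pres_class R u" "g = pres_class R w" for u w n x g
  proof -
    have [simp]: "x \<in> carrier G" "g \<in> carrier G" using carr xg by auto
    have "pres_eq R ([] @ (wconj u w @ wpow u (- n)) @ []) ([] @ [])"
      by (rule pres_eq.rel[OF r])
    hence "pres_class R (wconj u w @ wpow u (- n)) = \<one>\<^bsub>G\<^esub>"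
      by (simp add: one pres_class_eq_iff)
    hence "inv\<^bsub>G\<^esub> g \<otimes>\<^bsub>G\<^esub> x \<otimes>\<^bsub>G\<^esub> g \<otimes>\<^bsub>G\<^esub> inv\<^bsub>G\<^esub> (x [^]\<^bsub>G\<^esub> n) = \<one>\<^bsub>G\<^esub>"
      using pow[of u "- n"] unfolding xg by (simp add: conj mult int_pow_neg carr)
    hence "g \<otimes>\<^bsub>G\<^esub> (inv\<^bsub>G\<^esub> g \<otimes>\<^bsub>G\<^esub> x \<otimes>\<^bsub>G\<^esub> g \<otimes>\<^bsub>G\<^esub> inv\<^bsub>G\<^esub> (x [^]\<^bsub>G\<^esub> n)) \<otimes>\<^bsub>G\<^esub> x [^]\<^bsub>G\<^esub> n = g \<otimes>\<^bsub>G\<^esub> x [^]\<^bsub>G\<^esub> n"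
      by simp
    thus ?thesis by (simp add: m_assoc)
  qed
  have [simp]: "A \<in> carrier G" "B \<in> carrier G" using carr by (simp_all add: A_def B_def)
  have BA: "gcomm G B A = inv\<^bsub>G\<^esub> (gcomm G A B)"
    by (simp add: gcomm_def inv_mult_group m_assoc)
  show "macdonald (Ggrp \<alpha> \<beta>) (gA \<alpha> \<beta>) (gB \<alpha> \<beta>) \<alpha> \<beta>"
    unfolding defs
  proof unfold_locales
    have "wconj wA (wcomm wA wB) @ wpow wA (- \<alpha>) \<in> R" "wconj wB (wcomm wB wA) @ wpow wB (- \<beta>) \<in> R"
      by (simp_all add: R_def Grels_def)
    note rels = this[THEN rel]
    show "A \<otimes>\<^bsub>G\<^esub> gcomm G A B = gcomm G A B \<otimes>\<^bsub>G\<^esub> A [^]\<^bsub>G\<^esub> \<alpha>"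
      by (rule rels(1)) (simp_all add: A_def B_def comm)
    have "B \<otimes>\<^bsub>G\<^esub> gcomm G B A = gcomm G B A \<otimes>\<^bsub>G\<^esub> B [^]\<^bsub>G\<^esub> \<beta>"
      by (rule rels(2)) (simp_all add: A_def B_def comm)
    thus "gcomm G A B \<otimes>\<^bsub>G\<^esub> B = B [^]\<^bsub>G\<^esub> \<beta> \<otimes>\<^bsub>G\<^esub> gcomm G A B"
      unfolding BA by (simp add: intertwine_inv gcomm_closed)
  qed auto
  show "gcomm (Ggrp \<alpha> \<beta>) (gA \<alpha> \<beta>) (gB \<alpha> \<beta>) = gC \<alpha> \<beta>"
    unfolding defs A_def B_def by (rule comm)
  have sub: "subgroup (generate G {A, B}) G" by (rule generate_is_subgroup) simp
  have "pres_class R w \<in> generate G {A, B}" for w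
  proof (induction w)
    case Nil
    show ?case using generate.one[of G "{A, B}"] by (simp add: one)
  next
    case (Cons l w)
    have "pres_class R [l] \<in> generate G {A, B}"
    proof -
      have AB: "A \<in> generate G {A, B}" "B \<in> generate G {A, B}" by (auto intro: generate.incl)
      obtain g i where l: "l = (g, i)" by (cases l)
      have "[l] = (if i then winv (if g then wB else wA) else (if g then wB else wA))"
        by (simp add: l wA_def wB_def winv_def)
      hence "pres_class R [l] = (if i then inv\<^bsub>G\<^esub> (if g then B else A) else (if g then B else A))"
        by (simp add: A_def B_def inv)
      thus ?thesis using AB subgroup.m_inv_closed[OF sub] by simp
    qed
    hence "pres_class R [l] \<otimes>\<^bsub>G\<^esub> pres_class R w \<in> generate G {A, B}"
      using Cons.IH by (rule subgroup.m_closed[OF sub])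
    thus ?case by (simp add: mult)
  qed
  hence "carrier G \<subseteq> generate G {A, B}" by (auto simp: G_def fp_group_carrier)
  thus "carrier (Ggrp \<alpha> \<beta>) = generate (Ggrp \<alpha> \<beta>) {gA \<alpha> \<beta>, gB \<alpha> \<beta>}"
    unfolding defs using subgroup.subset[OF sub] by blast
qed

lemma (in macdonald) Ggrp_hom:
  obtains h where "group_hom (Ggrp \<alpha> \<beta>) G h" "h (gA \<alpha> \<beta>) = A" "h (gB \<alpha> \<beta>) = B"
proof -
  define f where "f = (\<lambda>g. if g then B else A)"
  have f: "range f \<subseteq> carrier G" by (auto simp: f_def)
  note ev = word_eval_append[OF f] word_eval_winv[OF f] word_eval_wpow[OF f]
  have eA: "word_eval G f wA = A" and eB: "word_eval G f wB = B"
    by (simp_all add: word_eval_def wA_def wB_def f_def)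
  have eC: "word_eval G f (wcomm wA wB) = C" "word_eval G f (wcomm wB wA) = inv C"
    by (simp_all add: wcomm_def ev eA eB gcomm_def m_assoc inv_mult_group)
  have "word_eval G f r = \<one>" if "r \<in> Grels \<alpha> \<beta>" for r
  proof -
    have "inv C \<otimes> (A \<otimes> C) \<otimes> inv (A [^] \<alpha>) = \<one>"
      unfolding A_gcomm by (simp add: m_assoc)
    hence 1: "word_eval G f (wconj wA (wcomm wA wB) @ wpow wA (- \<alpha>)) = \<one>"
      by (simp add: wconj_def ev eA eC int_pow_neg m_assoc)
    have "(C \<otimes> B) \<otimes> inv C \<otimes> inv (B [^] \<beta>) = \<one>"
      unfolding gcomm_B by (simp add: m_assoc)
    hence 2: "word_eval G f (wconj wB (wcomm wB wA) @ wpow wB (- \<beta>)) = \<one>"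
      by (simp add: wconj_def ev eB eC int_pow_neg m_assoc)
    show ?thesis using that 1 2 by (auto simp: Grels_def)
  qed
  then obtain h where "group_hom (fp_group (Grels \<alpha> \<beta>)) G h"
    "\<And>w. h (pres_class (Grels \<alpha> \<beta>) w) = word_eval G f w"
    using fp_group_hom[OF f] by metis
  thus ?thesis using that[of h] eA eB by (simp add: Ggrp_def gA_def gB_def)
qed

lemma (in group) ord_eq_prime_power:
  assumes p: "Factorial_Ring.prime p" and x: "x \<in> carrier G"
    and "x [^] (p ^ Suc n) = \<one>" "x [^] (p ^ n) \<noteq> \<one>"
  shows "ord x = p ^ Suc n"
proof -
  obtain k where k: "k \<le> Suc n" "ord x = p ^ k"
    using assms(3) pow_eq_id[OF x] divides_primepow_nat[OF p] by blast
  moreover have "\<not> k \<le> n"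
    using assms(4) pow_eq_id[OF x] k(2) le_imp_power_dvd by metis
  ultimately show ?thesis by (simp add: le_Suc_eq)
qed

lemma macdonald_subgroup:
  assumes "macdonald G a b \<alpha> \<beta>" and P: "subgroup P G" and ab: "a \<in> P" "b \<in> P"
  shows "gcomm (G\<lparr>carrier := P\<rparr>) a b = gcomm G a b" and "macdonald (G\<lparr>carrier := P\<rparr>) a b \<alpha> \<beta>"
proof -
  interpret macdonald G a b \<alpha> \<beta> by fact
  interpret P: group "G\<lparr>carrier := P\<rparr>" by (rule subgroup.subgroup_is_group[OF P group_axioms])
  show comm: "gcomm (G\<lparr>carrier := P\<rparr>) a b = C"
    using ab P by (simp add: gcomm_def)
  show "macdonald (G\<lparr>carrier := P\<rparr>) a b \<alpha> \<beta>"
    by unfold_locales (use ab A_gcomm gcomm_B in \<open>simp_all add: comm flip: int_pow_consistent[OF P]\<close>)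
qed

theorem theorem9p2:
  fixes \<alpha> \<beta> :: int
  assumes "[\<alpha> = 7] (mod 9)" and "[\<beta> = 7] (mod 9)"
    and "multiplicity (3::int) (\<alpha> - \<beta>) = 2"
  defines "G \<equiv> Ggrp \<alpha> \<beta>"
  defines "G3 \<equiv> sylow_of_nilpotent G 3"
  defines "a \<equiv> sylow_proj G 3 (gA \<alpha> \<beta>)"
    and "b \<equiv> sylow_proj G 3 (gB \<alpha> \<beta>)"
    and "c \<equiv> sylow_proj G 3 (gC \<alpha> \<beta>)"
  shows "order G3 = 3 ^ 8 \<and> nilpotency_class G3 = 5 \<and>
         group.ord G3 a = 27 \<and> group.ord G3 b = 27 \<and> group.ord G3 c = 9"
proof -
  define A B where "A = gA \<alpha> \<beta>" and "B = gB \<alpha> \<beta>"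
  interpret macdonald G A B \<alpha> \<beta>
    unfolding G_def A_def B_def by (rule macdonald_Ggrp)
  have C: "gC \<alpha> \<beta> = C" and gen: "carrier G = generate G {A, B}"
    unfolding G_def A_def B_def by (simp_all add: macdonald_Ggrp(2) flip: macdonald_Ggrp(3))
  have large: "\<bar>x\<bar> \<ge> 2" if "[x = 7] (mod 9)" for x :: int
    using that unfolding cong_def by presburger
  have diff: "\<not> 27 dvd \<alpha> - \<beta>"
  proof
    assume "27 dvd \<alpha> - \<beta>"
    hence "(3::int) ^ 3 dvd \<alpha> - \<beta>" by simp
    moreover have "\<alpha> - \<beta> \<noteq> 0" using assms(3) by auto
    ultimately have "3 \<le> multiplicity 3 (\<alpha> - \<beta>)" by (intro multiplicity_geI) auto
    thus False using assms(3) by simp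
  qed
  obtain K v r t :: nat where v: "v > 0" "coprime v 3" and r27: "[int r = 1] (mod 27)"
    and split: "A = A [^]\<^bsub>G\<^esub> int r \<otimes>\<^bsub>G\<^esub> A [^]\<^bsub>G\<^esub> int t" "B = B [^]\<^bsub>G\<^esub> int r \<otimes>\<^bsub>G\<^esub> B [^]\<^bsub>G\<^esub> int t"
    and comm0: "A [^]\<^bsub>G\<^esub> int r \<otimes>\<^bsub>G\<^esub> B [^]\<^bsub>G\<^esub> int t = B [^]\<^bsub>G\<^esub> int t \<otimes>\<^bsub>G\<^esub> A [^]\<^bsub>G\<^esub> int r"
      "A [^]\<^bsub>G\<^esub> int t \<otimes>\<^bsub>G\<^esub> B [^]\<^bsub>G\<^esub> int r = B [^]\<^bsub>G\<^esub> int r \<otimes>\<^bsub>G\<^esub> A [^]\<^bsub>G\<^esub> int t"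
    and tor3: "(A [^]\<^bsub>G\<^esub> int r) [^]\<^bsub>G\<^esub> (3 ^ K :: int) = \<one>\<^bsub>G\<^esub>" "(B [^]\<^bsub>G\<^esub> int r) [^]\<^bsub>G\<^esub> (3 ^ K :: int) = \<one>\<^bsub>G\<^esub>"
    and torv: "(A [^]\<^bsub>G\<^esub> int t) [^]\<^bsub>G\<^esub> int v = \<one>\<^bsub>G\<^esub>" "(B [^]\<^bsub>G\<^esub> int t) [^]\<^bsub>G\<^esub> int v = \<one>\<^bsub>G\<^esub>"
    by (rule three_part_split[OF large[OF assms(1)] large[OF assms(2)]])
  define a3 b3 a' b' where "a3 = A [^]\<^bsub>G\<^esub> int r" and "b3 = B [^]\<^bsub>G\<^esub> int r"
    and "a' = A [^]\<^bsub>G\<^esub> int t" and "b' = B [^]\<^bsub>G\<^esub> int t"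
  note part_defs = a3_def b3_def a'_def b'_def
  have cl [simp]: "a3 \<in> carrier G" "b3 \<in> carrier G" "a' \<in> carrier G" "b' \<in> carrier G"
    by (simp_all add: part_defs)
  have comm: "a3 \<otimes>\<^bsub>G\<^esub> a' = a' \<otimes>\<^bsub>G\<^esub> a3" "a3 \<otimes>\<^bsub>G\<^esub> b' = b' \<otimes>\<^bsub>G\<^esub> a3" "b3 \<otimes>\<^bsub>G\<^esub> a' = a' \<otimes>\<^bsub>G\<^esub> b3" "b3 \<otimes>\<^bsub>G\<^esub> b' = b' \<otimes>\<^bsub>G\<^esub> b3"
    using comm0 by (simp_all add: part_defs add.commute flip: int_pow_mult)
  have AB: "A = a3 \<otimes>\<^bsub>G\<^esub> a'" "B = b3 \<otimes>\<^bsub>G\<^esub> b'" using split by (simp_all add: part_defs)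
  note part = macdonald_part[OF cl AB a3_def b3_def comm]
  have "macdonald G a' b' \<alpha> \<beta>"
    by (rule macdonald_part(2)[OF cl(3,4,1,2) _ _ a'_def b'_def]) (use AB comm in simp_all)
  then interpret m': macdonald G a' b' \<alpha> \<beta> .
  interpret m: macdonald G a3 b3 \<alpha> \<beta> by (rule part(2))
  interpret m3: macdonald3 G a3 b3 \<alpha> \<beta> K
    by unfold_locales (use tor3 assms(1,2) diff in \<open>simp_all add: part_defs\<close>)
  interpret s3: macdonald3 G b3 a3 \<beta> \<alpha> K by (rule m3.macdonald3_swap)
  define c3 where "c3 = gcomm G a3 b3"
  have c3 [simp]: "c3 \<in> carrier G" by (simp add: c3_def)
  have a27: "a3 [^]\<^bsub>G\<^esub> (27::int) = \<one>\<^bsub>G\<^esub>" and b27: "b3 [^]\<^bsub>G\<^esub> (27::int) = \<one>\<^bsub>G\<^esub>" and c9: "c3 [^]\<^bsub>G\<^esub> (9::int) = \<one>\<^bsub>G\<^esub>"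
    using m3.A_27 s3.A_27 m3.C_9 by (simp_all add: c3_def)
  define P Q where "P = generate G {a3, b3}" and "Q = generate G {a', b'}"
  have P: "subgroup P G" and Q: "subgroup Q G"
    unfolding P_def Q_def by (rule generate_is_subgroup; simp)+
  have abP: "a3 \<in> P" "b3 \<in> P" and abQ: "a' \<in> Q" "b' \<in> Q"
    by (auto simp: P_def Q_def intro: generate.incl)
  have gcomm_mem: "gcomm G x y \<in> H" if "subgroup H G" "x \<in> H" "y \<in> H" for x y H
    using that subgroup.m_closed[OF that(1)] subgroup.m_inv_closed[OF that(1)] by (simp add: gcomm_def)
  have cP: "c3 \<in> P" unfolding c3_def by (rule gcomm_mem[OF P abP])
  have PQ: "x \<otimes>\<^bsub>G\<^esub> y = y \<otimes>\<^bsub>G\<^esub> x" if "x \<in> P" "y \<in> Q" for x y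
    by (rule generate_commute[OF _ _ _ that[unfolded P_def Q_def]]) (use comm in auto)
  have prod: "\<exists>x\<in>P. \<exists>y\<in>Q. g = x \<otimes>\<^bsub>G\<^esub> y" if "g \<in> carrier G" for g
    using that unfolding gen
  proof (induction rule: generate.induct)
    case one
    show ?case using subgroup.one_closed[OF P] subgroup.one_closed[OF Q] by force
  next
    case (incl h)
    thus ?case using AB abP abQ by auto
  next
    case (inv h)
    have "inv\<^bsub>G\<^esub> A = inv\<^bsub>G\<^esub> a3 \<otimes>\<^bsub>G\<^esub> inv\<^bsub>G\<^esub> a'" "inv\<^bsub>G\<^esub> B = inv\<^bsub>G\<^esub> b3 \<otimes>\<^bsub>G\<^esub> inv\<^bsub>G\<^esub> b'"
      unfolding AB comm(1,4) by (simp_all add: inv_mult_group)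
    thus ?case
      using inv abP abQ subgroup.m_inv_closed[OF P] subgroup.m_inv_closed[OF Q] by blast
  next
    case (eng g h)
    then obtain x y x' y' where xy: "x \<in> P" "y \<in> Q" "g = x \<otimes>\<^bsub>G\<^esub> y" "x' \<in> P" "y' \<in> Q" "h = x' \<otimes>\<^bsub>G\<^esub> y'" by blast
    have cc: "x \<in> carrier G" "y \<in> carrier G" "x' \<in> carrier G" "y' \<in> carrier G"
      using xy subgroup.mem_carrier[OF P] subgroup.mem_carrier[OF Q] by auto
    have "g \<otimes>\<^bsub>G\<^esub> h = x \<otimes>\<^bsub>G\<^esub> (y \<otimes>\<^bsub>G\<^esub> x') \<otimes>\<^bsub>G\<^esub> y'" using cc by (simp add: xy m_assoc)
    also have "\<dots> = (x \<otimes>\<^bsub>G\<^esub> x') \<otimes>\<^bsub>G\<^esub> (y \<otimes>\<^bsub>G\<^esub> y')" using cc PQ[OF xy(4,2)] by (simp add: m_assoc flip: PQ[OF xy(4,2)])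
    finally show ?case
      using subgroup.m_closed[OF P xy(1,4)] subgroup.m_closed[OF Q xy(2,5)] by blast
  qed
  \<comment> \<open>\<open>a'\<close> and \<open>b'\<close> have orders dividing \<open>v\<close>,
    and so does their commutator, since the primes dividing the order of \<open>a'\<close> divide
    \<open>\<alpha> - 1\<close>. So the order of \<open>Q\<close> divides
    \<open>v ^ 3\<close>.\<close>
  have finQ: "finite Q" and cardQ: "coprime (card Q) 3"
  proof -
    have ord: "ord a' dvd v" "ord b' dvd v" using torv by (simp_all add: int_pow_eq_id part_defs)
    hence pos: "ord a' > 0" "ord b' > 0" using v(1) by (auto intro: Nat.gr0I)
    have "int (ord a') dvd gsum \<alpha> (ord a')"
      by (rule dvd_gsum[OF pos(1)]) (rule m'.prime_dvd_ord_A[OF pos])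
    hence "gcomm G a' b' [^]\<^bsub>G\<^esub> int (ord a') = \<one>\<^bsub>G\<^esub>"
      by (intro m'.C_pow_eq_one) (simp_all add: int_pow_eq_id)
    hence "gcomm G a' b' [^]\<^bsub>G\<^esub> int v = \<one>\<^bsub>G\<^esub>"
      using ord(1) by (auto simp: int_pow_eq_id intro: dvd_trans)
    note card = m'.card_generate_dvd[OF v(1) torv[folded part_defs] this]
    show "finite Q" unfolding Q_def by (rule card(1))
    have "coprime (v ^ 3) 3" using v(2) by simp
    thus "coprime (card Q) 3" unfolding Q_def by (rule coprime_divisors[OF card(2) dvd_refl])
  qed
  define f where "f = (\<lambda>(j::nat, k::nat, i::nat). b3 [^]\<^bsub>G\<^esub> int j \<otimes>\<^bsub>G\<^esub> (c3 [^]\<^bsub>G\<^esub> int k \<otimes>\<^bsub>G\<^esub> a3 [^]\<^bsub>G\<^esub> int i))"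
  define T where "T = {..<27::nat} \<times> {..<9::nat} \<times> {..<27::nat}"
  have surj: "f ` T = P"
  proof
    show "f ` T \<subseteq> P"
      using abP cP subgroup.m_closed[OF P] subgroup_int_pow_closed[OF P] by (auto simp: f_def)
    show "P \<subseteq> f ` T"
    proof
      fix g assume "g \<in> P"
      moreover have "c3 [^]\<^bsub>G\<^esub> int 27 = \<one>\<^bsub>G\<^esub>" using int_pow_pow[of c3 9 3] c9 by simp
      ultimately obtain j k i where jki: "j < 27" "k < 27" "i < 27" "g = f (j, k, i)"
        using m.normal_form[of 27 g] a27 b27 by (auto simp: f_def c3_def P_def)
      \<comment> \<open>The normal form uses one modulus, 27, for all three exponents; that of
        \<open>c3\<close> is reduced further, which leaves \<open>27 * 9 * 27 = 3 ^ 8\<close>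
        triples.\<close>
      have "c3 [^]\<^bsub>G\<^esub> int k = c3 [^]\<^bsub>G\<^esub> int (k mod 9)"
        by (rule int_pow_cong[OF c3 c9]) (simp add: zmod_int cong_def)
      hence "g = f (j, k mod 9, i)" using jki(4) by (simp add: f_def)
      thus "g \<in> f ` T" using jki by (auto simp: T_def)
    qed
  qed
  \<comment> \<open>With the powers of \<open>b3\<close> collected on one side, the first model
    determines \<open>k\<close> and \<open>i\<close>. What remains is an equality of powers of
    \<open>b3\<close>, settled by the mirrored model, in which \<open>b3\<close> acts as the
    generator of order 27.\<close>
  have inj: "inj_on f T"
  proof (rule inj_onI)
    fix p p' assume pp: "p \<in> T" "p' \<in> T" "f p = f p'"
    obtain j k i j' k' i' where p: "p = (j, k, i)" "p' = (j', k', i')" by (cases p, cases p')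
    have T: "(j, k, i) \<in> T" "(j', k', i') \<in> T" and eq: "f (j, k, i) = f (j', k', i')"
      using pp unfolding p .
    obtain H1 :: "(int \<times> int \<Rightarrow> int \<times> int) monoid" and x1 y1
      where H1: "macdonald H1 x1 y1 \<alpha> \<beta>" "x1 [^]\<^bsub>H1\<^esub> (27::int) = \<one>\<^bsub>H1\<^esub>" "y1 [^]\<^bsub>H1\<^esub> (27::int) = \<one>\<^bsub>H1\<^esub>"
        "\<And>i k l (j::int). gcomm H1 x1 y1 [^]\<^bsub>H1\<^esub> int k \<otimes>\<^bsub>H1\<^esub> x1 [^]\<^bsub>H1\<^esub> int i = y1 [^]\<^bsub>H1\<^esub> j \<otimes>\<^bsub>H1\<^esub> gcomm H1 x1 y1 [^]\<^bsub>H1\<^esub> int l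
          \<Longrightarrow> [k = l] (mod 9) \<and> 27 dvd i"
      using macdonald_model[OF assms(1,2)] by metis
    interpret H1: macdonald H1 x1 y1 \<alpha> \<beta> by (rule H1(1))
    obtain h1 where h1: "group_hom G H1 h1" "h1 A = x1" "h1 B = y1"
      unfolding G_def A_def B_def by (rule H1.Ggrp_hom)
    interpret h1: group_hom G H1 h1 by (rule h1(1))
    \<comment> \<open>Because of this the 3-parts have the same images in the models as
      \<open>A\<close> and \<open>B\<close> themselves.\<close>
    have pow_r: "x [^]\<^bsub>H\<^esub> int r = x" if "group H" "x \<in> carrier H" "x [^]\<^bsub>H\<^esub> (27::int) = \<one>\<^bsub>H\<^esub>"
      for H :: "(int \<times> int \<Rightarrow> int \<times> int) monoid" and x
      using group.int_pow_cong[OF that r27] group.int_pow_1[OF that(1,2)] by simp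
    have h1a: "h1 a3 = x1" and h1b: "h1 b3 = y1"
      using pow_r[OF H1.group_axioms] H1(2,3) h1 by (simp_all add: part_defs h1.hom_int_pow)
    have h1c: "h1 c3 = gcomm H1 x1 y1"
      by (simp add: c3_def gcomm_def h1.hom_inv h1a h1b)
    define d where "d = nat ((int i - int i') mod 27)"
    have "c3 [^]\<^bsub>G\<^esub> int k \<otimes>\<^bsub>G\<^esub> a3 [^]\<^bsub>G\<^esub> (int i - int i') = b3 [^]\<^bsub>G\<^esub> (int j' - int j) \<otimes>\<^bsub>G\<^esub> c3 [^]\<^bsub>G\<^esub> int k'"
    proof -
      have "b3 [^]\<^bsub>G\<^esub> (- int j) \<otimes>\<^bsub>G\<^esub> f (j, k, i) \<otimes>\<^bsub>G\<^esub> a3 [^]\<^bsub>G\<^esub> (- int i') = b3 [^]\<^bsub>G\<^esub> (- int j) \<otimes>\<^bsub>G\<^esub> f (j', k', i') \<otimes>\<^bsub>G\<^esub> a3 [^]\<^bsub>G\<^esub> (- int i')"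
        using eq by simp
      thus ?thesis by (simp add: f_def m_assoc int_pow_mult_assoc flip: int_pow_mult)
    qed
    also have "a3 [^]\<^bsub>G\<^esub> (int i - int i') = a3 [^]\<^bsub>G\<^esub> int d"
      by (rule int_pow_cong[OF cl(1) a27]) (simp add: d_def cong_def)
    finally have "h1 (c3 [^]\<^bsub>G\<^esub> int k \<otimes>\<^bsub>G\<^esub> a3 [^]\<^bsub>G\<^esub> int d) = h1 (b3 [^]\<^bsub>G\<^esub> (int j' - int j) \<otimes>\<^bsub>G\<^esub> c3 [^]\<^bsub>G\<^esub> int k')"
      by simp
    hence "[k = k'] (mod 9) \<and> 27 dvd d"
      by (intro H1(4)[of k d "int j' - int j" k']) (simp add: h1.hom_int_pow h1a h1b h1c)
    hence kk: "k = k'" and d0: "27 dvd d" using T by (simp_all add: T_def cong_def)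
    have ii: "i = i'"
    proof -
      have "d < 27" by (simp add: d_def nat_less_iff)
      hence "d = 0" using d0 by (auto dest: dvd_imp_le)
      hence "(int i - int i') mod 27 = 0" using pos_mod_sign[of 27 "int i - int i'"] by (simp add: d_def)
      hence "int i mod 27 = int i' mod 27" by (simp add: mod_eq_dvd_iff mod_0_imp_dvd)
      thus ?thesis using T by (simp add: T_def)
    qed
    obtain H2 :: "(int \<times> int \<Rightarrow> int \<times> int) monoid" and x2 y2
      where H2: "macdonald H2 x2 y2 \<beta> \<alpha>" "x2 [^]\<^bsub>H2\<^esub> (27::int) = \<one>\<^bsub>H2\<^esub>" "y2 [^]\<^bsub>H2\<^esub> (27::int) = \<one>\<^bsub>H2\<^esub>"
        "\<And>i k l (j::int). gcomm H2 x2 y2 [^]\<^bsub>H2\<^esub> int k \<otimes>\<^bsub>H2\<^esub> x2 [^]\<^bsub>H2\<^esub> int i = y2 [^]\<^bsub>H2\<^esub> j \<otimes>\<^bsub>H2\<^esub> gcomm H2 x2 y2 [^]\<^bsub>H2\<^esub> int l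
          \<Longrightarrow> [k = l] (mod 9) \<and> 27 dvd i"
      using macdonald_model[OF assms(2,1)] by metis
    interpret H2': macdonald H2 x2 y2 \<beta> \<alpha> by (rule H2(1))
    interpret H2: macdonald H2 y2 x2 \<alpha> \<beta> by (rule H2'.macdonald_swap)
    obtain h2 where h2: "group_hom G H2 h2" "h2 A = y2" "h2 B = x2"
      unfolding G_def A_def B_def by (rule H2.Ggrp_hom)
    interpret h2: group_hom G H2 h2 by (rule h2(1))
    have h2b: "h2 b3 = x2"
      using pow_r[OF H2'.group_axioms] H2(2,3) h2 by (simp add: part_defs h2.hom_int_pow)
    define d2 where "d2 = nat ((int j - int j') mod 27)"
    have "b3 [^]\<^bsub>G\<^esub> int j = b3 [^]\<^bsub>G\<^esub> int j'" using eq by (simp add: f_def kk ii)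
    hence "b3 [^]\<^bsub>G\<^esub> (int j - int j') = \<one>\<^bsub>G\<^esub>" by (simp add: int_pow_diff)
    also have "b3 [^]\<^bsub>G\<^esub> (int j - int j') = b3 [^]\<^bsub>G\<^esub> int d2"
      by (rule int_pow_cong[OF cl(2) b27]) (simp add: d2_def cong_def)
    finally have "h2 (b3 [^]\<^bsub>G\<^esub> int d2) = h2 \<one>\<^bsub>G\<^esub>" by simp
    hence "[0::nat = 0] (mod 9) \<and> 27 dvd d2"
      by (intro H2(4)[of 0 d2 0 0]) (simp add: h2.hom_int_pow h2b)
    moreover have "d2 < 27" by (simp add: d2_def nat_less_iff)
    ultimately have "d2 = 0" by (auto dest: dvd_imp_le)
    hence "(int j - int j') mod 27 = 0" using pos_mod_sign[of 27 "int j - int j'"] by (simp add: d2_def)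
    hence "int j mod 27 = int j' mod 27" by (simp add: mod_eq_dvd_iff mod_0_imp_dvd)
    hence "j = j'" using T by (simp add: T_def)
    thus "p = p'" using kk ii p by simp
  qed
  have "card P = card T" unfolding surj[symmetric] by (rule card_image[OF inj])
  hence cardP: "card P = 3 ^ 8" by (simp add: T_def card_cartesian_product)
  have f0: "f p \<noteq> \<one>\<^bsub>G\<^esub>" if "p \<in> T" "p \<noteq> (0, 0, 0)" for p
  proof -
    have "f (0, 0, 0) = \<one>\<^bsub>G\<^esub>" by (simp add: f_def)
    moreover have "(0, 0, 0) \<in> T" by (simp add: T_def)
    ultimately show ?thesis using inj_onD[OF inj, of p "(0, 0, 0)"] that by auto
  qed
  \<comment> \<open>Uniqueness of normal forms also shows that the bounds on the orders are
    sharp.\<close>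
  have a9: "a3 [^]\<^bsub>G\<^esub> (9::int) \<noteq> \<one>\<^bsub>G\<^esub>" and b9: "b3 [^]\<^bsub>G\<^esub> (9::int) \<noteq> \<one>\<^bsub>G\<^esub>" and c3': "c3 [^]\<^bsub>G\<^esub> (3::int) \<noteq> \<one>\<^bsub>G\<^esub>"
    using f0[of "(0, 0, 9)"] f0[of "(9, 0, 0)"] f0[of "(0, 3, 0)"] by (simp_all add: f_def T_def)
  have three: "Factorial_Ring.prime (3::nat)" by simp
  have pel: "p_elems G 3 = P"
    by (rule sylow_of_direct_product(1)[OF three P cardP Q finQ cardQ]) (fact PQ prod)+
  have proj: "sylow_proj G 3 (x \<otimes>\<^bsub>G\<^esub> y) = x" if "x \<in> P" "y \<in> Q" for x y
    by (rule sylow_of_direct_product(2)[OF three P cardP Q finQ cardQ]) (fact PQ prod that)+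
  have G3: "G3 = G\<lparr>carrier := P\<rparr>"
    unfolding G3_def sylow_of_nilpotent_def pel ..
  have abc: "a = a3" "b = b3" "c = c3"
    unfolding a_def b_def c_def C A_def[symmetric] B_def[symmetric]
    using proj[OF abP(1) abQ(1)] proj[OF abP(2) abQ(2)] proj[OF cP gcomm_mem[OF Q abQ]] AB part(1)
    by (simp_all add: c3_def)
  interpret G3: macdonald G3 a3 b3 \<alpha> \<beta>
    unfolding G3 by (rule macdonald_subgroup(2)[OF part(2) P abP])
  have gc3: "gcomm G3 a3 b3 = c3"
    unfolding G3 c3_def by (rule macdonald_subgroup(1)[OF part(2) P abP])
  have pow3: "x [^]\<^bsub>G3\<^esub> i = x [^]\<^bsub>G\<^esub> i" if "x \<in> P" for x and i :: int
    unfolding G3 using int_pow_consistent[OF P that] by simp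
  have one3: "\<one>\<^bsub>G3\<^esub> = \<one>\<^bsub>G\<^esub>" by (simp add: G3)
  have carr3: "carrier G3 = P" by (simp add: G3)
  have "generate G3 {a3, b3} = P"
    unfolding G3 P_def using generate_consistent[OF _ P, of "{a3, b3}"] abP by (simp add: P_def)
  hence gen3: "carrier G3 = generate G3 {a3, b3}" by (simp add: carr3)
  have "nilpotency_class G3 = 5"
    using G3.nilpotency_class_5[OF gen3] a27 b27 c9 a9 assms(1,2) abP cP by (simp add: pow3 one3 gc3)
  moreover have ord3: "group.ord G3 x = 3 ^ Suc n"
    if "x \<in> P" "x [^]\<^bsub>G\<^esub> (3 ^ Suc n :: int) = \<one>\<^bsub>G\<^esub>" "x [^]\<^bsub>G\<^esub> (3 ^ n :: int) \<noteq> \<one>\<^bsub>G\<^esub>" for x n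
  proof (rule G3.ord_eq_prime_power[OF three])
    show "x \<in> carrier G3" using that(1) by (simp add: carr3)
    have "x [^]\<^bsub>G3\<^esub> m = x [^]\<^bsub>G\<^esub> int m" for m :: nat
      using pow3[OF that(1), of "int m"] int_pow_int[of G3 x m] by simp
    thus "x [^]\<^bsub>G3\<^esub> ((3::nat) ^ Suc n) = \<one>\<^bsub>G3\<^esub>" "x [^]\<^bsub>G3\<^esub> ((3::nat) ^ n) \<noteq> \<one>\<^bsub>G3\<^esub>"
      using that(2,3) by (simp_all add: one3)
  qed
  have "group.ord G3 a3 = 27" "group.ord G3 b3 = 27" "group.ord G3 c3 = 9"
    using ord3[OF abP(1), of 2] ord3[OF abP(2), of 2] ord3[OF cP, of 1] a27 b27 c9 a9 b9 c3' by simp_all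
  moreover have "order G3 = 3 ^ 8" using cardP by (simp add: order_def carr3)
  ultimately show ?thesis by (simp add: abc)
qed

end
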